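(* Let $G$ be a finite simple group with $\kappa_{\mathcal P}(G)=\kappa_{\mathcal P}(L_2(7))$. Then $G\cong L_2(7)$. That is, $L_2(7)$ is $\kappa_{\mathcal P}$-recognizable in the class of all finite simple groups.
   Context: The power graph $\mathcal{P}(G)$ of a finite group $G$ has vertex set $G$, two distinct elements being adjacent when one is a power of the other. $\kappa_{\mathcal P}(G)$ denotes the number of spanning trees of $\mathcal{P}(G)$. $L_2(7)=\mathrm{PSL}(2,7)$. *)

theory Defs
  imports "HOL-Algebra.SimpleGroups" "HOL-Algebra.Coset"
begin

section \<open>Simple graphs given by a vertex set and a symmetric adjacency relation\<close>

text \<open>Edges of the graph (V, adj): two-element sets {x,y} of vertices with adj x y.\<close>
definition graph_edges :: "'a set \<Rightarrow> ('a \<Rightarrow> 'a \<Rightarrow> bool) \<Rightarrow> 'a set set" where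
  "graph_edges V adj = {{x, y} | x y. x \<in> V \<and> y \<in> V \<and> x \<noteq> y \<and> adj x y}"

text \<open>Connectivity of the graph with vertex set V and edge set T (a set of 2-sets).\<close>
definition edge_rel :: "'a set set \<Rightarrow> ('a \<times> 'a) set" where
  "edge_rel T = {(x, y). {x, y} \<in> T \<and> x \<noteq> y}"

definition connected_by :: "'a set \<Rightarrow> 'a set set \<Rightarrow> bool" where
  "connected_by V T \<longleftrightarrow> (\<forall>x\<in>V. \<forall>y\<in>V. (x, y) \<in> (edge_rel T)\<^sup>*)"

text \<open>A tree on V with edge set T: all edges are 2-subsets of V, the graph is connected,
  and it is acyclic, i.e. every edge is a bridge (removing it disconnects its endpoints).\<close>
definition is_tree_on :: "'a set \<Rightarrow> 'a set set \<Rightarrow> bool" where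
  "is_tree_on V T \<longleftrightarrow>
     (\<forall>e\<in>T. \<exists>x y. e = {x, y} \<and> x \<in> V \<and> y \<in> V \<and> x \<noteq> y) \<and>
     connected_by V T \<and>
     (\<forall>x y. {x, y} \<in> T \<and> x \<noteq> y \<longrightarrow> (x, y) \<notin> (edge_rel (T - {{x, y}}))\<^sup>*)"

definition spanning_trees :: "'a set \<Rightarrow> ('a \<Rightarrow> 'a \<Rightarrow> bool) \<Rightarrow> 'a set set set" where
  "spanning_trees V adj = {T. T \<subseteq> graph_edges V adj \<and> is_tree_on V T}"

definition num_spanning_trees :: "'a set \<Rightarrow> ('a \<Rightarrow> 'a \<Rightarrow> bool) \<Rightarrow> nat" where
  "num_spanning_trees V adj = card (spanning_trees V adj)"

section \<open>Power graph\<close>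

definition power_adj :: "('a, 'b) monoid_scheme \<Rightarrow> 'a \<Rightarrow> 'a \<Rightarrow> bool" where
  "power_adj G x y \<longleftrightarrow> x \<noteq> y \<and>
     ((\<exists>n::nat. y = x [^]\<^bsub>G\<^esub> n) \<or> (\<exists>n::nat. x = y [^]\<^bsub>G\<^esub> n))"

definition kappa_P :: "('a, 'b) monoid_scheme \<Rightarrow> nat" where
  "kappa_P G = num_spanning_trees (carrier G) (power_adj G)"

section \<open>L_2(7) = PSL(2,7)\<close>

text \<open>SL(2,7): matrices (a,b,c,d) = [[a,b],[c,d]] with entries in {0..6} (integers mod 7),
  determinant 1 mod 7.\<close>
definition mat2_mult_mod7 :: "int \<times> int \<times> int \<times> int \<Rightarrow> int \<times> int \<times> int \<times> int \<Rightarrow> int \<times> int \<times> int \<times> int" where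
  "mat2_mult_mod7 m n = (case m of (a, b, c, d) \<Rightarrow> case n of (a', b', c', d') \<Rightarrow>
       ((a * a' + b * c') mod 7, (a * b' + b * d') mod 7,
        (c * a' + d * c') mod 7, (c * b' + d * d') mod 7))"

definition SL2_7 :: "(int \<times> int \<times> int \<times> int) monoid" where
  "SL2_7 = \<lparr> carrier = {(a, b, c, d) | a b c d. a \<in> {0..6} \<and> b \<in> {0..6} \<and> c \<in> {0..6} \<and> d \<in> {0..6}
                                   \<and> (a * d - b * c) mod 7 = 1},
             monoid.mult = mat2_mult_mod7,
             monoid.one = (1, 0, 0, 1) \<rparr>"

text \<open>Centre {I, -I} of SL(2,7).\<close>
definition Z_SL2_7 :: "(int \<times> int \<times> int \<times> int) set" where
  "Z_SL2_7 = {(1, 0, 0, 1), (6, 0, 0, 6)}"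

definition PSL2_7 :: "(int \<times> int \<times> int \<times> int) set monoid" where
  "PSL2_7 = SL2_7 Mod Z_SL2_7"

end

theory Submission imports Defs "HOL-Algebra.Sylow" "HOL-Algebra.Group_Action"
  "HOL-Algebra.Multiplicative_Group" "HOL-Combinatorics.Permutations" "HOL-Library.FuncSet"
  "HOL-Number_Theory.Cong"
begin

text \<open>Rooting at the identity identifies spanning trees of the power graph with parent maps without
  cycles. Since \<open>PSL2_7\<close> is partitioned by its 57 maximal cyclic subgroups \<open>C\<^sub>7\<close> (8), \<open>C\<^sub>3\<close> (28) and
  \<open>C\<^sub>4\<close> (21), its count is \<open>7\<^sup>4\<^sup>0 3\<^sup>2\<^sup>8 4\<^sup>4\<^sup>2\<close>. Suppose \<open>G\<close> is simple with the same count.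

  Two vertices with the same closed neighbourhood \<open>N\<close> force \<open>card N\<close> to divide the count, so every odd
  prime dividing the order of \<open>G\<close> is 3 or 7. Joining each element to its inverse gives a factor 3 for
  every pair \<open>{x, x\<^sup>-\<^sup>1}\<close> with \<open>x\<^sup>2 \<noteq> 1\<close>, hence at most 302 elements outside \<open>S = {x. x\<^sup>2 = 1}\<close>; all
  centralizers have index at least 5, which bounds \<open>S\<close> as well, and the order of \<open>G\<close> is below 576. Sylow
  theory and actions on few cosets exclude the orders \<open>2\<^sup>a 3\<^sup>b\<close>. Each Sylow 7-subgroup contributes a
  factor \<open>7\<^sup>5\<close>, so there are exactly eight of them, and \<open>G\<close> acts on them as on a projective line. The
  stabilizer of two points has order 3, so the order is 168, and \<open>G\<close> satisfies the relations of a Bruhat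
  decomposition of \<open>PSL2_7\<close>. These bound the subgroup of \<open>G \<times> PSL2_7\<close> generated by matching generators
  by 168 elements, so that this subgroup is the graph of an isomorphism.\<close>

section \<open>Spanning trees and parent maps\<close>

text \<open>Every estimate rests on two properties of parent maps: their set grows with the
  neighbourhoods, and it factors over blocks that meet only in the identity. Discarding edges
  therefore gives lower bounds, in which a clique of n nonidentity elements contributes Cayley's
  number \<open>(n + 1) ^ (n - 1)\<close>; this is the source of the 3 for a pair and of
  \<open>7 ^ 5\<close> for a subgroup of order 7. The figure 302 is 2 * 151, since
  \<open>3 ^ 152\<close> exceeds the given count. Indices below 5 are impossible because G would
  embed in the symmetric group on four points, and 24 vertices carry too few trees. The bound 576 =
  2^6 * 3^2 limits the power of 2 to 2^5 as soon as 9 divides the order. The obstacle at the end is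
  that order 168 together with a doubly transitive action on eight points does not determine the
  group: the affine semilinear group over the field with eight elements acts in this way too, and
  simplicity has to be invoked against it. In the same way parity excludes the larger torus of
  PGL(2,7).\<close>

definition parent_maps :: "'a set \<Rightarrow> ('a \<Rightarrow> 'a set) \<Rightarrow> ('a \<Rightarrow> 'a) set" where
  "parent_maps S N = {f \<in> Pi\<^sub>E S N. \<forall>A\<subseteq>S. A \<noteq> {} \<longrightarrow> \<not> f ` A \<subseteq> A}"

lemma parent_mapsI:
  assumes "f \<in> Pi\<^sub>E S N" and "\<And>A. A \<subseteq> S \<Longrightarrow> A \<noteq> {} \<Longrightarrow> f ` A \<subseteq> A \<Longrightarrow> False"
  shows "f \<in> parent_maps S N"
  using assms unfolding parent_maps_def by blast

lemma parent_maps_PiE: "f \<in> parent_maps S N \<Longrightarrow> f \<in> Pi\<^sub>E S N"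
  by (simp add: parent_maps_def)

lemma parent_maps_mem: "f \<in> parent_maps S N \<Longrightarrow> x \<in> S \<Longrightarrow> f x \<in> N x"
  unfolding parent_maps_def by (auto dest: PiE_mem)

lemma parent_maps_no_invariant:
  "f \<in> parent_maps S N \<Longrightarrow> A \<subseteq> S \<Longrightarrow> f ` A \<subseteq> A \<Longrightarrow> A = {}"
  unfolding parent_maps_def by blast

text \<open>The vertices violating \<open>P\<close> would be mapped into themselves by
  \<open>f\<close>. Expressing acyclicity as the absence of nonempty invariant sets yields this
  induction towards the root without any mention of path lengths.\<close>

lemma parent_maps_induct [consumes 2, case_names step]:
  assumes f: "f \<in> parent_maps S N" and x: "x \<in> S"
    and step: "\<And>x. x \<in> S \<Longrightarrow> (f x \<in> S \<Longrightarrow> P (f x)) \<Longrightarrow> P x"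
  shows "P x"
proof (rule ccontr)
  assume "\<not> P x"
  have "{x \<in> S. \<not> P x} = {}"
    by (rule parent_maps_no_invariant[OF f]) (use step in auto)
  with \<open>\<not> P x\<close> x show False by blast
qed

definition parent_edges :: "'a set \<Rightarrow> ('a \<Rightarrow> 'a) \<Rightarrow> 'a set set" where
  "parent_edges S f = (\<lambda>v. {v, f v}) ` S"

lemma sym_edge_rel: "sym (edge_rel T)"
  by (auto simp: sym_def edge_rel_def insert_commute)

lemma sym_edge_rel_rtrancl: "(x, y) \<in> (edge_rel T)\<^sup>* \<Longrightarrow> (y, x) \<in> (edge_rel T)\<^sup>*"
  using sym_rtrancl[OF sym_edge_rel] by (meson symD)

context
  fixes V :: "'a set" and adj :: "'a \<Rightarrow> 'a \<Rightarrow> bool" and r :: 'a and N :: "'a \<Rightarrow> 'a set"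
  assumes r: "r \<in> V" and adj_sym: "\<And>x y. adj x y \<Longrightarrow> adj y x"
    and N: "\<And>v. v \<in> V - {r} \<Longrightarrow> N v = {w \<in> V. w \<noteq> v \<and> adj v w}"
begin

lemma parent_edges_connected:
  assumes f: "f \<in> parent_maps (V - {r}) N"
  shows "connected_by V (parent_edges (V - {r}) f)"
proof -
  let ?R = "edge_rel (parent_edges (V - {r}) f)"
  have "(x, r) \<in> ?R\<^sup>*" if "x \<in> V - {r}" for x
    using f that
  proof (induction rule: parent_maps_induct)
    case (step x)
    have fx: "f x \<in> V" "f x \<noteq> x"
      using parent_maps_mem[OF f step(1)] N[OF step(1)] by auto
    then have "(x, f x) \<in> ?R"
      using step(1) by (auto simp: edge_rel_def parent_edges_def)
    moreover have "(f x, r) \<in> ?R\<^sup>*"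
      using step(2) fx by (cases "f x = r") auto
    ultimately show ?case by (rule converse_rtrancl_into_rtrancl)
  qed
  then have "(x, r) \<in> ?R\<^sup>*" if "x \<in> V" for x
    using that by (cases "x = r") auto
  then show ?thesis
    unfolding connected_by_def using sym_edge_rel_rtrancl rtrancl_trans by metis
qed

text \<open>Let \<open>D\<close> consist of \<open>v\<close> and its descendants. The edge from
  \<open>v\<close> to \<open>f v\<close> is the only one that leaves \<open>D\<close>, and
  \<open>f v\<close> lies outside \<open>D\<close> because otherwise \<open>D\<close> would be
  invariant under \<open>f\<close>.\<close>

lemma parent_edges_bridge:
  assumes f: "f \<in> parent_maps (V - {r}) N" and v: "v \<in> V - {r}"
  shows "(v, f v) \<notin> (edge_rel (parent_edges (V - {r}) f - {{v, f v}}))\<^sup>*"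
proof
  let ?S = "V - {r}"
  let ?E = "parent_edges ?S f - {{v, f v}}"
  let ?F = "{(z, f z) | z. z \<in> ?S}"
  define D where "D = {z. (z, v) \<in> ?F\<^sup>*}"
  have fwd: "f z \<in> D" if "z \<in> D" "z \<noteq> v" for z
    using that unfolding D_def by (auto elim: converse_rtranclE)
  have bwd: "z \<in> D" if "f z \<in> D" "z \<in> ?S" for z
    using that unfolding D_def by (auto intro: converse_rtrancl_into_rtrancl)
  have DS: "D \<subseteq> ?S"
  proof
    fix z assume "z \<in> D"
    then have "(z, v) \<in> ?F\<^sup>*" by (simp add: D_def)
    then show "z \<in> ?S" using v by (cases rule: converse_rtranclE) auto
  qed
  have vD: "v \<in> D" by (simp add: D_def)
  have fvD: "f v \<notin> D"
  proof
    assume "f v \<in> D"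
    then have "f ` D \<subseteq> D" using fwd by blast
    then show False using parent_maps_no_invariant[OF f DS] vD by blast
  qed
  have closed: "b \<in> D" if "(a, b) \<in> edge_rel ?E" "a \<in> D" for a b
  proof -
    from that(1) have "{a, b} \<in> parent_edges ?S f" "{a, b} \<noteq> {v, f v}"
      by (simp_all add: edge_rel_def)
    then obtain z where z: "z \<in> ?S" "{a, b} = {z, f z}" "{a, b} \<noteq> {v, f v}"
      by (metis (no_types, lifting) imageE parent_edges_def)
    then have "z \<noteq> v" by auto
    from z(2) consider "a = z" "b = f z" | "b = z" "a = f z" by (auto simp: doubleton_eq_iff)
    then show ?thesis using fwd[of z] bwd[of z] \<open>z \<noteq> v\<close> z(1) that(2) by cases simp_all
  qed
  assume "(v, f v) \<in> (edge_rel ?E)\<^sup>*"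
  then have "f v \<in> D"
    by (rule rtrancl_induct[where P = "\<lambda>z. z \<in> D"]) (use vD closed in simp_all)
  with fvD show False by contradiction
qed

lemma parent_edges_spanning_tree:
  assumes f: "f \<in> parent_maps (V - {r}) N"
  shows "parent_edges (V - {r}) f \<in> spanning_trees V adj"
proof -
  let ?S = "V - {r}"
  have fv: "f v \<in> V \<and> f v \<noteq> v \<and> adj v (f v)" if "v \<in> ?S" for v
    using parent_maps_mem[OF f that] N[OF that] by auto
  have bridge: "(x, y) \<notin> (edge_rel (parent_edges ?S f - {{x, y}}))\<^sup>*"
    if xy: "{x, y} \<in> parent_edges ?S f" for x y
  proof -
    from xy obtain v where v: "v \<in> ?S" "{x, y} = {v, f v}" by (auto simp: parent_edges_def)
    then consider "x = v" "y = f v" | "y = v" "x = f v" by (auto simp: doubleton_eq_iff)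
    then show ?thesis
    proof cases
      case 1
      then show ?thesis using parent_edges_bridge[OF f v(1)] by simp
    next
      case 2
      then show ?thesis
        using parent_edges_bridge[OF f v(1)] sym_edge_rel_rtrancl v(2) by metis
    qed
  qed
  have sub: "parent_edges ?S f \<subseteq> graph_edges V adj"
  proof
    fix e assume "e \<in> parent_edges ?S f"
    then obtain v where "v \<in> ?S" "e = {v, f v}" by (auto simp: parent_edges_def)
    then show "e \<in> graph_edges V adj"
      using fv[of v] unfolding graph_edges_def by (metis (mono_tags, lifting) DiffD1 mem_Collect_eq)
  qed
  then have "\<forall>e\<in>parent_edges ?S f. \<exists>x y. e = {x, y} \<and> x \<in> V \<and> y \<in> V \<and> x \<noteq> y"
    unfolding graph_edges_def by blast
  then show ?thesis
    using parent_edges_connected[OF f] sub bridge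
    by (simp add: spanning_trees_def is_tree_on_def)
qed

text \<open>Suppose \<open>f x\<close> and \<open>g x\<close> differ. The edge from \<open>x\<close>
  to \<open>g x\<close> must then be the parent edge of \<open>g x\<close> under \<open>f\<close>,
  so \<open>f (g x) = x\<close>; the induction hypothesis at \<open>g x\<close> turns this into a
  2-cycle of \<open>g\<close>.\<close>

lemma parent_edges_inj: "inj_on (parent_edges (V - {r})) (parent_maps (V - {r}) N)"
proof (rule inj_onI)
  let ?S = "V - {r}"
  fix f g assume f: "f \<in> parent_maps ?S N" and g: "g \<in> parent_maps ?S N"
    and eq: "parent_edges ?S f = parent_edges ?S g"
  have "f x = g x" if "x \<in> ?S" for x
    using g that
  proof (induction rule: parent_maps_induct)
    case (step x)
    show ?case
    proof (rule ccontr)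
      assume ne: "f x \<noteq> g x"
      have "{x, g x} \<in> parent_edges ?S f"
        using step(1) unfolding eq by (auto simp: parent_edges_def)
      then obtain z where "z \<in> ?S" "{x, g x} = {z, f z}" by (auto simp: parent_edges_def)
      with ne have "g x \<in> ?S" "f (g x) = x" by (auto simp: doubleton_eq_iff)
      with step(2) have "g ` {x, g x} \<subseteq> {x, g x}" by auto
      with parent_maps_no_invariant[OF g, of "{x, g x}"] step(1) \<open>g x \<in> ?S\<close> show False by auto
    qed
  qed
  then show "f = g"
    using PiE_ext[OF parent_maps_PiE[OF f] parent_maps_PiE[OF g]] by blast
qed

text \<open>Each vertex takes as parent a neighbour closer to the root; a point of least distance
  shows that no set is invariant. The parent edges already connect everything, so a further edge of
  \<open>T\<close> would not be a bridge.\<close>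

lemma spanning_tree_parent_edges:
  assumes T: "T \<in> spanning_trees V adj"
  shows "T \<in> parent_edges (V - {r}) ` parent_maps (V - {r}) N"
proof -
  let ?S = "V - {r}" and ?R = "edge_rel T"
  have conn: "connected_by V T" and sub: "T \<subseteq> graph_edges V adj"
    and bridge: "\<And>x y. {x, y} \<in> T \<Longrightarrow> x \<noteq> y \<Longrightarrow> (x, y) \<notin> (edge_rel (T - {{x, y}}))\<^sup>*"
    using T unfolding spanning_trees_def is_tree_on_def by auto
  define d where "d v = (LEAST n. (v, r) \<in> ?R ^^ n)" for v
  have ex: "\<exists>u. (v, u) \<in> ?R \<and> d u < d v" if v: "v \<in> ?S" for v
  proof -
    have "(v, r) \<in> ?R\<^sup>*" using conn v r by (auto simp: connected_by_def)
    then have "\<exists>n. (v, r) \<in> ?R ^^ n" by (simp add: rtrancl_is_UN_relpow)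
    then have dv: "(v, r) \<in> ?R ^^ d v" unfolding d_def by (rule LeastI_ex)
    then obtain m where m: "d v = Suc m" using v by (cases "d v") auto
    then obtain u where u: "(v, u) \<in> ?R" "(u, r) \<in> ?R ^^ m"
      using dv by (metis relpow_Suc_E2)
    then have "d u \<le> m" unfolding d_def by (simp add: Least_le)
    with u m show ?thesis by auto
  qed
  define f where "f = (\<lambda>v\<in>?S. SOME u. (v, u) \<in> ?R \<and> d u < d v)"
  have fv: "(v, f v) \<in> ?R \<and> d (f v) < d v" if "v \<in> ?S" for v
    using someI_ex[OF ex[OF that]] that by (simp add: f_def)
  have fT: "{v, f v} \<in> T" if "v \<in> ?S" for v
    using fv[OF that] by (simp add: edge_rel_def)
  have f: "f \<in> parent_maps ?S N"
  proof (rule parent_mapsI)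
    have "f v \<in> N v" if "v \<in> ?S" for v
    proof -
      have "{v, f v} \<in> graph_edges V adj" using fT[OF that] sub by blast
      then show ?thesis
        unfolding graph_edges_def N[OF that] by (auto simp: doubleton_eq_iff intro: adj_sym)
    qed
    then show "f \<in> Pi\<^sub>E ?S N" by (auto simp: f_def)
    fix A assume A: "A \<subseteq> ?S" "A \<noteq> {}" "f ` A \<subseteq> A"
    obtain a where a: "a \<in> A" "\<And>b. b \<in> A \<Longrightarrow> d a \<le> d b"
      using ex_has_least_nat[of "\<lambda>a. a \<in> A" _ d] A(2) by blast
    have "f a \<in> A" using A(3) a(1) by blast
    then have "d a \<le> d (f a)" by (rule a(2))
    moreover have "d (f a) < d a" using fv A(1) a(1) by blast
    ultimately show False by simp
  qed
  have sub2: "parent_edges ?S f \<subseteq> T" using fT by (auto simp: parent_edges_def)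
  have "T \<subseteq> parent_edges ?S f"
  proof
    fix e assume e: "e \<in> T"
    then obtain x y where xy: "e = {x, y}" "x \<in> V" "y \<in> V" "x \<noteq> y"
      using sub by (auto simp: graph_edges_def)
    show "e \<in> parent_edges ?S f"
    proof (rule ccontr)
      assume "e \<notin> parent_edges ?S f"
      then have "edge_rel (parent_edges ?S f) \<subseteq> edge_rel (T - {{x, y}})"
        using sub2 xy(1) by (auto simp: edge_rel_def)
      moreover have "(x, y) \<in> (edge_rel (parent_edges ?S f))\<^sup>*"
        using parent_edges_connected[OF f] xy(2,3) by (simp add: connected_by_def)
      ultimately have "(x, y) \<in> (edge_rel (T - {{x, y}}))\<^sup>*"
        using rtrancl_mono by blast
      then show False using bridge[of x y] e xy(1,4) by simp
    qed
  qed
  with sub2 f show ?thesis by blast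
qed

lemma num_spanning_trees_eq: "num_spanning_trees V adj = card (parent_maps (V - {r}) N)"
proof -
  have "bij_betw (parent_edges (V - {r})) (parent_maps (V - {r}) N) (spanning_trees V adj)"
    unfolding bij_betw_def
    using parent_edges_inj parent_edges_spanning_tree spanning_tree_parent_edges by blast
  from bij_betw_same_card[OF this] show ?thesis by (simp add: num_spanning_trees_def)
qed

end

section \<open>Loops, restriction and products of parent maps\<close>

lemma parent_maps_insert_self: "parent_maps S (\<lambda>v. insert v (N v)) = parent_maps S N"
proof -
  have "parent_maps S (\<lambda>v. insert v (N v)) \<subseteq> parent_maps S N"
  proof
    fix f assume f: "f \<in> parent_maps S (\<lambda>v. insert v (N v))"
    have "f v \<in> N v" if "v \<in> S" for v
      using parent_maps_mem[OF f that] parent_maps_no_invariant[OF f, of "{v}"] that by auto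
    then have "f \<in> Pi\<^sub>E S N" using parent_maps_PiE[OF f] by (simp add: PiE_iff)
    then show "f \<in> parent_maps S N" using f by (simp add: parent_maps_def)
  qed
  moreover have "Pi\<^sub>E S N \<subseteq> Pi\<^sub>E S (\<lambda>v. insert v (N v))" by (rule PiE_mono) blast
  ultimately show ?thesis unfolding parent_maps_def by blast
qed

lemma parent_maps_cong: "(\<And>v. v \<in> S \<Longrightarrow> N v = N' v) \<Longrightarrow> parent_maps S N = parent_maps S N'"
  unfolding parent_maps_def by (simp cong: PiE_cong)

lemma parent_maps_mono:
  "(\<And>v. v \<in> S \<Longrightarrow> N v \<subseteq> N' v) \<Longrightarrow> parent_maps S N \<subseteq> parent_maps S N'"
  unfolding parent_maps_def using PiE_mono by blast

lemma finite_parent_maps: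
  "finite S \<Longrightarrow> (\<And>v. v \<in> S \<Longrightarrow> finite (N v)) \<Longrightarrow> finite (parent_maps S N)"
  by (rule finite_subset[of _ "Pi\<^sub>E S N"]) (auto simp: parent_maps_def intro: finite_PiE)

lemma restrict_parent_maps:
  assumes f: "f \<in> parent_maps S N" and "A \<subseteq> S"
  shows "restrict f A \<in> parent_maps A N"
proof (rule parent_mapsI)
  show "restrict f A \<in> Pi\<^sub>E A N" using parent_maps_mem[OF f] assms(2) by auto
  fix B assume "B \<subseteq> A" "B \<noteq> {}" "restrict f A ` B \<subseteq> B"
  then show False using parent_maps_no_invariant[OF f, of B] assms(2) by auto
qed

text \<open>Only arrows from \<open>S\<close> into \<open>T\<close> have to be excluded. The part of
  an invariant set inside \<open>S\<close> is then itself invariant, hence empty, and what remains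
  is an invariant subset of \<open>T\<close>; arrows from \<open>T\<close> into \<open>S\<close> do
  no harm.\<close>

lemma card_parent_maps_Un:
  assumes disj: "S \<inter> T = {}" and S: "\<And>v. v \<in> S \<Longrightarrow> N v \<inter> T = {}"
  shows "card (parent_maps (S \<union> T) N) = card (parent_maps S N) * card (parent_maps T N)"
proof -
  let ?\<phi> = "\<lambda>f. (restrict f S, restrict f T)"
  let ?\<psi> = "\<lambda>(g, h). \<lambda>v\<in>S \<union> T. if v \<in> S then g v else h v"
  have "bij_betw ?\<phi> (parent_maps (S \<union> T) N) (parent_maps S N \<times> parent_maps T N)"
  proof (rule bij_betwI[of _ _ _ ?\<psi>])
    show "?\<phi> \<in> parent_maps (S \<union> T) N \<rightarrow> parent_maps S N \<times> parent_maps T N"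
      by (intro funcsetI SigmaI restrict_parent_maps[where S = "S \<union> T"]) simp_all
    show "?\<psi> \<in> parent_maps S N \<times> parent_maps T N \<rightarrow> parent_maps (S \<union> T) N"
    proof (clarify, rule parent_mapsI)
      fix g h assume g: "g \<in> parent_maps S N" and h: "h \<in> parent_maps T N"
      let ?f = "\<lambda>v\<in>S \<union> T. if v \<in> S then g v else h v"
      show "?f \<in> Pi\<^sub>E (S \<union> T) N"
      proof (rule PiE_I)
        fix v assume "v \<in> S \<union> T"
        then show "?f v \<in> N v"
          using parent_maps_mem[OF g, of v] parent_maps_mem[OF h, of v] by (cases "v \<in> S") simp_all
      qed simp
      fix A assume A: "A \<subseteq> S \<union> T" "A \<noteq> {}" "?f ` A \<subseteq> A"
      have "g ` (A \<inter> S) \<subseteq> A \<inter> S"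
      proof clarify
        fix x assume x: "x \<in> A" "x \<in> S"
        then have "?f x \<in> A" using A(3) by blast
        then have "g x \<in> A" using x by simp
        moreover have "g x \<notin> T" using parent_maps_mem[OF g x(2)] S[OF x(2)] by blast
        ultimately show "g x \<in> A \<inter> S" using A(1) by blast
      qed
      then have AS: "A \<inter> S = {}" by (intro parent_maps_no_invariant[OF g]) simp_all
      have "h x \<in> A" if "x \<in> A" for x
      proof -
        have "?f x \<in> A" using A(3) that by blast
        moreover have "x \<in> T" "x \<notin> S" using that AS A(1) by blast+
        ultimately show ?thesis by simp
      qed
      then have "h ` A \<subseteq> A" "A \<subseteq> T" using AS A(1) by blast+
      with A(2) show False using parent_maps_no_invariant[OF h, of A] by blast
    qed
    fix f assume "f \<in> parent_maps (S \<union> T) N"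
    from parent_maps_PiE[OF this] have "f \<in> extensional (S \<union> T)" by (simp add: PiE_def)
    then show "?\<psi> (?\<phi> f) = f" by (auto simp: fun_eq_iff extensional_def)
  next
    fix y assume "y \<in> parent_maps S N \<times> parent_maps T N"
    then obtain g h where y: "y = (g, h)" and gh: "g \<in> parent_maps S N" "h \<in> parent_maps T N"
      by (cases y) auto
    from parent_maps_PiE[OF gh(1)] have g: "g \<in> extensional S" by (simp add: PiE_def)
    from parent_maps_PiE[OF gh(2)] have h: "h \<in> extensional T" by (simp add: PiE_def)
    have "restrict (?\<psi> (g, h)) S = g"
      using g by (auto simp: fun_eq_iff extensional_def)
    moreover have "restrict (?\<psi> (g, h)) T = h"
      using h disj by (auto simp: fun_eq_iff extensional_def disjoint_iff)
    ultimately show "?\<phi> (?\<psi> y) = y" by (simp only: y)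
  qed
  from bij_betw_same_card[OF this] show ?thesis by (simp add: card_cartesian_product)
qed

lemma parent_maps_empty: "card (parent_maps {} N) = 1"
  by (simp add: parent_maps_def)

lemma card_parent_maps_Union:
  assumes "finite F" and "\<And>B C. B \<in> F \<Longrightarrow> C \<in> F \<Longrightarrow> B \<noteq> C \<Longrightarrow> B \<inter> C = {}"
    and "\<And>B C v. B \<in> F \<Longrightarrow> C \<in> F \<Longrightarrow> B \<noteq> C \<Longrightarrow> v \<in> B \<Longrightarrow> N v \<inter> C = {}"
  shows "card (parent_maps (\<Union>F) N) = (\<Prod>B\<in>F. card (parent_maps B N))"
  using assms
proof (induction rule: finite_induct)
  case empty
  then show ?case by (simp add: parent_maps_empty)
next
  case (insert B F)
  have "card (parent_maps (B \<union> \<Union>F) N) = card (parent_maps B N) * card (parent_maps (\<Union>F) N)"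
  proof (rule card_parent_maps_Un)
    show "B \<inter> \<Union>F = {}" using insert.prems(1) insert.hyps by blast
    show "N v \<inter> \<Union>F = {}" if "v \<in> B" for v
      using insert.prems(2)[of B _ v] insert.hyps that by blast
  qed
  moreover have "card (parent_maps (\<Union>F) N) = (\<Prod>B\<in>F. card (parent_maps B N))"
    using insert.prems by (intro insert.IH) (meson insertI2)+
  ultimately show ?case using insert.hyps by simp
qed

section \<open>Cayley's formula for forests with a given set of roots\<close>

lemma sum_Pow_card:
  fixes g :: "nat \<Rightarrow> nat"
  assumes "finite S"
  shows "(\<Sum>J\<in>Pow S. g (card J)) = (\<Sum>j\<le>card S. (card S choose j) * g j)"
proof -
  have "(\<Sum>J\<in>Pow S. g (card J)) = (\<Sum>j\<le>card S. \<Sum>J\<in>{J \<in> Pow S. card J = j}. g (card J))"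
    by (rule sum.group[symmetric]) (use assms card_mono in auto)
  also have "\<dots> = (\<Sum>j\<le>card S. (card S choose j) * g j)"
    using n_subsets[OF assms] by (intro sum.cong) (auto simp: Pow_def)
  finally show ?thesis .
qed

text \<open>This is \<open>a\<close> times the derivative in \<open>a\<close> of the binomial
  theorem. The absorption identity for \<open>Suc j * (Suc m choose Suc j)\<close> takes over the
  role of differentiation, and for \<open>k = 0\<close> both sides vanish.\<close>

lemma sum_choose_weighted:
  fixes a b :: nat
  shows "(\<Sum>j\<le>k. (k choose j) * (j * a ^ j * b ^ (k - j))) = k * a * (a + b) ^ (k - 1)"
proof (cases k)
  case (Suc m)
  have "(\<Sum>j\<le>Suc m. (Suc m choose j) * (j * a ^ j * b ^ (Suc m - j)))
      = (\<Sum>j\<le>m. (Suc m choose Suc j) * (Suc j * a ^ Suc j * b ^ (m - j)))"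
    by (subst sum.atMost_Suc_shift) simp
  also have "\<dots> = (\<Sum>j\<le>m. Suc m * a * ((m choose j) * a ^ j * b ^ (m - j)))"
  proof (rule sum.cong)
    fix j
    have "(Suc m choose Suc j) * (Suc j * a ^ Suc j * b ^ (m - j))
        = (Suc j * (Suc m choose Suc j)) * (a * a ^ j * b ^ (m - j))"
      unfolding power_Suc by (simp only: mult_ac)
    also have "\<dots> = (Suc m * (m choose j)) * (a * a ^ j * b ^ (m - j))"
      by (simp only: Suc_times_binomial_eq mult.commute)
    finally show "(Suc m choose Suc j) * (Suc j * a ^ Suc j * b ^ (m - j))
        = Suc m * a * ((m choose j) * a ^ j * b ^ (m - j))" by (simp only: mult_ac)
  qed simp
  also have "\<dots> = Suc m * a * (a + b) ^ m"
    by (simp add: binomial sum_distrib_left)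
  finally show ?thesis using Suc by simp
qed simp

text \<open>Grouping the parent maps by the set \<open>J\<close> of children of the roots expresses the count for
  \<open>(S, R)\<close> through the counts for \<open>(S - J, J)\<close>.\<close>

lemma card_parent_maps_fixed_children:
  assumes "finite S" "finite R" "S \<inter> R = {}" "J \<subseteq> S"
  shows "card {f \<in> parent_maps S (\<lambda>_. S \<union> R). {v \<in> S. f v \<in> R} = J}
       = card R ^ card J * card (parent_maps (S - J) (\<lambda>_. S))"
proof -
  let ?F = "{f \<in> parent_maps S (\<lambda>_. S \<union> R). {v \<in> S. f v \<in> R} = J}"
  let ?\<phi> = "\<lambda>f. (restrict f J, restrict f (S - J))"
  let ?\<psi> = "\<lambda>(g, h). \<lambda>v\<in>S. if v \<in> J then g v else h v"
  let ?Y = "(J \<rightarrow>\<^sub>E R) \<times> parent_maps (S - J) (\<lambda>_. S)"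
  have "bij_betw ?\<phi> ?F ?Y"
  proof (rule bij_betwI[of _ _ _ ?\<psi>])
    show "?\<phi> \<in> ?F \<rightarrow> ?Y"
    proof
      fix f assume f: "f \<in> ?F"
      then have fm: "f \<in> parent_maps S (\<lambda>_. S \<union> R)" by simp
      have "restrict f (S - J) \<in> parent_maps (S - J) (\<lambda>_. S)"
      proof (rule parent_mapsI)
        show "restrict f (S - J) \<in> S - J \<rightarrow>\<^sub>E S"
          using f parent_maps_mem[OF fm] by auto
        fix B assume "B \<subseteq> S - J" "B \<noteq> {}" "restrict f (S - J) ` B \<subseteq> B"
        then show False using parent_maps_no_invariant[OF fm, of B] by (auto simp: image_subset_iff)
      qed
      then show "?\<phi> f \<in> ?Y" using f by auto
    qed
    show "?\<psi> \<in> ?Y \<rightarrow> ?F"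
    proof (clarify, intro CollectI conjI)
      fix g h assume g: "g \<in> J \<rightarrow>\<^sub>E R" and h: "h \<in> parent_maps (S - J) (\<lambda>_. S)"
      let ?f = "\<lambda>v\<in>S. if v \<in> J then g v else h v"
      show "?f \<in> parent_maps S (\<lambda>_. S \<union> R)"
      proof (rule parent_mapsI)
        show "?f \<in> S \<rightarrow>\<^sub>E S \<union> R"
          using PiE_mem[OF g] parent_maps_mem[OF h] by auto
        fix A assume A: "A \<subseteq> S" "A \<noteq> {}" "?f ` A \<subseteq> A"
        have "x \<notin> J" if "x \<in> A" for x
        proof
          assume "x \<in> J"
          then have "?f x \<in> R" using g assms(4) by auto
          moreover have "?f x \<in> A" using A(3) that by blast
          ultimately show False using A(1) assms(3) by blast
        qed
        then have "A \<subseteq> S - J" "h ` A \<subseteq> A" using A by (force simp: image_subset_iff)+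
        with A(2) show False using parent_maps_no_invariant[OF h, of A] by blast
      qed
      show "{v \<in> S. ?f v \<in> R} = J"
        using g parent_maps_mem[OF h] assms(3,4) by fastforce
    qed
    fix f assume "f \<in> ?F"
    then have "f \<in> extensional S" using parent_maps_PiE by (auto simp: PiE_def)
    then show "?\<psi> (?\<phi> f) = f" using assms(4) by (auto simp: fun_eq_iff extensional_def)
  next
    fix y assume "y \<in> ?Y"
    then obtain g h where y: "y = (g, h)" and gh: "g \<in> J \<rightarrow>\<^sub>E R" "h \<in> parent_maps (S - J) (\<lambda>_. S)"
      by (cases y) auto
    from gh(1) have g: "g \<in> extensional J" by (simp add: PiE_def)
    from parent_maps_PiE[OF gh(2)] have h: "h \<in> extensional (S - J)" by (simp add: PiE_def)
    have "restrict (?\<psi> (g, h)) J = g"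
      using g assms(4) by (auto simp: fun_eq_iff extensional_def)
    moreover have "restrict (?\<psi> (g, h)) (S - J) = h"
      using h by (auto simp: fun_eq_iff extensional_def)
    ultimately show "?\<phi> (?\<psi> y) = y" by (simp only: y)
  qed
  then have "card ?F = card ?Y" by (rule bij_betw_same_card)
  then show ?thesis
    using assms finite_subset[OF assms(4)] by (simp add: card_cartesian_product card_funcsetE)
qed

text \<open>With a roots and k further vertices the count is a (a + k)^(k - 1); one factor a + k is
  cleared so that the empty \<open>S\<close> needs no separate exponent. Once the children
  \<open>J\<close> of the roots are fixed, the remaining vertices see \<open>J\<close> as their
  roots, and \<open>S - J\<close> and \<open>J\<close> together again have k elements, so the
  induction hypothesis gives a summand of \<open>sum_choose_weighted\<close>.\<close>

lemma card_parent_maps_complete_aux: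
  assumes "finite S" "finite R" "S \<inter> R = {}"
  shows "(card R + card S) * card (parent_maps S (\<lambda>_. S \<union> R)) = card R * (card R + card S) ^ card S"
  using assms
proof (induction "card S" arbitrary: S R rule: less_induct)
  case less
  let ?k = "card S" and ?a = "card R"
  show ?case
  proof (cases "S = {}")
    case True
    then show ?thesis by (simp add: parent_maps_empty)
  next
    case False
    let ?P = "parent_maps S (\<lambda>_. S \<union> R)"
    have finP: "finite ?P" using less.prems by (intro finite_parent_maps) auto
    have J: "?k * card {f \<in> ?P. {v \<in> S. f v \<in> R} = J} = card J * ?a ^ card J * ?k ^ (?k - card J)"
      if "J \<in> Pow S" for J
    proof -
      have JS: "J \<subseteq> S" and fJ: "finite J" using that less.prems finite_subset by auto
      have cSJ: "card (S - J) = ?k - card J" "card J \<le> ?k"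
        using JS fJ less.prems by (auto simp: card_Diff_subset card_mono)
      have un: "S - J \<union> J = S" using JS by blast
      have "?k * card (parent_maps (S - J) (\<lambda>_. S)) = card J * ?k ^ (?k - card J)"
      \<comment> \<open>If no vertex points to a root, all of \<open>S\<close> is invariant and
        there is no such map; the factor \<open>card J\<close> makes the right-hand side vanish as
        well.\<close>
      proof (cases "J = {}")
        case True
        have "parent_maps S (\<lambda>_. S) = {}"
          using parent_maps_no_invariant[of _ S "\<lambda>_. S" S] parent_maps_mem[of _ S "\<lambda>_. S"] False
          by blast
        then show ?thesis using True by simp
      next
        case False
        then have "card (S - J) < ?k" using JS fJ less.prems(1) by (intro psubset_card_mono) auto
        from less.hyps[OF this, of J] less.prems(1) fJ cSJ un show ?thesis by auto
      qed
      then show ?thesis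
        using card_parent_maps_fixed_children[OF less.prems JS] by (simp add: mult_ac)
    qed
    have "card ?P = (\<Sum>J\<in>Pow S. card {f \<in> ?P. {v \<in> S. f v \<in> R} = J})"
    proof -
      have "card ?P = (\<Sum>f\<in>?P. 1)" by simp
      also have "\<dots> = (\<Sum>J\<in>Pow S. \<Sum>f\<in>{f \<in> ?P. {v \<in> S. f v \<in> R} = J}. 1)"
        by (rule sum.group[symmetric]) (use finP less.prems in auto)
      finally show ?thesis by simp
    qed
    then have "?k * card ?P = (\<Sum>J\<in>Pow S. card J * ?a ^ card J * ?k ^ (?k - card J))"
      using J by (simp add: sum_distrib_left)
    also have "\<dots> = ?k * ?a * (?a + ?k) ^ (?k - 1)"
      by (subst sum_Pow_card[of S "\<lambda>j. j * ?a ^ j * ?k ^ (?k - j)"])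
        (use less.prems sum_choose_weighted[of ?k ?a ?k] in auto)
    finally have "card ?P = ?a * (?a + ?k) ^ (?k - 1)"
      using False less.prems(1) by (simp add: mult.assoc)
    moreover have "(?a + ?k) * (?a + ?k) ^ (?k - 1) = (?a + ?k) ^ ?k"
      using False less.prems(1) by (simp add: card_gt_0_iff power_eq_if)
    ultimately show ?thesis by (simp add: mult.left_commute)
  qed
qed

text \<open>Cayley's formula for the complete graph on \<open>insert r S\<close>, obtained from the
  forest formula with a single root.\<close>

lemma card_parent_maps_complete:
  assumes "finite S" "r \<notin> S" "S \<noteq> {}"
  shows "card (parent_maps S (\<lambda>_. insert r S)) = (card S + 1) ^ (card S - 1)"
proof -
  have "(1 + card S) * card (parent_maps S (\<lambda>_. insert r S)) = (1 + card S) ^ card S"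
    using card_parent_maps_complete_aux[of S "{r}"] assms by simp
  moreover have "(1 + card S) ^ card S = (1 + card S) * (1 + card S) ^ (card S - 1)"
    using assms by (simp add: card_gt_0_iff power_eq_if)
  ultimately have "(1 + card S) * card (parent_maps S (\<lambda>_. insert r S))
      = (1 + card S) * (1 + card S) ^ (card S - 1)" by (simp only:)
  then show ?thesis unfolding mult_cancel1 by simp
qed

section \<open>Twin vertices and divisibility of the count\<close>

lemma parent_maps_terminal:
  assumes f: "f \<in> parent_maps S N" and "finite S"
  obtains \<pi> where "\<And>v. v \<notin> S \<Longrightarrow> \<pi> v = v" "\<And>v. v \<in> S \<Longrightarrow> \<pi> v = \<pi> (f v)" "\<And>v. \<pi> v \<notin> S"
proof -
  define \<pi> where "\<pi> v = (f ^^ (LEAST n. (f ^^ n) v \<notin> S)) v" for v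
  have ex: "\<exists>n. (f ^^ n) v \<notin> S" if "v \<in> S" for v
    using f that
  proof (induction rule: parent_maps_induct)
    case (step x)
    show ?case
    proof (cases "f x \<in> S")
      case True
      then obtain n where "(f ^^ n) (f x) \<notin> S" using step by blast
      then have "(f ^^ Suc n) x \<notin> S" by (simp only: funpow_Suc_right o_apply not_False_eq_True)
      then show ?thesis by blast
    next
      case False
      then have "(f ^^ 1) x \<notin> S" by simp
      then show ?thesis by blast
    qed
  qed
  have out: "\<pi> v = v" if "v \<notin> S" for v
  proof -
    have "(LEAST n. (f ^^ n) v \<notin> S) = 0" using that by (intro Least_eq_0) simp
    then show ?thesis by (simp add: \<pi>_def)
  qed
  moreover have "\<pi> v = \<pi> (f v)" if v: "v \<in> S" for v
  proof -
    obtain n where "(f ^^ n) v \<notin> S" using ex[OF v] by blast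
    then have "(LEAST n. (f ^^ n) v \<notin> S) = Suc (LEAST n. (f ^^ Suc n) v \<notin> S)"
      using v by (intro Least_Suc) auto
    then show ?thesis by (simp add: \<pi>_def funpow_Suc_right del: funpow.simps)
  qed
  moreover have "\<pi> v \<notin> S" for v
  proof (cases "v \<in> S")
    case True
    then show ?thesis unfolding \<pi>_def by (rule LeastI_ex[OF ex])
  qed (simp add: out)
  ultimately show thesis using that by blast
qed

lemma dvd_card_fibers:
  assumes "finite A" "\<And>b. b \<in> h ` A \<Longrightarrow> (m::nat) dvd card {a \<in> A. h a = b}"
  shows "m dvd card A"
proof -
  have "card A = (\<Sum>a\<in>A. 1)" by simp
  also have "\<dots> = (\<Sum>b\<in>h ` A. \<Sum>a\<in>{a \<in> A. h a = b}. 1)"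
    by (rule sum.group[symmetric]) (use assms in auto)
  also have "\<dots> = (\<Sum>b\<in>h ` A. card {a \<in> A. h a = b})" by simp
  finally have "card A = (\<Sum>b\<in>h ` A. card {a \<in> A. h a = b})" .
  moreover have "m dvd (\<Sum>b\<in>h ` A. card {a \<in> A. h a = b})"
    using assms(2) by (rule dvd_sum)
  ultimately show ?thesis by (simp only:)
qed

text \<open>Fix the values of \<open>f\<close> away from the twins \<open>x\<close>, \<open>y\<close> and let \<open>\<pi>\<close> send a vertex to the element of
  \<open>{r, x, y}\<close> it flows to. If \<open>\<rho>\<close> members of the common neighbourhood \<open>M\<close> flow to \<open>r\<close>, then exactly
  \<open>\<rho> * card M\<close> of the choices for \<open>(f x, f y)\<close> create no cycle.\<close>

lemma card_twin_nbhd_dvd_aux: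
  assumes S: "finite S" "x \<in> S" "y \<in> S" "x \<noteq> y" "r \<notin> S"
    and N: "\<And>v. v \<in> S \<Longrightarrow> N v \<subseteq> insert r S"
    and M: "N x = M" "N y = M"
  shows "card M dvd card (parent_maps S N)"
proof (rule dvd_card_fibers[where h = "\<lambda>f. restrict f (S - {x, y})"])
  let ?S = "S - {x, y}"
  have finN: "finite (N v)" if "v \<in> S" for v using N[OF that] S(1) finite_subset by blast
  then show "finite (parent_maps S N)" using S(1) by (intro finite_parent_maps)
  have MS: "M \<subseteq> insert r S" and finM: "finite M" using N[OF S(2)] finN[OF S(2)] M by auto
  fix g assume "g \<in> (\<lambda>f. restrict f ?S) ` parent_maps S N"
  then have g: "g \<in> parent_maps ?S N" using restrict_parent_maps[of _ S N ?S] by blast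
  then obtain \<pi> where \<pi>: "\<And>v. v \<notin> ?S \<Longrightarrow> \<pi> v = v" "\<And>v. v \<in> ?S \<Longrightarrow> \<pi> v = \<pi> (g v)"
    "\<And>v. \<pi> v \<notin> ?S"
    using parent_maps_terminal[OF g] S(1) by blast
  have gS: "g w \<in> insert r S" if "w \<in> ?S" for w
    using parent_maps_mem[OF g that] N[of w] that by blast
  have \<pi>r: "\<pi> r = r" and \<pi>x: "\<pi> x = x" and \<pi>y: "\<pi> y = y" using \<pi>(1) S by auto
  have "\<pi> w \<in> {r, x, y}" if "w \<in> ?S" for w
    using g that
  proof (induction rule: parent_maps_induct)
    case (step w)
    then show ?case using gS[of w] \<pi> by (cases "g w \<in> ?S") auto
  qed
  then have \<pi>cases: "\<pi> w \<in> {r, x, y}" if "w \<in> insert r S" for w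
    using that \<pi>(1) by (cases "w \<in> ?S") auto
  define f where "f u v = (\<lambda>w\<in>S. if w = x then u else if w = y then v else g w)" for u v
  have fS: "f u v w = g w" if "w \<in> ?S" for u v w using that by (simp add: f_def)
  have fxy: "f u v x = u" "f u v y = v" for u v using S by (simp_all add: f_def)
  \<comment> \<open>These are the pairs for which the flow from both twins ends in \<open>r\<close>:
    either \<open>u\<close> flows to \<open>r\<close> and \<open>v\<close> does not come back to
    \<open>y\<close>, or \<open>u\<close> flows to \<open>y\<close> and \<open>v\<close> flows to
    \<open>r\<close>.\<close>
  let ?good = "\<lambda>u v. \<pi> u = r \<and> \<pi> v \<noteq> y \<or> \<pi> u = y \<and> \<pi> v = r"
  have fPi: "f u v \<in> Pi\<^sub>E S N" if "u \<in> M" "v \<in> M" for u v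
    using that M parent_maps_mem[OF g] by (auto simp: f_def)
  have good: "f u v \<in> parent_maps S N" if uv: "u \<in> M" "v \<in> M" "?good u v" for u v
  proof (rule parent_mapsI[OF fPi])
    fix B assume B: "B \<subseteq> S" "B \<noteq> {}" "f u v ` B \<subseteq> B"
    have fB: "f u v w \<in> B" if "w \<in> B" for w using B(3) that by blast
    have rB: "r \<notin> B" using B(1) S(5) by blast
    have "w \<in> B \<longrightarrow> \<pi> w \<in> B" if "w \<in> ?S" for w
      using g that
    proof (induction rule: parent_maps_induct)
      case (step w)
      show ?case
      proof
        assume "w \<in> B"
        then have "g w \<in> B" using fB fS[OF step(1)] by metis
        then show "\<pi> w \<in> B" using step \<pi> by (cases "g w \<in> ?S") simp_all
      qed
    qed
    then have \<pi>B: "\<pi> w \<in> B" if "w \<in> B" for w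
      using that \<pi>(1) by (cases "w \<in> ?S") auto
    obtain w where w: "w \<in> B" using B(2) by blast
    then have "\<pi> w \<in> {r, x, y}" using B(1) \<pi>cases by blast
    then have "x \<in> B \<or> y \<in> B" using \<pi>B[OF w] rB by auto
    moreover have "\<pi> u \<in> B" if "x \<in> B" using \<pi>B[OF fB[OF that]] fxy by simp
    moreover have "\<pi> v \<in> B" if "y \<in> B" using \<pi>B[OF fB[OF that]] fxy by simp
    moreover have "\<pi> v \<in> {r, x, y}" using \<pi>cases MS uv(2) by blast
    ultimately show False using uv(3) rB by auto
  qed (use uv in auto)
  have bad: "f u v \<notin> parent_maps S N" if uv: "u \<in> M" "v \<in> M" "\<not> ?good u v" for u v
  proof
    assume fm: "f u v \<in> parent_maps S N"
    \<comment> \<open>The set of all vertices whose flow ends in \<open>Z\<close> is invariant under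
      \<open>f u v\<close>.\<close>
    have inv: "False" if Z: "Z \<subseteq> {x, y}" "Z \<noteq> {}" "x \<in> Z \<Longrightarrow> \<pi> u \<in> Z" "y \<in> Z \<Longrightarrow> \<pi> v \<in> Z" for Z
    proof -
      let ?B = "{w \<in> S. \<pi> w \<in> Z}"
      have "f u v w \<in> ?B" if w: "w \<in> ?B" for w
      proof -
        have rZ: "r \<notin> Z" using Z(1) S by auto
        have "\<pi> (f u v w) \<in> Z"
          using w Z(3,4) \<pi>x \<pi>y \<pi>(2)[of w] fS[of w u v] fxy by (cases "w \<in> ?S") auto
        moreover have "f u v w \<in> insert r S"
          using w uv MS gS fS fxy by (cases "w \<in> ?S") auto
        ultimately show ?thesis using \<pi>r rZ by auto
      qed
      then have "?B = {}" by (intro parent_maps_no_invariant[OF fm]) auto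
      then have nZ: "\<pi> w \<notin> Z" if "w \<in> S" for w using that by blast
      have "x \<notin> Z" "y \<notin> Z" using nZ[OF S(2)] nZ[OF S(3)] \<pi>x \<pi>y by simp_all
      then show False using Z(1,2) by blast
    qed
    have "\<pi> u \<in> {r, x, y}" "\<pi> v \<in> {r, x, y}" using \<pi>cases MS uv by blast+
    then have "\<pi> u = x \<or> \<pi> v = y \<or> \<pi> u = y \<and> \<pi> v = x" using uv(3) by auto
    then consider "\<pi> u = x" | "\<pi> v = y" | "\<pi> u = y" "\<pi> v = x" by blast
    then show False
    proof cases
      case 1
      then show ?thesis using inv[of "{x}"] S(4) by simp
    next
      case 2
      then show ?thesis using inv[of "{y}"] S(4) by simp
    next
      case 3
      then show ?thesis using inv[of "{x, y}"] by simp
    qed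
  qed
  let ?F = "{h \<in> parent_maps S N. restrict h ?S = g}"
  let ?G = "{(u, v). u \<in> M \<and> v \<in> M \<and> ?good u v}"
  have "bij_betw (\<lambda>h. (h x, h y)) ?F ?G"
  proof (rule bij_betwI[of _ _ _ "\<lambda>(u, v). f u v"])
    have hf: "h = f (h x) (h y)" if "h \<in> ?F" for h
    proof
      fix w
      have "h \<in> extensional S" using that parent_maps_PiE[of h S N] by (simp add: PiE_def)
      moreover have "h w = g w" if w: "w \<in> ?S"
      proof -
        have "restrict h ?S w = g w" using \<open>h \<in> ?F\<close> by simp
        then show ?thesis using w by simp
      qed
      ultimately show "h w = f (h x) (h y) w"
        by (cases "w \<in> S") (auto simp: f_def extensional_def)
    qed
    have hM: "h x \<in> M" "h y \<in> M" if "h \<in> ?F" for h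
      using that parent_maps_mem[of h S N] S M by auto
    show "(\<lambda>h. (h x, h y)) \<in> ?F \<rightarrow> ?G"
    proof
      fix h assume h: "h \<in> ?F"
      then have "f (h x) (h y) \<in> parent_maps S N" using hf[OF h] by simp
      then show "(h x, h y) \<in> ?G" using bad[OF hM[OF h]] hM[OF h] by auto
    qed
    show "(\<lambda>(u, v). f u v) \<in> ?G \<rightarrow> ?F"
    proof
      fix p assume "p \<in> ?G"
      then obtain u v where p: "p = (u, v)" "u \<in> M" "v \<in> M" "?good u v" by auto
      have "g \<in> extensional ?S" using parent_maps_PiE[OF g] by (simp add: PiE_def)
      then have "restrict (f u v) ?S = g"
        by (auto simp: fun_eq_iff f_def extensional_def)
      then show "(case p of (u, v) \<Rightarrow> f u v) \<in> ?F" using good p by simp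
    qed
    show "(case (h x, h y) of (u, v) \<Rightarrow> f u v) = h" if "h \<in> ?F" for h using hf[OF that] by simp
    show "((case p of (u, v) \<Rightarrow> f u v) x, (case p of (u, v) \<Rightarrow> f u v) y) = p" if "p \<in> ?G" for p
      using fxy by (cases p) simp
  qed
  from bij_betw_same_card[OF this] have "card ?F = card ?G" .
  also have "\<dots> = card {u \<in> M. \<pi> u = r} * card M"
  proof -
    let ?r = "{u \<in> M. \<pi> u = r}" and ?y = "{u \<in> M. \<pi> u = y}"
    \<comment> \<open>The number of members of \<open>M\<close> flowing to \<open>y\<close> is
      subtracted in the first product and added back in the second, so only the number flowing to
      \<open>r\<close> survives as a factor beside \<open>card M\<close>.\<close>
    have "?G = ?r \<times> (M - ?y) \<union> ?y \<times> ?r" by auto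
    moreover have "?r \<times> (M - ?y) \<inter> ?y \<times> ?r = {}" using S by auto
    ultimately have "card ?G = card ?r * card (M - ?y) + card ?y * card ?r"
      using finM by (simp add: card_Un_disjoint card_cartesian_product)
    also have "\<dots> = card ?r * (card (M - ?y) + card ?y)" by (simp add: algebra_simps)
    also have "card (M - ?y) + card ?y = card M"
      using finM by (simp add: card_Diff_subset card_mono)
    finally show ?thesis .
  qed
  finally show "card M dvd card ?F" by simp
qed

text \<open>Allowing loops does not change the count and turns equal closed neighbourhoods into
  equal neighbourhoods.\<close>

lemma card_twin_nbhd_dvd:
  assumes S: "finite S" "x \<in> S" "y \<in> S" "x \<noteq> y" "r \<notin> S"
    and N: "\<And>v. v \<in> S \<Longrightarrow> N v \<subseteq> insert r S"
    and M: "insert x (N x) = M" "insert y (N y) = M"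
  shows "card M dvd card (parent_maps S N)"
proof -
  have "card M dvd card (parent_maps S (\<lambda>v. insert v (N v)))"
    by (rule card_twin_nbhd_dvd_aux[OF S]) (use N M in auto)
  then show ?thesis by (simp add: parent_maps_insert_self)
qed

section \<open>Actions on cosets and Sylow subgroups\<close>

lemma (in group) finite_mult_closed_subgroup:
  assumes fin: "finite (carrier G)" and H: "H \<subseteq> carrier G" "\<one> \<in> H"
    and mult: "\<And>x y. x \<in> H \<Longrightarrow> y \<in> H \<Longrightarrow> x \<otimes> y \<in> H"
  shows "subgroup H G"
proof (rule subgroupI)
  fix x assume x: "x \<in> H"
  then have xG: "x \<in> carrier G" using H by blast
  have pow: "x [^] n \<in> H" for n :: nat by (induction n) (use x H mult in auto)
  have "x [^] (ord x - 1) \<otimes> x = x [^] Suc (ord x - 1)" by simp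
  also have "\<dots> = x [^] ord x" using ord_ge_1[OF fin xG] by (simp del: nat_pow_Suc)
  also have "\<dots> = \<one>" using xG by simp
  finally have "inv x = x [^] (ord x - 1)" using xG by (intro inv_equality) simp_all
  then show "inv x \<in> H" using pow by simp
qed (use H mult in auto)

lemma (in group) group_actionI:
  assumes cl: "\<And>g x. g \<in> carrier G \<Longrightarrow> x \<in> E \<Longrightarrow> act g x \<in> E"
    and one: "\<And>x. x \<in> E \<Longrightarrow> act \<one> x = x"
    and mult: "\<And>g h x. g \<in> carrier G \<Longrightarrow> h \<in> carrier G \<Longrightarrow> x \<in> E \<Longrightarrow> act (g \<otimes> h) x = act g (act h x)"
  shows "group_action G E (\<lambda>g. \<lambda>x\<in>E. act g x)"
proof -
  have inv: "act (inv g) (act g x) = x" "act g (act (inv g) x) = x"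
    if "g \<in> carrier G" "x \<in> E" for g x
    using that mult[of "inv g" g x] mult[of g "inv g" x] one by simp_all
  have bij: "(\<lambda>x\<in>E. act g x) \<in> Bij E" if g: "g \<in> carrier G" for g
  proof -
    have "bij_betw (act g) E E"
      by (rule bij_betwI[of _ _ _ "act (inv g)"]) (use g cl inv in auto)
    then have "bij_betw (\<lambda>x\<in>E. act g x) E E" by (simp cong: bij_betw_cong)
    then show ?thesis by (simp add: Bij_def)
  qed
  have "(\<lambda>g. \<lambda>x\<in>E. act g x) \<in> hom G (BijGroup E)"
  proof (rule homI)
    fix g h assume gh: "g \<in> carrier G" "h \<in> carrier G"
    have "(\<lambda>x\<in>E. act (g \<otimes> h) x) = compose E (\<lambda>x\<in>E. act g x) (\<lambda>x\<in>E. act h x)"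
      using gh cl mult by (intro ext) (simp add: compose_def restrict_def)
    then show "(\<lambda>x\<in>E. act (g \<otimes> h) x) = (\<lambda>x\<in>E. act g x) \<otimes>\<^bsub>BijGroup E\<^esub> (\<lambda>x\<in>E. act h x)"
      using bij gh by (simp add: BijGroup_def)
  qed (use bij in \<open>simp add: BijGroup_def\<close>)
  then show ?thesis
    unfolding group_action_def group_hom_def group_hom_axioms_def
    using group_axioms group_BijGroup by blast
qed

text \<open>The modulus may be composite. Besides prime moduli, the modulus 9 is used to find an
  orbit of length 3 of a Sylow 3-subgroup.\<close>

lemma (in group_action) card_fixed_points_cong_gen:
  assumes dvd: "\<And>x. x \<in> E \<Longrightarrow> card (orbit G \<phi> x) \<noteq> 1 \<Longrightarrow> p dvd card (orbit G \<phi> x)"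
    and fin: "finite E"
  shows "card E mod p = card {x \<in> E. \<forall>g\<in>carrier G. \<phi> g x = x} mod p"
proof -
  interpret group G using group_hom by (simp add: group_hom_def)
  let ?F = "{x \<in> E. \<forall>g\<in>carrier G. \<phi> g x = x}"
  let ?C = "{B \<in> orbits G E \<phi>. card B \<noteq> 1}"
  have orbE: "B \<subseteq> E" if "B \<in> orbits G E \<phi>" for B
    using that orbits_coverture by blast
  have "E - ?F = \<Union>?C"
  proof
    show "E - ?F \<subseteq> \<Union>?C"
    proof
      fix x assume x: "x \<in> E - ?F"
      then obtain g where g: "g \<in> carrier G" "\<phi> g x \<noteq> x" by blast
      have "card (orbit G \<phi> x) \<noteq> 1"
      proof
        assume "card (orbit G \<phi> x) = 1"
        then obtain z where "orbit G \<phi> x = {z}" by (auto simp: card_1_singleton_iff)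
        moreover have "x \<in> orbit G \<phi> x" using orbit_refl x by blast
        moreover have "\<phi> g x \<in> orbit G \<phi> x" using g by (auto simp: orbit_def)
        ultimately show False using g(2) by simp
      qed
      moreover have "orbit G \<phi> x \<in> orbits G E \<phi>" using x by (auto simp: orbits_def)
      moreover have "x \<in> orbit G \<phi> x" using orbit_refl x by blast
      ultimately show "x \<in> \<Union>?C" by blast
    qed
    show "\<Union>?C \<subseteq> E - ?F"
    proof
      fix x assume "x \<in> \<Union>?C"
      then obtain y where y: "y \<in> E" "x \<in> orbit G \<phi> y" "card (orbit G \<phi> y) \<noteq> 1"
        by (auto simp: orbits_def)
      then have xE: "x \<in> E" using orbE[of "orbit G \<phi> y"] by (auto simp: orbits_def)
      have "x \<notin> ?F"
      proof
        assume "x \<in> ?F"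
        then have "\<forall>g\<in>carrier G. \<phi> g x = x" by simp
        moreover have "y \<in> orbit G \<phi> x" by (rule orbit_sym[OF y(1) xE y(2)])
        then obtain g where "g \<in> carrier G" "y = \<phi> g x" by (auto simp: orbit_def)
        ultimately have "y = x" by simp
        have "orbit G \<phi> y \<subseteq> {y}"
        proof
          fix z assume "z \<in> orbit G \<phi> y"
          then obtain h where "h \<in> carrier G" "z = \<phi> h y" by (auto simp: orbit_def)
          then show "z \<in> {y}" using \<open>\<forall>g\<in>carrier G. \<phi> g x = x\<close> \<open>y = x\<close> by simp
        qed
        then have "orbit G \<phi> y = {y}" using orbit_refl[OF y(1)] by (intro equalityI) simp_all
        with y(3) show False by simp
      qed
      with xE show "x \<in> E - ?F" by blast
    qed
  qed
  moreover have "p dvd card (\<Union>?C)"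
  proof (rule dvd_partition)
    show "finite (\<Union>?C)" using orbE fin by (intro finite_subset[of "\<Union>?C" E]) auto
    show "\<forall>c\<in>?C. p dvd card c"
    proof
      fix B assume "B \<in> ?C"
      then obtain x where x: "x \<in> E" "B = orbit G \<phi> x" "card B \<noteq> 1" by (auto simp: orbits_def)
      then show "p dvd card B" using dvd by blast
    qed
    show "\<forall>c1\<in>?C. \<forall>c2\<in>?C. c1 \<noteq> c2 \<longrightarrow> c1 \<inter> c2 = {}" using disjoint_union by blast
  qed
  ultimately have "p dvd card (E - ?F)" by simp
  moreover have "card (E - ?F) = card E - card ?F" "card ?F \<le> card E"
    using fin by (auto simp: card_Diff_subset card_mono)
  ultimately show ?thesis using mod_eq_dvd_iff_nat[of "card ?F" "card E" p] by simp
qed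

lemma (in group_action) card_orbit_primepow:
  assumes p: "prime p" "order G = p ^ k" and x: "x \<in> E"
  obtains i where "card (orbit G \<phi> x) = p ^ i"
proof -
  have "card (orbit G \<phi> x) dvd p ^ k" using orbit_stabilizer_theorem[OF x] p(2) by (metis dvd_triv_left)
  then show thesis using p(1) that by (auto simp: divides_primepow_nat)
qed

lemma (in group_action) card_fixed_points_cong:
  assumes p: "prime p" "order G = p ^ k" and fin: "finite E"
  shows "card E mod p = card {x \<in> E. \<forall>g\<in>carrier G. \<phi> g x = x} mod p"
proof (rule card_fixed_points_cong_gen[OF _ fin])
  fix x assume x: "x \<in> E" "card (orbit G \<phi> x) \<noteq> 1"
  obtain i where i: "card (orbit G \<phi> x) = p ^ i" by (rule card_orbit_primepow[OF p x(1)])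
  with x(2) have "i \<noteq> 0" by (intro notI) simp
  with i show "p dvd card (orbit G \<phi> x)" by simp
qed

lemma card_Bij:
  assumes "finite S"
  shows "card (Bij S) = fact (card S)"
proof -
  have "bij_betw (\<lambda>p. restrict p S) {p. p permutes S} (Bij S)"
  proof (rule bij_betwI[of _ _ _ "\<lambda>f x. if x \<in> S then f x else x"])
    show "(\<lambda>p. restrict p S) \<in> {p. p permutes S} \<rightarrow> Bij S"
      by (auto simp: Bij_def permutes_imp_bij cong: bij_betw_cong)
    show "(\<lambda>f x. if x \<in> S then f x else x) \<in> Bij S \<rightarrow> {p. p permutes S}"
    proof clarify
      fix f assume "f \<in> Bij S"
      then have "bij_betw f S S" by (simp add: Bij_def)
      then have "bij_betw (\<lambda>x. if x \<in> S then f x else x) S S" by (simp cong: bij_betw_cong)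
      then show "(\<lambda>x. if x \<in> S then f x else x) permutes S" by (rule bij_imp_permutes) simp
    qed
    fix p assume "p \<in> {p. p permutes S}"
    then show "(\<lambda>x. if x \<in> S then restrict p S x else x) = p"
      by (auto simp: permutes_def fun_eq_iff)
  next
    fix f assume "f \<in> Bij S"
    then have "f \<in> extensional S" by (simp add: Bij_def)
    then show "restrict (\<lambda>x. if x \<in> S then f x else x) S = f"
      by (auto simp: fun_eq_iff extensional_def)
  qed
  from bij_betw_same_card[OF this] show ?thesis
    using card_permutations[OF refl assms] by simp
qed

text \<open>Right cosets carry a natural right action; multiplying by the inverse turns it into the
  left action that \<open>group_action\<close> describes.\<close>

definition coset_act :: "('a, 'b) monoid_scheme \<Rightarrow> 'a set \<Rightarrow> 'a \<Rightarrow> 'a set \<Rightarrow> 'a set" where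
  "coset_act G K = (\<lambda>g. \<lambda>R\<in>rcosets\<^bsub>G\<^esub> K. R #>\<^bsub>G\<^esub> inv\<^bsub>G\<^esub> g)"

lemma (in group) coset_act_rcos:
  assumes "subgroup K G" "a \<in> carrier G" "g \<in> carrier G"
  shows "coset_act G K g (K #> a) = K #> (a \<otimes> inv g)"
proof -
  have "K #> a \<in> rcosets K" using assms subgroup.subset by (intro rcosetsI) auto
  then show ?thesis
    using assms subgroup.subset[OF assms(1)] by (simp add: coset_act_def coset_mult_assoc)
qed

lemma (in group) group_action_coset_act:
  assumes K: "subgroup K G"
  shows "group_action G (rcosets K) (coset_act G K)"
  unfolding coset_act_def
proof (rule group_actionI)
  have KG: "K \<subseteq> carrier G" by (rule subgroup.subset[OF K])
  fix R assume "R \<in> rcosets K"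
  then obtain a where a: "a \<in> carrier G" "R = K #> a" by (auto simp: RCOSETS_def)
  show "R #> inv g \<in> rcosets K" if "g \<in> carrier G" for g
    using a that KG by (simp add: coset_mult_assoc rcosetsI)
  show "R #> inv \<one> = R" using a KG by (simp add: coset_mult_assoc)
  show "R #> inv (g \<otimes> h) = R #> inv h #> inv g" if "g \<in> carrier G" "h \<in> carrier G" for g h
    using a that KG by (simp add: coset_mult_assoc m_assoc inv_mult_group)
qed

lemma (in group) rcos_eq_iff:
  assumes K: "subgroup K G" and "a \<in> carrier G" "b \<in> carrier G"
  shows "K #> a = K #> b \<longleftrightarrow> a \<otimes> inv b \<in> K"
proof -
  have "K #> a = K #> b \<longleftrightarrow> a \<in> K #> b"
    using repr_independence[OF _ assms(3) K, of a] rcos_self[OF assms(2) K] by auto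
  also have "\<dots> \<longleftrightarrow> a \<otimes> inv b \<in> K"
    using subgroup.rcos_module[OF K group_axioms assms(3,2)] .
  finally show ?thesis .
qed

lemma (in group) coset_act_fixed_iff:
  assumes K: "subgroup K G" and "a \<in> carrier G" "g \<in> carrier G"
  shows "coset_act G K g (K #> a) = K #> a \<longleftrightarrow> a \<otimes> g \<otimes> inv a \<in> K"
proof -
  have "coset_act G K g (K #> a) = K #> a \<longleftrightarrow> K #> a = K #> (a \<otimes> inv g)"
    using coset_act_rcos[OF assms] by auto
  also have "\<dots> \<longleftrightarrow> a \<otimes> inv (a \<otimes> inv g) \<in> K" using assms by (intro rcos_eq_iff) auto
  also have "a \<otimes> inv (a \<otimes> inv g) = a \<otimes> g \<otimes> inv a"
    using assms by (simp add: inv_mult_group m_assoc)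
  finally show ?thesis .
qed

text \<open>An element acting trivially fixes the coset \<open>K\<close> and so lies in
  \<open>K\<close>. The kernel is therefore a proper normal subgroup.\<close>

lemma (in simple_group) coset_act_inj:
  assumes K: "subgroup K G" "K \<noteq> carrier G"
  shows "inj_on (coset_act G K) (carrier G)"
proof -
  interpret act: group_action G "rcosets K" "coset_act G K"
    by (rule group_action_coset_act[OF K(1)])
  interpret h: group_hom G "BijGroup (rcosets K)" "coset_act G K" by (rule act.group_hom)
  let ?N = "kernel G (BijGroup (rcosets K)) (coset_act G K)"
  have "?N \<subseteq> K"
  proof
    fix g assume "g \<in> ?N"
    then have g: "g \<in> carrier G" "coset_act G K g = coset_act G K \<one>"
      by (auto simp: kernel_def)
    have "coset_act G K g (K #> \<one>) = K #> \<one>"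
      using g(2) coset_act_rcos[OF K(1), of \<one> \<one>] by simp
    then show "g \<in> K" using coset_act_fixed_iff[OF K(1), of \<one> g] g(1) by simp
  qed
  then have "?N \<noteq> carrier G" using K subgroup.subset by blast
  then have "?N = {\<one>}" using no_real_normal_subgroup[OF h.normal_kernel] by blast
  then show ?thesis by (rule h.trivial_ker_imp_inj)
qed

lemma (in simple_group) coset_act_faithful:
  assumes K: "subgroup K G" "K \<noteq> carrier G"
    and g: "g \<in> carrier G" "\<And>R. R \<in> rcosets K \<Longrightarrow> coset_act G K g R = R"
  shows "g = \<one>"
proof (rule inj_onD[OF coset_act_inj[OF K] _ g(1) one_closed])
  interpret act: group_action G "rcosets K" "coset_act G K" by (rule group_action_coset_act[OF K(1)])
  show "coset_act G K g = coset_act G K \<one>"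
  proof
    fix R show "coset_act G K g R = coset_act G K \<one> R"
    proof (cases "R \<in> rcosets K")
      case True
      then show ?thesis using g(2)[OF True] fun_cong[OF act.id_eq_one, of R] by simp
    qed (simp add: coset_act_def)
  qed
qed

lemma (in simple_group) order_dvd_fact_index:
  assumes fin: "finite (carrier G)" and K: "subgroup K G" "K \<noteq> carrier G"
  shows "order G dvd fact (card (rcosets K))"
proof -
  interpret act: group_action G "rcosets K" "coset_act G K"
    by (rule group_action_coset_act[OF K(1)])
  interpret h: group_hom G "BijGroup (rcosets K)" "coset_act G K" by (rule act.group_hom)
  have "card (coset_act G K ` carrier G) = order G"
    using coset_act_inj[OF K] by (simp add: card_image order_def)
  moreover have "card (coset_act G K ` carrier G) dvd order (BijGroup (rcosets K))"
    using group.lagrange[OF group_BijGroup h.img_is_subgroup] by (metis dvd_triv_right)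
  moreover have "finite (rcosets K)" using fin by (simp add: RCOSETS_def)
  ultimately show ?thesis by (simp add: order_def BijGroup_def card_Bij)
qed

section \<open>Sylow theory by counting fixed cosets\<close>

text \<open>The points of \<open>G/K\<close> fixed by \<open>Q\<close> are the cosets \<open>K a\<close> with \<open>a Q a\<^sup>-\<^sup>1 \<subseteq> K\<close>.\<close>

lemma (in group) card_rcosets_fixed_cong:
  assumes fin: "finite (carrier G)" and p: "prime p"
    and Q: "subgroup Q G" "card Q = p ^ k" and K: "subgroup K G"
  shows "card (rcosets K) mod p
       = card {K #> a | a. a \<in> carrier G \<and> (\<forall>q\<in>Q. a \<otimes> q \<otimes> inv a \<in> K)} mod p"
proof -
  interpret act: group_action G "rcosets K" "coset_act G K"
    by (rule group_action_coset_act[OF K])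
  interpret Q: group_action "G\<lparr>carrier := Q\<rparr>" "rcosets K" "coset_act G K"
    by (rule act.induced_action[OF Q(1)])
  have "{R \<in> rcosets K. \<forall>g\<in>Q. coset_act G K g R = R}
      = {K #> a | a. a \<in> carrier G \<and> (\<forall>q\<in>Q. a \<otimes> q \<otimes> inv a \<in> K)}" (is "?L = ?R")
  proof -
    have "coset_act G K g (K #> a) = K #> a \<longleftrightarrow> a \<otimes> g \<otimes> inv a \<in> K"
      if "a \<in> carrier G" "g \<in> Q" for a g
      using coset_act_fixed_iff[OF K that(1)] that subgroup.subset[OF Q(1)] by blast
    then show ?thesis by (auto simp: RCOSETS_def)
  qed
  moreover have "finite (rcosets K)" using fin by (simp add: RCOSETS_def)
  ultimately show ?thesis
    using Q.card_fixed_points_cong[OF p, of k] Q(2) by (simp add: order_def)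
qed

text \<open>The number of cosets fixed by \<open>Q\<close> is congruent to the index modulo
  \<open>p\<close>, hence nonzero. For a Sylow subgroup \<open>K\<close> this is Sylow's conjugacy
  theorem.\<close>

lemma (in group) p_subgroup_conj_into:
  assumes fin: "finite (carrier G)" and p: "prime p"
    and Q: "subgroup Q G" "card Q = p ^ k" and K: "subgroup K G" "\<not> p dvd card (rcosets K)"
  obtains a where "a \<in> carrier G" "\<And>q. q \<in> Q \<Longrightarrow> a \<otimes> q \<otimes> inv a \<in> K"
proof -
  let ?F = "{K #> a | a. a \<in> carrier G \<and> (\<forall>q\<in>Q. a \<otimes> q \<otimes> inv a \<in> K)}"
  have "card ?F mod p \<noteq> 0"
    using card_rcosets_fixed_cong[OF fin p Q K(1)] K(2) by (metis mod_0_imp_dvd)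
  then have "?F \<noteq> {}" by (metis card.empty mod_0)
  then show thesis using that by blast
qed

text \<open>For a finite \<open>P\<close> in the carrier this is the normalizer: conjugation is
  injective, so mapping \<open>P\<close> into itself means mapping it onto itself.\<close>

definition conj_stab :: "('a, 'b) monoid_scheme \<Rightarrow> 'a set \<Rightarrow> 'a set" where
  "conj_stab G P = {g \<in> carrier G. \<forall>x\<in>P. g \<otimes>\<^bsub>G\<^esub> x \<otimes>\<^bsub>G\<^esub> inv\<^bsub>G\<^esub> g \<in> P}"

lemma (in group) conj_mult:
  "g \<in> carrier G \<Longrightarrow> h \<in> carrier G \<Longrightarrow> x \<in> carrier G \<Longrightarrow>
    (g \<otimes> h) \<otimes> x \<otimes> inv (g \<otimes> h) = g \<otimes> (h \<otimes> x \<otimes> inv h) \<otimes> inv g"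
  by (simp add: m_assoc inv_mult_group)

lemma (in group) conj_nat_pow:
  assumes x: "x \<in> carrier G" and h: "h \<in> carrier G"
  shows "(x \<otimes> h \<otimes> inv x) [^] (m::nat) = x \<otimes> h [^] m \<otimes> inv x"
proof (induction m)
  case (Suc m)
  have c: "inv x \<otimes> (x \<otimes> (h \<otimes> inv x)) = h \<otimes> inv x" using x h by (simp flip: m_assoc)
  have "(x \<otimes> h \<otimes> inv x) [^] Suc m = x \<otimes> h [^] m \<otimes> inv x \<otimes> (x \<otimes> h \<otimes> inv x)"
    by (simp only: nat_pow_Suc Suc)
  also have "\<dots> = x \<otimes> h [^] Suc m \<otimes> inv x" using x h by (simp add: m_assoc c)
  finally show ?case .
qed (use x in simp)

lemma (in group) subgroup_conj_stab:
  assumes fin: "finite (carrier G)" and P: "P \<subseteq> carrier G"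
  shows "subgroup (conj_stab G P) G"
proof (rule finite_mult_closed_subgroup[OF fin])
  show "conj_stab G P \<subseteq> carrier G" by (auto simp: conj_stab_def)
  show "\<one> \<in> conj_stab G P" using P by (auto simp: conj_stab_def)
  fix g h assume gh: "g \<in> conj_stab G P" "h \<in> conj_stab G P"
  have "(g \<otimes> h) \<otimes> x \<otimes> inv (g \<otimes> h) \<in> P" if "x \<in> P" for x
  proof -
    have "(g \<otimes> h) \<otimes> x \<otimes> inv (g \<otimes> h) = g \<otimes> (h \<otimes> x \<otimes> inv h) \<otimes> inv g"
      using gh that P by (intro conj_mult) (auto simp: conj_stab_def)
    then show ?thesis using gh that by (simp add: conj_stab_def)
  qed
  then show "g \<otimes> h \<in> conj_stab G P" using gh by (simp add: conj_stab_def)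
qed

lemma (in group) subgroup_le_conj_stab:
  "subgroup P G \<Longrightarrow> P \<subseteq> conj_stab G P"
  unfolding conj_stab_def
  by (auto intro: subgroup.m_closed subgroup.m_inv_closed simp: subgroup.mem_carrier)

lemma (in group) normal_of_conj_stab:
  assumes "subgroup P G" "conj_stab G P = carrier G"
  shows "P \<lhd> G"
  using assms by (intro normal_invI) (auto simp: conj_stab_def)

lemma (in group) card_rcosets_mult_dvd:
  assumes H: "subgroup H G" and K: "subgroup K G" and HK: "H \<subseteq> K" and fin: "finite (carrier G)"
  shows "card K = card {H #> a | a. a \<in> K} * card H"
    and "card (rcosets H) = card (rcosets K) * card {H #> a | a. a \<in> K}"
proof -
  interpret K: group "G\<lparr>carrier := K\<rparr>" by (rule subgroup_imp_group[OF K])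
  have "card (rcosets\<^bsub>G\<lparr>carrier := K\<rparr>\<^esub> H) * card H = card K"
    using K.lagrange[OF subgroup_incl[OF H K HK]] by (simp add: order_def)
  moreover have "rcosets\<^bsub>G\<lparr>carrier := K\<rparr>\<^esub> H = {H #> a | a. a \<in> K}"
    by (auto simp: RCOSETS_def)
  ultimately show *: "card K = card {H #> a | a. a \<in> K} * card H" by simp
  have "card (rcosets H) * card H = card (rcosets K) * card {H #> a | a. a \<in> K} * card H"
    using lagrange[OF H] lagrange[OF K] * by (simp add: mult.assoc)
  moreover have "card H > 0"
    using subgroup.one_closed[OF H] finite_subset[OF subgroup.subset[OF H] fin]
    by (auto simp: card_gt_0_iff)
  ultimately show "card (rcosets H) = card (rcosets K) * card {H #> a | a. a \<in> K}" by simp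
qed

text \<open>The cosets of \<open>Q\<close> fixed by \<open>Q\<close> are those contained in its
  normalizer. Their number is congruent to the index of \<open>Q\<close>, so \<open>p\<close>
  divides the index of \<open>Q\<close> in the normalizer.\<close>

lemma (in group) normalizer_grows:
  assumes fin: "finite (carrier G)" and p: "prime p"
    and Q: "subgroup Q G" "card Q = p ^ k" "p dvd card (rcosets Q)"
  shows "p ^ Suc k dvd card (conj_stab G Q)"
proof -
  have "card {Q #> a | a. a \<in> conj_stab G Q} mod p = 0"
    using card_rcosets_fixed_cong[OF fin p Q(1,2,1)] Q(3) by (simp add: conj_stab_def)
  then have "p dvd card {Q #> a | a. a \<in> conj_stab G Q}" by (rule mod_0_imp_dvd)
  then show ?thesis
    using card_rcosets_mult_dvd(1)[OF Q(1) subgroup_conj_stab subgroup_le_conj_stab, OF fin _ Q(1) fin]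
      subgroup.subset[OF Q(1)] Q(2) by (simp add: mult_dvd_mono)
qed

lemma (in group) subgroup_conj_image:
  assumes "subgroup P G" "a \<in> carrier G"
  shows "subgroup ((\<lambda>x. a \<otimes> x \<otimes> inv a) ` P) G" "card ((\<lambda>x. a \<otimes> x \<otimes> inv a) ` P) = card P"
proof -
  have PG: "P \<subseteq> carrier G" by (rule subgroup.subset[OF assms(1)])
  have "group_hom G G (\<lambda>x. a \<otimes> x \<otimes> inv a)"
  proof (intro group_hom.intro group_hom_axioms.intro group_axioms homI)
    fix x y assume xy: "x \<in> carrier G" "y \<in> carrier G"
    show "a \<otimes> (x \<otimes> y) \<otimes> inv a = a \<otimes> x \<otimes> inv a \<otimes> (a \<otimes> y \<otimes> inv a)"
      using xy assms(2) by (simp add: m_assoc inv_solve_left)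
  qed (use assms(2) in simp)
  from group_hom.subgroup_img_is_subgroup[OF this assms(1)]
  show "subgroup ((\<lambda>x. a \<otimes> x \<otimes> inv a) ` P) G" .
  have "inj_on (\<lambda>x. a \<otimes> x \<otimes> inv a) P"
  proof (rule inj_onI)
    fix x y assume "x \<in> P" "y \<in> P" "a \<otimes> x \<otimes> inv a = a \<otimes> y \<otimes> inv a"
    then show "x = y" using conjugation_is_inj[OF assms(2), of x y] PG by blast
  qed
  then show "card ((\<lambda>x. a \<otimes> x \<otimes> inv a) ` P) = card P" by (rule card_image)
qed

text \<open>Within the normalizer the index of \<open>P\<close> is still prime to \<open>p\<close>,
  so some \<open>b\<close> there conjugates \<open>Q\<close> into \<open>P\<close>; since
  \<open>b\<close> normalizes \<open>P\<close>, conjugating back stays in \<open>P\<close>.\<close>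

lemma (in group) normalizing_p_subgroup_le:
  assumes fin: "finite (carrier G)" and p: "prime p"
    and P: "subgroup P G" "\<not> p dvd card (rcosets P)"
    and Q: "subgroup Q G" "card Q = p ^ k" "Q \<subseteq> conj_stab G P"
  shows "Q \<subseteq> P"
proof
  let ?N = "conj_stab G P"
  have PG: "P \<subseteq> carrier G" by (rule subgroup.subset[OF P(1)])
  have N: "subgroup ?N G" by (rule subgroup_conj_stab[OF fin PG])
  have PN: "P \<subseteq> ?N" by (rule subgroup_le_conj_stab[OF P(1)])
  interpret N: group "G\<lparr>carrier := ?N\<rparr>" by (rule subgroup_imp_group[OF N])
  have NG: "?N \<subseteq> carrier G" by (rule subgroup.subset[OF N])
  have idx: "\<not> p dvd card (rcosets\<^bsub>G\<lparr>carrier := ?N\<rparr>\<^esub> P)"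
  proof -
    have "rcosets\<^bsub>G\<lparr>carrier := ?N\<rparr>\<^esub> P = {P #> a | a. a \<in> ?N}" by (auto simp: RCOSETS_def)
    then show ?thesis using card_rcosets_mult_dvd(2)[OF P(1) N PN fin] P(2) by auto
  qed
  have finN: "finite (carrier (G\<lparr>carrier := ?N\<rparr>))" using fin NG finite_subset by auto
  obtain b where b: "b \<in> ?N" "\<And>q. q \<in> Q \<Longrightarrow> b \<otimes> q \<otimes> inv b \<in> P"
    using N.p_subgroup_conj_into[OF finN p subgroup_incl[OF Q(1) N Q(3)] Q(2)
      subgroup_incl[OF P(1) N PN] idx] N by auto
  fix q assume q: "q \<in> Q"
  have bG: "b \<in> carrier G" and qG: "q \<in> carrier G" using b(1) q NG Q(3) by blast+
  have "inv b \<in> ?N" using b(1) N by (rule subgroup.m_inv_closed[rotated])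
  then have "inv b \<otimes> (b \<otimes> q \<otimes> inv b) \<otimes> inv (inv b) \<in> P"
    using b(2)[OF q] by (simp add: conj_stab_def)
  also have "inv b \<otimes> (b \<otimes> q \<otimes> inv b) \<otimes> inv (inv b) = q"
    using bG qG by (simp add: m_assoc inv_solve_left')
  finally show "q \<in> P" .
qed

text \<open>\<open>P\<close> fixes the coset of its normalizer and no other: if a conjugate of
  \<open>P\<close> by \<open>a\<close> normalizes \<open>P\<close>, it is contained in
  \<open>P\<close>, and then \<open>a\<close> is in the normalizer. The index is the number of Sylow
  subgroups.\<close>

lemma (in group) sylow_conj_stab_index_cong:
  assumes fin: "finite (carrier G)" and p: "prime p"
    and P: "subgroup P G" "card P = p ^ k" "\<not> p dvd card (rcosets P)"
  shows "card (rcosets (conj_stab G P)) mod p = 1"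
proof -
  let ?N = "conj_stab G P"
  have PG: "P \<subseteq> carrier G" by (rule subgroup.subset[OF P(1)])
  have N: "subgroup ?N G" by (rule subgroup_conj_stab[OF fin PG])
  have PN: "P \<subseteq> ?N" by (rule subgroup_le_conj_stab[OF P(1)])
  have mem: "a \<in> ?N" if a: "a \<in> carrier G" "\<forall>q\<in>P. a \<otimes> q \<otimes> inv a \<in> ?N" for a
  proof -
    let ?Q = "(\<lambda>x. a \<otimes> x \<otimes> inv a) ` P"
    have "card ?Q = p ^ k" using subgroup_conj_image(2)[OF P(1) a(1)] P(2) by simp
    then have "?Q \<subseteq> P"
      by (rule normalizing_p_subgroup_le[OF fin p P(1,3) subgroup_conj_image(1)[OF P(1) a(1)]])
        (use a(2) in blast)
    then show ?thesis using a(1) by (auto simp: conj_stab_def)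
  qed
  have "{?N #> a | a. a \<in> carrier G \<and> (\<forall>q\<in>P. a \<otimes> q \<otimes> inv a \<in> ?N)} = {?N #> \<one>}"
  proof -
    have "?N #> a = ?N #> \<one>" if "a \<in> carrier G" "\<forall>q\<in>P. a \<otimes> q \<otimes> inv a \<in> ?N" for a
      using mem[OF that] rcos_eq_iff[OF N that(1), of \<one>] that(1) by simp
    moreover have "\<one> \<otimes> q \<otimes> inv \<one> \<in> ?N" if "q \<in> P" for q
      using that subsetD[OF PN that] subsetD[OF PG that] by simp
    ultimately show ?thesis using one_closed by blast
  qed
  then show ?thesis
    using card_rcosets_fixed_cong[OF fin p P(1,2) N] prime_gt_1_nat[OF p] by simp
qed

lemma (in group) exists_ord_prime:
  assumes fin: "finite (carrier G)" and p: "prime p" "p dvd order G"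
  obtains x where "x \<in> carrier G" "ord x = p"
proof -
  obtain H where H: "subgroup H G" "card H = p"
  proof -
    from p(2) obtain m where "order G = p * m" by (rule dvdE)
    then have "\<exists>H. subgroup H G \<and> card H = p ^ 1"
      by (intro sylow_thm[OF p(1) group_axioms _ fin, of 1 m]) simp
    then show ?thesis using that by auto
  qed
  then have "card H > 1" using p(1) prime_gt_1_nat by simp
  then obtain x where x: "x \<in> H" "x \<noteq> \<one>"
    by (metis card.empty card_1_singleton_iff is_singletonI' is_singleton_altdef less_irrefl not_one_less_zero)
  interpret H: group "G\<lparr>carrier := H\<rparr>" by (rule subgroup_imp_group[OF H(1)])
  have xG: "x \<in> carrier G" using x H(1) subgroup.mem_carrier by fast
  have "x [^] p = \<one>"
    using H.pow_order_eq_1[of x] x(1) H(2) by (simp add: order_def flip: nat_pow_consistent)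
  then have "ord x dvd p" using xG by (simp add: pow_eq_id)
  moreover have "ord x \<noteq> 1" using x(2) ord_eq_1[OF xG] by blast
  ultimately have "ord x = p" using p(1) by (auto simp: prime_nat_iff)
  with xG show thesis by (rule that)
qed

section \<open>Spanning trees of power graphs\<close>

lemma power_adj_sym: "power_adj G x y \<Longrightarrow> power_adj G y x"
  unfolding power_adj_def by blast

lemma (in group) power_adj_one: "x \<noteq> \<one> \<Longrightarrow> power_adj G x \<one>"
  unfolding power_adj_def by (metis nat_pow_0)

lemma (in group) kappa_P_eq:
  "kappa_P G = card (parent_maps (carrier G - {\<one>}) (\<lambda>v. {w \<in> carrier G. w \<noteq> v \<and> power_adj G v w}))"
  unfolding kappa_P_def by (rule num_spanning_trees_eq) (auto intro: power_adj_sym)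

lemma (in group) kappa_P_le:
  assumes fin: "finite (carrier G)"
  shows "kappa_P G \<le> order G ^ (order G - 1)"
proof -
  let ?S = "carrier G - {\<one>}"
  have "parent_maps ?S (\<lambda>v. {w \<in> carrier G. w \<noteq> v \<and> power_adj G v w}) \<subseteq> ?S \<rightarrow>\<^sub>E carrier G"
    by (intro subsetI PiE_I) (auto dest: parent_maps_mem parent_maps_PiE)
  moreover have "finite (?S \<rightarrow>\<^sub>E carrier G)" using fin by (intro finite_PiE) auto
  ultimately have "kappa_P G \<le> card (?S \<rightarrow>\<^sub>E carrier G)"
    unfolding kappa_P_eq by (rule card_mono[rotated])
  also have "\<dots> = order G ^ (order G - 1)"
    using fin by (subst card_funcsetE) (simp_all add: order_def)
  finally show ?thesis .
qed

lemma (in group) card_parent_maps_block: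
  assumes "finite B" "B \<noteq> {}" "\<one> \<notin> B" "B \<subseteq> carrier G"
    and adj: "\<And>v w. v \<in> B \<Longrightarrow> w \<in> B \<Longrightarrow> v \<noteq> w \<Longrightarrow> power_adj G v w"
  shows "card (parent_maps B (\<lambda>v. {w \<in> insert \<one> B. w \<noteq> v \<and> power_adj G v w}))
       = (card B + 1) ^ (card B - 1)"
proof -
  let ?N = "\<lambda>v. {w \<in> insert \<one> B. w \<noteq> v \<and> power_adj G v w}"
  have "insert v (?N v) = insert \<one> B" if "v \<in> B" for v
  proof -
    have "v \<noteq> \<one>" using that assms(3) by blast
    then show ?thesis using adj[OF that] power_adj_one[of v] that by auto
  qed
  then have "parent_maps B (\<lambda>v. insert v (?N v)) = parent_maps B (\<lambda>_. insert \<one> B)"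
    by (rule parent_maps_cong)
  then show ?thesis
    using card_parent_maps_complete[OF assms(1,3,2)] parent_maps_insert_self[of B ?N] by simp
qed

text \<open>No edge joins two different blocks, so the power graph consists of complete graphs glued
  together at the identity, and Cayley's formula applies to each of them.\<close>

lemma (in group) kappa_P_blocks:
  assumes fin: "finite (carrier G)" and F: "\<Union>F = carrier G - {\<one>}" "{} \<notin> F"
    and disj: "\<And>B C. B \<in> F \<Longrightarrow> C \<in> F \<Longrightarrow> B \<noteq> C \<Longrightarrow> B \<inter> C = {}"
    and clique: "\<And>B v w. B \<in> F \<Longrightarrow> v \<in> B \<Longrightarrow> w \<in> B \<Longrightarrow> v \<noteq> w \<Longrightarrow> power_adj G v w"
    and sep: "\<And>B v w. B \<in> F \<Longrightarrow> v \<in> B \<Longrightarrow> w \<in> carrier G \<Longrightarrow> w \<noteq> \<one> \<Longrightarrow> power_adj G v w \<Longrightarrow> w \<in> B"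
  shows "kappa_P G = (\<Prod>B\<in>F. (card B + 1) ^ (card B - 1))"
proof -
  let ?N = "\<lambda>v. {w \<in> carrier G. w \<noteq> v \<and> power_adj G v w}"
  have BG: "B \<subseteq> carrier G - {\<one>}" if "B \<in> F" for B using that F(1) by blast
  have finF: "finite F" using fin F(1) by (intro finite_UnionD) simp
  have "kappa_P G = (\<Prod>B\<in>F. card (parent_maps B ?N))"
    unfolding kappa_P_eq F(1)[symmetric]
  proof (rule card_parent_maps_Union[OF finF disj])
    fix B C v assume BC: "B \<in> F" "C \<in> F" "B \<noteq> C" "v \<in> B"
    have "w \<notin> ?N v" if w: "w \<in> C" for w
    proof
      assume "w \<in> ?N v"
      moreover have "w \<noteq> \<one>" using BG[OF BC(2)] w by blast
      ultimately have "w \<in> B" using sep[OF BC(1,4)] by blast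
      then show False using disj[OF BC(1,2,3)] w by blast
    qed
    then show "?N v \<inter> C = {}" by blast
  qed
  also have "\<dots> = (\<Prod>B\<in>F. (card B + 1) ^ (card B - 1))"
  proof (rule prod.cong[OF refl])
    fix B assume B: "B \<in> F"
    have "?N v = {w \<in> insert \<one> B. w \<noteq> v \<and> power_adj G v w}" if "v \<in> B" for v
      using sep[OF B that] BG[OF B] by auto
    then have "parent_maps B ?N = parent_maps B (\<lambda>v. {w \<in> insert \<one> B. w \<noteq> v \<and> power_adj G v w})"
      by (rule parent_maps_cong)
    moreover have "finite B" using BG[OF B] fin finite_subset by blast
    moreover have "B \<noteq> {}" "\<one> \<notin> B" "B \<subseteq> carrier G" using B F(2) BG[OF B] by auto
    ultimately show "card (parent_maps B ?N) = (card B + 1) ^ (card B - 1)"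
      using clique[OF B] card_parent_maps_block[of B] by simp
  qed
  finally show ?thesis .
qed

text \<open>Deleting all edges between different blocks leaves complete graphs glued at the identity
  and can only lose spanning trees. Every later lower bound for the count is an instance of this
  one.\<close>

lemma (in group) kappa_P_ge_blocks:
  assumes fin: "finite (carrier G)" and F: "\<Union>F = carrier G - {\<one>}" "{} \<notin> F"
    and disj: "\<And>B C. B \<in> F \<Longrightarrow> C \<in> F \<Longrightarrow> B \<noteq> C \<Longrightarrow> B \<inter> C = {}"
    and clique: "\<And>B v w. B \<in> F \<Longrightarrow> v \<in> B \<Longrightarrow> w \<in> B \<Longrightarrow> v \<noteq> w \<Longrightarrow> power_adj G v w"
  shows "(\<Prod>B\<in>F. (card B + 1) ^ (card B - 1)) \<le> kappa_P G"
proof -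
  define blk where "blk v = (THE B. B \<in> F \<and> v \<in> B)" for v
  have blk: "blk v = B" if "B \<in> F" "v \<in> B" for B v
    unfolding blk_def using that disj by (intro the_equality) auto
  let ?N = "\<lambda>v. {w \<in> insert \<one> (blk v). w \<noteq> v \<and> power_adj G v w}"
  have BG: "B \<subseteq> carrier G - {\<one>}" if "B \<in> F" for B using that F(1) by blast
  have finF: "finite F" using fin F(1) by (intro finite_UnionD) simp
  have "(\<Prod>B\<in>F. (card B + 1) ^ (card B - 1)) = (\<Prod>B\<in>F. card (parent_maps B ?N))"
  proof (rule prod.cong[OF refl])
    fix B assume B: "B \<in> F"
    have "parent_maps B ?N = parent_maps B (\<lambda>v. {w \<in> insert \<one> B. w \<noteq> v \<and> power_adj G v w})"
      by (rule parent_maps_cong) (simp add: blk[OF B])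
    moreover have "finite B" using BG[OF B] fin finite_subset by blast
    moreover have "B \<noteq> {}" "\<one> \<notin> B" "B \<subseteq> carrier G" using B F(2) BG[OF B] by auto
    ultimately show "(card B + 1) ^ (card B - 1) = card (parent_maps B ?N)"
      using clique[OF B] card_parent_maps_block[of B] by simp
  qed
  also have "\<dots> = card (parent_maps (\<Union>F) ?N)"
  proof (rule card_parent_maps_Union[OF finF disj, symmetric])
    fix B C v assume BC: "B \<in> F" "C \<in> F" "B \<noteq> C" "v \<in> B"
    have "insert \<one> B \<inter> C = {}" using BG[OF BC(2)] disj[OF BC(1,2,3)] by blast
    then show "?N v \<inter> C = {}" using blk[OF BC(1,4)] by auto
  qed
  also have "\<dots> \<le> kappa_P G"
    unfolding kappa_P_eq F(1)
  proof (rule card_mono)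
    show "finite (parent_maps (carrier G - {\<one>}) (\<lambda>v. {w \<in> carrier G. w \<noteq> v \<and> power_adj G v w}))"
      using fin by (intro finite_parent_maps) auto
    show "parent_maps (carrier G - {\<one>}) ?N
        \<subseteq> parent_maps (carrier G - {\<one>}) (\<lambda>v. {w \<in> carrier G. w \<noteq> v \<and> power_adj G v w})"
    proof (rule parent_maps_mono)
      fix v assume "v \<in> carrier G - {\<one>}"
      then obtain B where B: "B \<in> F" "v \<in> B" using F(1) by blast
      then show "?N v \<subseteq> {w \<in> carrier G. w \<noteq> v \<and> power_adj G v w}"
        using blk[OF B] BG[OF B(1)] by auto
    qed
  qed
  finally show ?thesis .
qed

lemma (in group) generate_eq_of_mem:
  assumes fin: "finite (carrier G)" and "y \<in> carrier G" "w \<in> carrier G"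
    and w: "y \<in> generate G {w}" "ord w = ord y"
  shows "generate G {y} = generate G {w}"
proof (rule card_subset_eq)
  have "generate G {w} \<subseteq> carrier G" using assms(3) by (intro generate_incl) simp
  then show "finite (generate G {w})" using fin finite_subset by blast
  show "generate G {y} \<subseteq> generate G {w}"
    using w(1) assms by (intro generate_subgroup_incl generate_is_subgroup) auto
  show "card (generate G {y}) = card (generate G {w})"
    using generate_pow_card assms by metis
qed

text \<open>If the order of \<open>y\<close> is maximal among the elements whose order is divisible by \<open>p\<close>, then \<open>y\<close> and
  its inverse have the common closed neighbourhood \<open>generate G {y}\<close>.\<close>

lemma (in group) odd_prime_dvd_kappa_P:
  assumes fin: "finite (carrier G)" and p: "prime p" "p > 2" "p dvd order G"
  shows "p dvd kappa_P G"
proof -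
  let ?S = "carrier G - {\<one>}" and ?N = "\<lambda>v. {w \<in> carrier G. w \<noteq> v \<and> power_adj G v w}"
  let ?X = "{x \<in> carrier G. p dvd ord x}"
  obtain x where "x \<in> carrier G" "ord x = p" using exists_ord_prime[OF fin p(1,3)] .
  then have "x \<in> ?X" by simp
  moreover have "\<forall>z. z \<in> ?X \<longrightarrow> ord z < Suc (order G)"
    using ord_le_group_order[OF fin] by (simp add: less_Suc_eq_le)
  ultimately have "\<exists>y. y \<in> ?X \<and> (\<forall>z. z \<in> ?X \<longrightarrow> ord z \<le> ord y)"
    by (rule ex_has_greatest_nat)
  then obtain y where y: "y \<in> ?X" "\<And>z. z \<in> ?X \<Longrightarrow> ord z \<le> ord y" by blast
  then have yG: "y \<in> carrier G" and py: "p dvd ord y" by auto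
  have o3: "ord y > 2"
    using dvd_imp_le[OF py] ord_ge_1[OF fin yG] p(2) by linarith
  have gen: "generate G {z} = {z [^] k | k. k \<in> (UNIV :: nat set)}" if "z \<in> carrier G" for z
    by (rule generate_pow_on_finite_carrier[OF fin that])
  have nbhd: "insert z (?N z) = generate G {y}"
    if z: "z \<in> carrier G" "generate G {z} = generate G {y}" for z
  proof
    have ordz: "ord z = ord y" using generate_pow_card[OF z(1)] generate_pow_card[OF yG] z(2) by simp
    show "insert z (?N z) \<subseteq> generate G {y}"
    proof
      fix w assume "w \<in> insert z (?N z)"
      then consider "w = z" | "w \<in> carrier G" "power_adj G z w" by blast
      then show "w \<in> generate G {y}"
      proof cases
        case 1
        then show ?thesis using z generate.incl[of z "{z}"] by auto
      next
        case 2
        then consider n :: nat where "w = z [^] n" | n :: nat where "z = w [^] n"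
          unfolding power_adj_def by blast
        then show ?thesis
        proof cases
          case 1
          then show ?thesis using gen[OF z(1)] z(2) by blast
        next
          case (2 n)
          \<comment> \<open>Since \<open>z\<close> is a power of \<open>w\<close>, its order divides
            that of \<open>w\<close>; so \<open>p\<close> divides \<open>ord w\<close>, maximality
            makes the two orders equal, and \<open>w\<close> generates the same subgroup.\<close>
          then have zw: "z \<in> generate G {w}" using gen[OF \<open>w \<in> carrier G\<close>] by blast
          have "ord z dvd ord w"
          proof -
            have "z [^] ord w = w [^] (n * ord w)" using 2 \<open>w \<in> carrier G\<close> by (simp add: nat_pow_pow)
            also have "\<dots> = \<one>" using \<open>w \<in> carrier G\<close> by (simp add: pow_eq_id)
            finally show ?thesis using z(1) by (simp add: pow_eq_id)
          qed
          then have "p dvd ord w" using py ordz dvd_trans by auto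
          then have "ord w \<le> ord y" using y(2) \<open>w \<in> carrier G\<close> by blast
          moreover have "ord z \<le> ord w"
            using \<open>ord z dvd ord w\<close> ord_ge_1[OF fin \<open>w \<in> carrier G\<close>] by (intro dvd_imp_le) auto
          ultimately have "generate G {z} = generate G {w}"
            using ordz by (intro generate_eq_of_mem[OF fin z(1) \<open>w \<in> carrier G\<close> zw]) simp
          then show ?thesis using z(2) generate.incl[of w "{w}"] by auto
        qed
      qed
    qed
    show "generate G {y} \<subseteq> insert z (?N z)"
    proof
      fix w assume "w \<in> generate G {y}"
      then obtain n :: nat where "w = z [^] n" using gen[OF z(1)] z(2) by blast
      then show "w \<in> insert z (?N z)" using z(1) by (auto simp: power_adj_def)
    qed
  qed
  have "y \<noteq> inv y"
  proof
    assume "y = inv y"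
    then have "y [^] (2::nat) = \<one>"
      using yG r_inv[OF yG] by (simp add: numeral_2_eq_2)
    then have "ord y dvd 2" using yG by (simp add: pow_eq_id)
    then show False using o3 by (auto dest: dvd_imp_le)
  qed
  have y1: "y \<noteq> \<one>" using o3 by (intro notI) simp
  have geni: "generate G {inv y} = generate G {y}"
    using yG by (intro generate_eq_of_mem[OF fin] generate.inv) simp_all
  have "card (generate G {y}) dvd card (parent_maps ?S ?N)"
    by (rule card_twin_nbhd_dvd[of _ y "inv y" \<one>])
      (use fin yG y1 \<open>y \<noteq> inv y\<close> nbhd[OF yG refl] nbhd[OF _ geni] in auto)
  then have "ord y dvd kappa_P G" using generate_pow_card[OF yG] kappa_P_eq by simp
  then show ?thesis using py by (rule dvd_trans[rotated])
qed

type_synonym mat2 = "int \<times> int \<times> int \<times> int"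

section \<open>The group PSL(2,7)\<close>

abbreviation mat2_neg :: "mat2 \<Rightarrow> mat2" where
  "mat2_neg A \<equiv> mat2_mult_mod7 (6, 0, 0, 6) A"

abbreviation mat2_pi :: "mat2 \<Rightarrow> mat2 set" where
  "mat2_pi A \<equiv> Z_SL2_7 #>\<^bsub>SL2_7\<^esub> A"

lemma carrier_SL2_7:
  "(a, b, c, d) \<in> carrier SL2_7 \<longleftrightarrow>
    a \<in> {0..6} \<and> b \<in> {0..6} \<and> c \<in> {0..6} \<and> d \<in> {0..6} \<and> (a * d - b * c) mod 7 = 1"
  by (simp add: SL2_7_def)

lemma mult_SL2_7: "monoid.mult SL2_7 = mat2_mult_mod7"
  by (simp add: SL2_7_def)

lemma one_SL2_7: "\<one>\<^bsub>SL2_7\<^esub> = (1, 0, 0, 1)"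
  by (simp add: SL2_7_def)

lemma mat2_mult_mod7_pair:
  "mat2_mult_mod7 (a, b, c, d) (a', b', c', d') =
     ((a * a' + b * c') mod 7, (a * b' + b * d') mod 7, (c * a' + d * c') mod 7, (c * b' + d * d') mod 7)"
  by (simp add: mat2_mult_mod7_def)

lemma mod7_mem: "(x::int) mod 7 \<in> {0..6}"
  using pos_mod_bound[of 7 x] pos_mod_sign[of 7 x] by simp

lemma mod7_cong: "[(x::int) mod 7 = x] (mod 7)"
  by (simp add: cong_def)

lemmas mod7_cong_intros = cong_add cong_diff cong_mult mod7_cong cong_refl

lemma mat2_mult_closed:
  assumes "A \<in> carrier SL2_7" "B \<in> carrier SL2_7"
  shows "mat2_mult_mod7 A B \<in> carrier SL2_7"
proof -
  obtain a b c d a' b' c' d' where AB: "A = (a, b, c, d)" "B = (a', b', c', d')"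
    by (metis prod_cases4)
  have "((a * a' + b * c') mod 7 * ((c * b' + d * d') mod 7)
        - (a * b' + b * d') mod 7 * ((c * a' + d * c') mod 7)) mod 7
      = ((a * a' + b * c') * (c * b' + d * d') - (a * b' + b * d') * (c * a' + d * c')) mod 7"
    unfolding cong_def[symmetric] by (intro mod7_cong_intros)
  also have "(a * a' + b * c') * (c * b' + d * d') - (a * b' + b * d') * (c * a' + d * c')
      = (a * d - b * c) * (a' * d' - b' * c')" by (simp add: algebra_simps)
  also have "\<dots> mod 7 = ((a * d - b * c) mod 7 * ((a' * d' - b' * c') mod 7)) mod 7"
    by (rule mod_mult_eq[symmetric])
  also have "\<dots> = 1" using assms unfolding AB carrier_SL2_7 by simp
  finally show ?thesis
    unfolding AB mat2_mult_mod7_pair carrier_SL2_7 using mod7_mem by blast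
qed

lemma mat2_mult_assoc:
  "mat2_mult_mod7 (mat2_mult_mod7 A B) C = mat2_mult_mod7 A (mat2_mult_mod7 B C)"
proof -
  obtain a b c d a' b' c' d' a'' b'' c'' d''
    where "A = (a, b, c, d)" "B = (a', b', c', d')" "C = (a'', b'', c'', d'')"
    by (metis prod_cases4)
  moreover have "(p mod 7 * x + q mod 7 * y) mod 7 = (p * x + q * y) mod 7"
    "(x * (p mod 7) + y * (q mod 7)) mod 7 = (x * p + y * q) mod 7" for p q x y :: int
    unfolding cong_def[symmetric] by (intro mod7_cong_intros)+
  ultimately show ?thesis
    by (simp only: mat2_mult_mod7_pair) (simp add: algebra_simps)
qed

lemma group_SL2_7: "group SL2_7"
proof (rule groupI)
  show "A \<otimes>\<^bsub>SL2_7\<^esub> B \<in> carrier SL2_7" if "A \<in> carrier SL2_7" "B \<in> carrier SL2_7" for A B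
    using mat2_mult_closed[OF that] by (simp only: mult_SL2_7)
  show "\<one>\<^bsub>SL2_7\<^esub> \<in> carrier SL2_7" by (simp add: carrier_SL2_7 one_SL2_7)
  show "A \<otimes>\<^bsub>SL2_7\<^esub> B \<otimes>\<^bsub>SL2_7\<^esub> C = A \<otimes>\<^bsub>SL2_7\<^esub> (B \<otimes>\<^bsub>SL2_7\<^esub> C)" for A B C
    unfolding mult_SL2_7 by (rule mat2_mult_assoc)
  fix A assume A: "A \<in> carrier SL2_7"
  obtain a b c d where Ae: "A = (a, b, c, d)" by (metis prod_cases4)
  show "\<one>\<^bsub>SL2_7\<^esub> \<otimes>\<^bsub>SL2_7\<^esub> A = A"
    using A unfolding Ae carrier_SL2_7 by (simp add: mat2_mult_mod7_pair mult_SL2_7 one_SL2_7)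
  let ?B = "(d, (- b) mod 7, (- c) mod 7, a)"
  have "[d * a - (- b) mod 7 * ((- c) mod 7) = d * a - (- b) * (- c)] (mod 7)"
    by (intro mod7_cong_intros)
  moreover have "d * a - (- b) * (- c) = a * d - b * c" by (simp add: algebra_simps)
  ultimately have "(d * a - (- b) mod 7 * ((- c) mod 7)) mod 7 = (a * d - b * c) mod 7"
    by (simp only: cong_def)
  then have "?B \<in> carrier SL2_7"
    using A mod7_mem[of "- b"] mod7_mem[of "- c"] unfolding Ae carrier_SL2_7 by simp
  moreover have "mat2_mult_mod7 ?B A = (1, 0, 0, 1)"
  proof -
    have e: "(d * a + (- b) mod 7 * c) mod 7 = (d * a + (- b) * c) mod 7"
      "(d * b + (- b) mod 7 * d) mod 7 = (d * b + (- b) * d) mod 7"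
      "((- c) mod 7 * a + a * c) mod 7 = ((- c) * a + a * c) mod 7"
      "((- c) mod 7 * b + a * d) mod 7 = ((- c) * b + a * d) mod 7"
      unfolding cong_def[symmetric] by (intro mod7_cong_intros)+
    have "d * a + (- b) * c = a * d - b * c" "d * b + (- b) * d = 0" "(- c) * a + a * c = 0"
      "(- c) * b + a * d = a * d - b * c" by (simp_all add: algebra_simps)
    moreover have "(a * d - b * c) mod 7 = 1" using A unfolding Ae carrier_SL2_7 by blast
    ultimately show ?thesis unfolding Ae mat2_mult_mod7_pair e by (simp add: mult.commute)
  qed
  ultimately show "\<exists>B\<in>carrier SL2_7. B \<otimes>\<^bsub>SL2_7\<^esub> A = \<one>\<^bsub>SL2_7\<^esub>"
    unfolding mult_SL2_7 one_SL2_7 by (rule bexI[rotated])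
qed

interpretation SL: group SL2_7 by (rule group_SL2_7)

lemma normal_Z_SL2_7: "Z_SL2_7 \<lhd> SL2_7"
proof (rule SL.normalI)
  show "subgroup Z_SL2_7 SL2_7"
  proof (rule SL.finite_mult_closed_subgroup)
    have "carrier SL2_7 \<subseteq> {0..6} \<times> {0..6} \<times> {0..6} \<times> {0..6}"
      by (auto simp: SL2_7_def)
    then show "finite (carrier SL2_7)" by (rule finite_subset) simp
  qed (auto simp: Z_SL2_7_def carrier_SL2_7 one_SL2_7 mult_SL2_7 mat2_mult_mod7_pair)
  show "\<forall>x\<in>carrier SL2_7. Z_SL2_7 #>\<^bsub>SL2_7\<^esub> x = x <#\<^bsub>SL2_7\<^esub> Z_SL2_7"
  proof
    fix x :: mat2
    obtain a b c d where "x = (a, b, c, d)" by (metis prod_cases4)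
    then show "Z_SL2_7 #>\<^bsub>SL2_7\<^esub> x = x <#\<^bsub>SL2_7\<^esub> Z_SL2_7"
      by (simp add: Z_SL2_7_def r_coset_def l_coset_def mult_SL2_7 mat2_mult_mod7_pair mult.commute)
  qed
qed

interpretation Z: normal Z_SL2_7 SL2_7 by (rule normal_Z_SL2_7)

interpretation PSL: group PSL2_7
  unfolding PSL2_7_def by (rule Z.factorgroup_is_group)

lemma mat2_pi_eq: "A \<in> carrier SL2_7 \<Longrightarrow> mat2_pi A = {A, mat2_neg A}"
  using SL.l_one[of A] by (auto simp: r_coset_def Z_SL2_7_def mult_SL2_7 one_SL2_7)

lemma mat2_pi_hom: "mat2_pi \<in> hom SL2_7 PSL2_7"
  unfolding PSL2_7_def by (rule Z.r_coset_hom_Mod)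

lemma mat2_pi_mult:
  "A \<in> carrier SL2_7 \<Longrightarrow> B \<in> carrier SL2_7 \<Longrightarrow>
    mat2_pi A \<otimes>\<^bsub>PSL2_7\<^esub> mat2_pi B = mat2_pi (mat2_mult_mod7 A B)"
  using hom_mult[OF mat2_pi_hom] by (simp add: mult_SL2_7)

lemma mat2_pi_closed: "A \<in> carrier SL2_7 \<Longrightarrow> mat2_pi A \<in> carrier PSL2_7"
  using hom_in_carrier[OF mat2_pi_hom] .

lemma one_PSL2_7: "\<one>\<^bsub>PSL2_7\<^esub> = mat2_pi (1, 0, 0, 1)"
  using SL.coset_mult_one[OF Z.subset] by (simp add: PSL2_7_def FactGroup_def one_SL2_7)

lemma carrier_PSL2_7: "carrier PSL2_7 = mat2_pi ` carrier SL2_7"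
  by (auto simp: PSL2_7_def FactGroup_def RCOSETS_def)

section \<open>Canonical representatives and the table of maximal cyclic subgroups\<close>

definition canonical :: "mat2 \<Rightarrow> bool" where
  "canonical A = (case A of (a, b, c, d) \<Rightarrow> if a = 0 then b \<le> 3 else a \<le> 3)"

text \<open>Determinant 1 makes the top row nonzero, and negation replaces a nonzero entry x by 7 -
  x. So only one of the two representatives of a class has its first nonzero top entry at most
  3.\<close>

lemma canonical_inj:
  assumes "A \<in> carrier SL2_7" "B \<in> carrier SL2_7" "canonical A" "canonical B" "mat2_pi A = mat2_pi B"
  shows "A = B"
proof (rule ccontr)
  assume "A \<noteq> B"
  then have AB: "A = mat2_neg B" using assms(5) unfolding mat2_pi_eq[OF assms(1)] mat2_pi_eq[OF assms(2)] by auto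
  obtain a b c d where B: "B = (a, b, c, d)" by (metis prod_cases4)
  have a: "a \<in> {0..6}" "b \<in> {0..6}" using assms(2) unfolding B carrier_SL2_7 by auto
  have ab: "a \<noteq> 0 \<or> b \<noteq> 0" using assms(2) unfolding B carrier_SL2_7 by auto
  have *: "canonical (6 * a mod 7, 6 * b mod 7, 6 * c mod 7, 6 * d mod 7)"
    using assms(3) unfolding AB B by (simp add: mat2_mult_mod7_pair)
  have m: "6 * x mod 7 = (if x = 0 then 0 else 7 - x)" if "x \<in> {0..6}" for x :: int
  proof -
    have "x = 0 \<or> x = 1 \<or> x = 2 \<or> x = 3 \<or> x = 4 \<or> x = 5 \<or> x = 6" using that by auto
    then show ?thesis by auto
  qed
  show False
    using * assms(4) a ab unfolding B canonical_def m[OF a(1)] m[OF a(2)]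
    by (auto split: if_splits)
qed

text \<open>Representatives of the nonidentity elements of \<open>PSL2_7\<close>, grouped by maximal cyclic subgroup; each
  list consists of the successive powers of its head.\<close>

definition blocks :: "mat2 list list" where
  "blocks =
    [[(0,1,6,2), (1,5,2,4), (2,4,3,3), (3,3,4,2), (3,5,2,6), (2,6,1,0)],
     [(0,1,6,5), (1,2,5,4), (2,3,4,3), (3,4,3,2), (3,2,5,6), (2,1,6,0)],
     [(0,2,3,2), (1,3,1,4), (2,1,5,3), (3,6,2,2), (3,3,1,6), (2,5,4,0)],
     [(0,2,3,5), (1,4,6,4), (2,6,2,3), (3,1,5,2), (3,4,6,6), (2,2,3,0)],
     [(0,3,2,2), (1,1,3,4), (2,5,1,3), (3,2,6,2), (3,1,3,6), (2,4,5,0)],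
     [(0,3,2,5), (1,6,4,4), (2,2,6,3), (3,5,1,2), (3,6,4,6), (2,3,2,0)],
     [(1,0,1,1), (1,0,2,1), (1,0,3,1), (1,0,4,1), (1,0,5,1), (1,0,6,1)],
     [(1,1,0,1), (1,2,0,1), (1,3,0,1), (1,4,0,1), (1,5,0,1), (1,6,0,1)],
     [(0,1,6,3), (1,4,3,6), (3,6,1,0)],
     [(0,1,6,4), (1,3,4,6), (3,1,6,0)],
     [(0,2,3,3), (1,1,5,6), (3,5,4,0)],
     [(0,2,3,4), (1,6,2,6), (3,2,3,0)],
     [(0,3,2,3), (1,5,1,6), (3,4,5,0)],
     [(0,3,2,4), (1,2,6,6), (3,3,2,0)],
     [(1,1,1,2), (2,3,3,5), (2,6,6,1)],
     [(1,1,2,3), (3,4,1,4), (3,6,5,1)],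
     [(1,2,1,3), (3,1,4,4), (3,5,6,1)],
     [(1,2,4,2), (2,6,5,5), (2,5,3,1)],
     [(1,3,3,3), (3,5,5,4), (3,4,4,1)],
     [(1,3,5,2), (2,2,1,5), (2,4,2,1)],
     [(1,4,2,2), (2,5,6,5), (2,3,5,1)],
     [(1,4,4,3), (3,2,2,4), (3,3,3,1)],
     [(1,5,3,2), (2,1,2,5), (2,2,4,1)],
     [(1,5,6,3), (3,6,3,4), (3,2,1,1)],
     [(1,6,5,3), (3,3,6,4), (3,1,2,1)],
     [(1,6,6,2), (2,4,4,5), (2,1,1,1)],
     [(2,1,3,2), (0,3,2,0), (2,6,4,2)],
     [(2,2,5,2), (0,1,6,0), (2,5,2,2)],
     [(2,3,1,2), (0,2,3,0), (2,4,6,2)],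
     [(0,1,6,1), (1,6,1,0)],
     [(0,1,6,6), (1,1,6,0)],
     [(0,2,3,1), (1,5,4,0)],
     [(0,2,3,6), (1,2,3,0)],
     [(0,3,2,1), (1,4,5,0)],
     [(0,3,2,6), (1,3,2,0)],
     [(1,1,4,5), (2,1,4,6)],
     [(1,2,2,5), (2,2,2,6)],
     [(1,3,6,5), (2,3,6,6)],
     [(1,4,1,5), (2,4,1,6)],
     [(1,5,5,5), (2,5,5,6)],
     [(1,6,3,5), (2,6,3,6)],
     [(2,0,0,4), (3,0,0,5)],
     [(2,0,1,4), (3,0,1,5)],
     [(2,0,2,4), (3,0,2,5)],
     [(2,0,3,4), (3,0,3,5)],
     [(2,0,4,4), (3,0,4,5)],
     [(2,0,5,4), (3,0,5,5)],
     [(2,0,6,4), (3,0,6,5)],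
     [(2,1,0,4), (3,1,0,5)],
     [(2,2,0,4), (3,2,0,5)],
     [(2,3,0,4), (3,3,0,5)],
     [(2,4,0,4), (3,4,0,5)],
     [(2,5,0,4), (3,5,0,5)],
     [(2,6,0,4), (3,6,0,5)],
     [(3,1,1,3), (3,6,6,3)],
     [(3,2,4,3), (3,5,3,3)],
     [(3,3,5,3), (3,4,2,3)]]"

text \<open>Successive products are compared up to sign because the table holds one representative
  of each pair {A, -A}. The product after the last entry has to be I or -I, which closes the
  cycle.\<close>

fun power_list :: "mat2 \<Rightarrow> mat2 list \<Rightarrow> bool" where
  "power_list g [] \<longleftrightarrow> False"
| "power_list g [x] \<longleftrightarrow> mat2_mult_mod7 x g \<in> {(1, 0, 0, 1), (6, 0, 0, 6)}"
| "power_list g (x # y # xs) \<longleftrightarrow>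
    (mat2_mult_mod7 x g = y \<or> mat2_mult_mod7 x g = mat2_neg y) \<and> power_list g (y # xs)"

text \<open>An executable form of membership in \<open>carrier SL2_7\<close>, so that the table can
  be checked by evaluation.\<close>

definition det_one :: "mat2 \<Rightarrow> bool" where
  "det_one A = (case A of (a, b, c, d) \<Rightarrow> 0 \<le> a \<and> a \<le> 6 \<and> 0 \<le> b \<and> b \<le> 6 \<and> 0 \<le> c \<and> c \<le> 6 \<and>
     0 \<le> d \<and> d \<le> 6 \<and> (a * d - b * c) mod 7 = 1)"

lemma blocks_power_list: "list_all (\<lambda>bs. power_list (hd bs) bs \<and> length bs \<in> {6, 3, 2}) blocks"
  by code_simp

lemma map_length_blocks: "map length blocks = replicate 8 6 @ replicate 21 3 @ replicate 28 2"
  by (simp add: blocks_def numeral_eq_Suc)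

lemma blocks_det_canonical: "list_all (list_all (\<lambda>A. det_one A \<and> canonical A)) blocks"
  by code_simp

lemma blocks_distinct: "distinct ((1, 0, 0, 1) # concat blocks)"
  by code_simp

text \<open>There are 48 nonzero top rows. For each of them the determinant condition leaves a line
  of 7 bottom rows, parametrized by \<open>c\<close> when \<open>a \<noteq> 0\<close> and by
  \<open>d\<close> when \<open>a = 0\<close>, and 48 * 7 = 336. The table supplies the matching
  lower bound.\<close>

lemma card_SL2_7_le: "card (carrier SL2_7) \<le> 336"
proof -
  let ?T = "({0..6} \<times> {0..6} - {(0, 0)}) \<times> {0..6::int} :: ((int \<times> int) \<times> int) set"
  let ?h = "\<lambda>(a, b, c, d). ((a, b), if a = 0 then d else c) :: (int \<times> int) \<times> int"
  have cancel: "y = z" if xyz: "x \<in> {0..6}" "x \<noteq> 0" "y \<in> {0..6}" "z \<in> {0..6}"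
    "(x * y - t) mod 7 = (x * z - t) mod 7" for x y z t :: int
  proof -
    have "7 dvd x * y - t - (x * z - t)" using xyz(5) by (simp only: mod_eq_dvd_iff)
    moreover have "x * y - t - (x * z - t) = x * (y - z)" by (simp add: algebra_simps)
    ultimately have "7 dvd x * (y - z)" by simp
    moreover have "coprime (7::int) x"
    proof -
      have "prime (7::int)" by simp
      moreover have "\<not> 7 dvd x" using xyz(1,2) by (auto dest: zdvd_imp_le)
      ultimately show ?thesis by (rule prime_imp_coprime)
    qed
    ultimately have d: "7 dvd y - z" using coprime_dvd_mult_right_iff by blast
    show ?thesis
    proof (rule ccontr)
      assume "y \<noteq> z"
      then have "\<bar>7\<bar> \<le> \<bar>y - z\<bar>" by (intro dvd_imp_le_int[OF _ d]) simp
      then show False using xyz(3,4) by (simp add: abs_if split: if_splits)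
    qed
  qed
  have "inj_on ?h (carrier SL2_7)"
  proof (rule inj_onI)
    fix A B assume AB: "A \<in> carrier SL2_7" "B \<in> carrier SL2_7" "?h A = ?h B"
    obtain a b c d where eA: "A = (a, b, c, d)" by (metis prod_cases4)
    obtain a' b' c' d' where eB: "B = (a', b', c', d')" by (metis prod_cases4)
    have "a' = a" "b' = b" using AB(3) by (simp_all add: eA eB)
    then have e: "A = (a, b, c, d)" "B = (a, b, c', d')" using eA eB by simp_all
    have r: "a \<in> {0..6}" "b \<in> {0..6}" "c \<in> {0..6}" "d \<in> {0..6}" "c' \<in> {0..6}" "d' \<in> {0..6}"
      and dA: "(a * d - b * c) mod 7 = 1" and dB: "(a * d' - b * c') mod 7 = 1"
      using AB(1,2) unfolding e carrier_SL2_7 by simp_all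
    show "A = B"
    proof (cases "a = 0")
      case False
      then have "c' = c" using AB(3) e by simp
      then show ?thesis using cancel[OF r(1) False r(4,6), of "b * c"] dA dB e by simp
    next
      case True
      then have d: "d' = d" using AB(3) e by simp
      have "b \<noteq> 0" using True dA by auto
      moreover have "(b * c - 0) mod 7 = (b * c' - 0) mod 7"
      proof -
        have "(- (b * c)) mod 7 = (- (b * c')) mod 7" using True dA dB by simp
        from mod_minus_cong[OF this] show ?thesis by simp
      qed
      ultimately have "c = c'" using cancel[OF r(2) _ r(3,5), of 0] by simp
      then show ?thesis using d e by simp
    qed
  qed
  moreover have "?h ` carrier SL2_7 \<subseteq> ?T"
  proof
    fix t assume "t \<in> ?h ` carrier SL2_7"
    then obtain a b c d where e: "(a, b, c, d) \<in> carrier SL2_7" "t = ?h (a, b, c, d)" by fastforce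
    then have "a \<noteq> 0 \<or> b \<noteq> 0" "a \<in> {0..6}" "b \<in> {0..6}" "c \<in> {0..6}" "d \<in> {0..6}"
      unfolding carrier_SL2_7 by auto
    then show "t \<in> ?T" using e(2) by simp
  qed
  moreover have "finite ?T" by simp
  ultimately have "card (carrier SL2_7) \<le> card ?T" by (rule card_inj_on_le)
  also have "card ?T = 336"
    by (subst card_cartesian_product) (simp add: card_Diff_subset card_cartesian_product)
  finally show ?thesis .
qed

lemma finite_SL2_7: "finite (carrier SL2_7)"
  by (rule finite_subset[of _ "{0..6} \<times> {0..6} \<times> {0..6} \<times> {0..6}"]) (auto simp: SL2_7_def)

lemma order_PSL2_7_le: "order PSL2_7 \<le> 168"
proof -
  have "order PSL2_7 * card Z_SL2_7 = card (carrier SL2_7)"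
    using SL.lagrange[OF Z.is_subgroup] by (simp add: order_def PSL2_7_def FactGroup_def)
  moreover have "card Z_SL2_7 = 2" by (simp add: Z_SL2_7_def)
  ultimately show ?thesis using card_SL2_7_le by simp
qed

lemma finite_PSL2_7: "finite (carrier PSL2_7)"
  unfolding carrier_PSL2_7 using finite_SL2_7 by blast

lemma block_mem:
  assumes "bs \<in> set blocks" "A \<in> set bs"
  shows "A \<in> carrier SL2_7" "canonical A" "A \<noteq> (1, 0, 0, 1)"
proof -
  have "det_one A \<and> canonical A" using blocks_det_canonical assms by (simp add: list_all_iff)
  then show "A \<in> carrier SL2_7" "canonical A"
    by (cases A; simp add: det_one_def carrier_SL2_7)+
  show "A \<noteq> (1, 0, 0, 1)" using blocks_distinct assms by auto
qed

lemma one_mem_SL2_7: "(1, 0, 0, 1) \<in> carrier SL2_7" "canonical (1, 0, 0, 1)"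
  by (simp_all add: carrier_SL2_7 canonical_def)

lemma mat2_pi_inj_blocks: "inj_on mat2_pi (set ((1, 0, 0, 1) # concat blocks))"
proof (rule inj_onI)
  have mem: "A \<in> carrier SL2_7 \<and> canonical A" if "A \<in> set ((1, 0, 0, 1) # concat blocks)" for A
  proof (cases "A = (1, 0, 0, 1)")
    case False
    then obtain bs where "bs \<in> set blocks" "A \<in> set bs" using \<open>A \<in> _\<close> by auto
    then show ?thesis using block_mem(1,2) by blast
  qed (simp add: one_mem_SL2_7)
  fix A B assume "A \<in> set ((1, 0, 0, 1) # concat blocks)" "B \<in> set ((1, 0, 0, 1) # concat blocks)"
    "mat2_pi A = mat2_pi B"
  then show "A = B" using canonical_inj mem by blast
qed

text \<open>The identity and the 167 entries of the table lie in distinct classes, and the group has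
  at most 168 elements; so the table is complete.\<close>

lemma carrier_PSL2_7_blocks:
  "carrier PSL2_7 = mat2_pi ` set ((1, 0, 0, 1) # concat blocks)" "order PSL2_7 = 168"
proof -
  let ?L = "(1, 0, 0, 1) # concat blocks"
  have "length (concat blocks) = 167" by (simp add: blocks_def)
  then have c: "card (mat2_pi ` set ?L) = 168"
    using card_image[OF mat2_pi_inj_blocks] distinct_card[OF blocks_distinct] by simp
  have sub: "mat2_pi ` set ?L \<subseteq> carrier PSL2_7"
  proof
    fix X assume "X \<in> mat2_pi ` set ?L"
    then obtain A where X: "X = mat2_pi A" "A \<in> set ?L" by blast
    show "X \<in> carrier PSL2_7"
    proof (cases "A = (1, 0, 0, 1)")
      case False
      then obtain bs where "bs \<in> set blocks" "A \<in> set bs" using X(2) by auto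
      then show ?thesis using block_mem(1) mat2_pi_closed X(1) by blast
    qed (use X(1) one_mem_SL2_7 mat2_pi_closed in blast)
  qed
  have "card (carrier PSL2_7) \<le> card (mat2_pi ` set ?L)"
    using order_PSL2_7_le c by (simp add: order_def)
  then show *: "carrier PSL2_7 = mat2_pi ` set ?L"
    using card_seteq[OF finite_PSL2_7 sub] by simp
  show "order PSL2_7 = 168" using c by (simp only: order_def *)
qed

lemma mat2_pi_neg:
  assumes "A \<in> carrier SL2_7"
  shows "mat2_pi (mat2_neg A) = mat2_pi A"
proof -
  have z: "(6, 0, 0, 6) \<in> carrier SL2_7" "(6, 0, 0, 6) \<in> Z_SL2_7"
    by (simp_all add: carrier_SL2_7 Z_SL2_7_def)
  have "mat2_pi (mat2_neg A) = mat2_pi (6, 0, 0, 6) #>\<^bsub>SL2_7\<^esub> A"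
    using SL.coset_mult_assoc[OF Z.subset z(1) assms] by (simp add: mult_SL2_7)
  then show ?thesis using SL.coset_join2[OF z(1) Z.is_subgroup z(2)] by simp
qed

text \<open>The recursion drops the head of the list while \<open>g\<close> stays fixed, so the
  induction carries an offset \<open>k\<close> for the exponent of the first entry. It is later used
  with \<open>k = 1\<close>.\<close>

lemma power_list_pow:
  assumes "power_list g bs" "g \<in> carrier SL2_7" "set bs \<subseteq> carrier SL2_7"
    "mat2_pi (hd bs) = mat2_pi g [^]\<^bsub>PSL2_7\<^esub> (k::nat)"
  shows "(\<forall>i<length bs. mat2_pi (bs ! i) = mat2_pi g [^]\<^bsub>PSL2_7\<^esub> (k + i)) \<and>
    mat2_pi g [^]\<^bsub>PSL2_7\<^esub> (k + length bs) = \<one>\<^bsub>PSL2_7\<^esub>"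
  using assms
proof (induction g bs arbitrary: k rule: power_list.induct)
  case (2 g x)
  have "mat2_pi g [^]\<^bsub>PSL2_7\<^esub> k = mat2_pi x" using 2(4) by simp
  then have "mat2_pi g [^]\<^bsub>PSL2_7\<^esub> Suc k = mat2_pi x \<otimes>\<^bsub>PSL2_7\<^esub> mat2_pi g"
    by (simp only: nat_pow_Suc)
  also have "\<dots> = mat2_pi (mat2_mult_mod7 x g)"
    using 2(2,3) by (intro mat2_pi_mult) simp_all
  also have "mat2_mult_mod7 x g \<in> Z_SL2_7"
    using 2(1) unfolding Z_SL2_7_def by simp
  then have "mat2_pi (mat2_mult_mod7 x g) = \<one>\<^bsub>PSL2_7\<^esub>"
    using SL.coset_join2[OF subsetD[OF Z.subset] Z.is_subgroup]
    by (simp add: PSL2_7_def FactGroup_def)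
  finally show ?case using 2(4) by (simp add: less_Suc_eq)
next
  case (3 g x y xs)
  have xy: "x \<in> carrier SL2_7" "y \<in> carrier SL2_7" using 3(4) by auto
  have "mat2_pi y = mat2_pi (mat2_mult_mod7 x g)"
  proof -
    from 3(2) have "mat2_mult_mod7 x g = y \<or> mat2_mult_mod7 x g = mat2_neg y" by simp
    then show ?thesis by (elim disjE) (simp_all only: mat2_pi_neg[OF xy(2)])
  qed
  also have "\<dots> = mat2_pi x \<otimes>\<^bsub>PSL2_7\<^esub> mat2_pi g" by (rule mat2_pi_mult[OF xy(1) 3(3), symmetric])
  also have "\<dots> = mat2_pi g [^]\<^bsub>PSL2_7\<^esub> Suc k" using 3(5) by (simp only: nat_pow_Suc list.sel(1))
  finally have y: "mat2_pi y = mat2_pi g [^]\<^bsub>PSL2_7\<^esub> Suc k" .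
  have IH: "(\<forall>i<length (y # xs). mat2_pi ((y # xs) ! i) = mat2_pi g [^]\<^bsub>PSL2_7\<^esub> (Suc k + i)) \<and>
    mat2_pi g [^]\<^bsub>PSL2_7\<^esub> (Suc k + length (y # xs)) = \<one>\<^bsub>PSL2_7\<^esub>"
  proof (rule 3(1))
    show "power_list g (y # xs)" using 3(2) by simp
    show "set (y # xs) \<subseteq> carrier SL2_7" using 3(4) by simp
    show "mat2_pi (hd (y # xs)) = mat2_pi g [^]\<^bsub>PSL2_7\<^esub> Suc k" using y by (simp only: list.sel(1))
  qed (rule 3(3))
  have "mat2_pi ((x # y # xs) ! i) = mat2_pi g [^]\<^bsub>PSL2_7\<^esub> (k + i)" if "i < length (x # y # xs)" for i
  proof (cases i)
    case 0
    then show ?thesis using 3(5) by (simp only: nth_Cons_0 list.sel(1) add_0_right)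
  next
    case (Suc j)
    then have "j < length (y # xs)" using that by simp
    with IH have "mat2_pi ((y # xs) ! j) = mat2_pi g [^]\<^bsub>PSL2_7\<^esub> (Suc k + j)" by blast
    then show ?thesis using Suc by (simp only: nth_Cons_Suc add_Suc_shift)
  qed
  moreover have "mat2_pi g [^]\<^bsub>PSL2_7\<^esub> (k + length (x # y # xs)) = \<one>\<^bsub>PSL2_7\<^esub>"
    using IH by (simp only: list.size(4) add_Suc_right add_Suc_shift add_0_right)
  ultimately show ?case by blast
qed simp_all

lemma block_cyclic:
  assumes "bs \<in> set blocks"
  obtains g where "g \<in> carrier PSL2_7" "g [^]\<^bsub>PSL2_7\<^esub> (length bs + 1) = \<one>\<^bsub>PSL2_7\<^esub>"
    "mat2_pi ` set bs = {g [^]\<^bsub>PSL2_7\<^esub> i | i. 1 \<le> i \<and> i \<le> length bs}"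
    "length bs \<in> {6, 3, 2}"
proof -
  have bs: "power_list (hd bs) bs" "length bs \<in> {6, 3, 2}"
    using blocks_power_list assms by (simp_all add: list_all_iff)
  have sub: "set bs \<subseteq> carrier SL2_7" using block_mem(1)[OF assms] by blast
  have hd: "hd bs \<in> carrier SL2_7" using sub bs(2) by (cases bs) auto
  let ?g = "mat2_pi (hd bs)"
  have g: "?g \<in> carrier PSL2_7" by (rule mat2_pi_closed[OF hd])
  have *: "(\<forall>i<length bs. mat2_pi (bs ! i) = ?g [^]\<^bsub>PSL2_7\<^esub> (1 + i)) \<and>
      ?g [^]\<^bsub>PSL2_7\<^esub> (1 + length bs) = \<one>\<^bsub>PSL2_7\<^esub>"
    by (rule power_list_pow[OF bs(1) hd sub]) (use g in simp)
  have "mat2_pi ` set bs = {mat2_pi (bs ! i) | i. i < length bs}"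
    by (auto simp: set_conv_nth)
  also have "\<dots> = {?g [^]\<^bsub>PSL2_7\<^esub> i | i. 1 \<le> i \<and> i \<le> length bs}"
  proof
    show "{mat2_pi (bs ! i) | i. i < length bs} \<subseteq> {?g [^]\<^bsub>PSL2_7\<^esub> i | i. 1 \<le> i \<and> i \<le> length bs}"
    proof
      fix X assume "X \<in> {mat2_pi (bs ! i) | i. i < length bs}"
      then obtain i where "i < length bs" "X = mat2_pi (bs ! i)" by blast
      then have "X = ?g [^]\<^bsub>PSL2_7\<^esub> (1 + i) \<and> 1 \<le> 1 + i \<and> 1 + i \<le> length bs" using * by simp
      then show "X \<in> {?g [^]\<^bsub>PSL2_7\<^esub> i | i. 1 \<le> i \<and> i \<le> length bs}" by blast
    qed
    show "{?g [^]\<^bsub>PSL2_7\<^esub> i | i. 1 \<le> i \<and> i \<le> length bs} \<subseteq> {mat2_pi (bs ! i) | i. i < length bs}"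
    proof
      fix X assume "X \<in> {?g [^]\<^bsub>PSL2_7\<^esub> i | i. 1 \<le> i \<and> i \<le> length bs}"
      then obtain i where i: "1 \<le> i" "i \<le> length bs" "X = ?g [^]\<^bsub>PSL2_7\<^esub> i" by blast
      then have "i - 1 < length bs" "1 + (i - 1) = i" by auto
      then have "mat2_pi (bs ! (i - 1)) = X" using * i(3) by metis
      then show "X \<in> {mat2_pi (bs ! i) | i. i < length bs}" using \<open>i - 1 < length bs\<close> by blast
    qed
  qed
  finally show thesis using that[OF g _ _ bs(2)] * by simp
qed

lemma (in group) nat_pow_mod_of_pow_one:
  assumes "g \<in> carrier G" "g [^] m = \<one>"
  shows "g [^] (a::nat) = g [^] (a mod m)"
proof -
  have "g [^] a = g [^] (m * (a div m) + a mod m)" by simp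
  also have "\<dots> = (g [^] m) [^] (a div m) \<otimes> g [^] (a mod m)"
    using assms(1) by (simp only: nat_pow_mult[symmetric] nat_pow_pow)
  finally show ?thesis using assms by simp
qed

text \<open>The subgroups of a cyclic group of prime power order form a chain, so of two elements
  one is a power of the other. For the three moduli at hand this is checked on exponents by
  enumeration.\<close>

lemma (in group) power_adj_prime_power_cyclic:
  assumes g: "g \<in> carrier G" "g [^] m = \<one>" and m: "m \<in> {7, 4, 3::nat}"
    and ij: "i < m" "j < m" "g [^] i \<noteq> g [^] j"
  shows "power_adj G (g [^] i) (g [^] j)"
proof -
  note red = nat_pow_mod_of_pow_one[OF g]
  have "\<forall>i\<in>set [0..<m]. \<forall>j\<in>set [0..<m].
      (\<exists>n\<in>set [0..<m]. i * n mod m = j) \<or> (\<exists>n\<in>set [0..<m]. j * n mod m = i)"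
  proof -
    consider "m = 7" | "m = 4" | "m = 3" using m by blast
    then show ?thesis by cases (simp only:, code_simp)+
  qed
  then have "(\<exists>n\<in>set [0..<m]. i * n mod m = j) \<or> (\<exists>n\<in>set [0..<m]. j * n mod m = i)"
    using ij(1,2) by (simp only: set_upt atLeastLessThan_iff) simp
  then consider n where "i * n mod m = j" | n where "j * n mod m = i" by blast
  then show ?thesis
  proof cases
    case (1 n)
    then have "g [^] j = (g [^] i) [^] n" using red[of "i * n"] g(1) by (simp add: nat_pow_pow)
    then show ?thesis using ij(3) unfolding power_adj_def by blast
  next
    case (2 n)
    then have "g [^] i = (g [^] j) [^] n" using red[of "j * n"] g(1) by (simp add: nat_pow_pow)
    then show ?thesis using ij(3) unfolding power_adj_def by blast
  qed
qed

text \<open>Powers of an element never leave its block except to the identity, so no edge joins two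
  blocks. A block of length n gives \<open>(n + 1) ^ (n - 1)\<close>: 8 blocks contribute
  \<open>7 ^ 5\<close> each, 21 contribute \<open>4 ^ 2\<close>, and 28 contribute 3.\<close>

lemma kappa_P_PSL2_7: "kappa_P PSL2_7 = 7 ^ 40 * 3 ^ 28 * 4 ^ 42"
proof -
  define B where "B bs = mat2_pi ` set bs" for bs
  let ?F = "B ` set blocks"
  let ?L = "(1, 0, 0, 1) # concat blocks"
  have inj: "A = A'" if "A \<in> set ?L" "A' \<in> set ?L" "mat2_pi A = mat2_pi A'" for A A'
    using inj_onD[OF mat2_pi_inj_blocks that(3,1,2)] .
  have memL: "A \<in> set ?L" if "bs \<in> set blocks" "A \<in> set bs" for bs A using that by auto
  have "distinct (concat blocks)" using blocks_distinct by (simp only: distinct.simps)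
  then have dist: "distinct (removeAll [] blocks)" "\<forall>bs. bs \<in> set blocks \<longrightarrow> distinct bs"
    "\<forall>bs cs. bs \<in> set blocks \<and> cs \<in> set blocks \<and> bs \<noteq> cs \<longrightarrow> set bs \<inter> set cs = {}"
    unfolding distinct_concat_iff by blast+
  have disj0: "bs = cs" if "bs \<in> set blocks" "cs \<in> set blocks" "A \<in> set bs" "A \<in> set cs" for bs cs A
    using dist(3) that by blast
  have disj: "bs = cs" if d: "bs \<in> set blocks" "cs \<in> set blocks" "x \<in> B bs" "x \<in> B cs" for bs cs x
  proof -
    obtain A A' where A: "x = mat2_pi A" "A \<in> set bs" "x = mat2_pi A'" "A' \<in> set cs"
      using d(3,4) unfolding B_def by blast
    have "A = A'" by (rule inj[OF memL[OF d(1) A(2)] memL[OF d(2) A(4)]]) (use A(1,3) in simp)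
    then show ?thesis using disj0[OF d(1,2) A(2)] A(4) by simp
  qed
  have ne: "bs \<noteq> []" if bs: "bs \<in> set blocks" for bs
  proof -
    have "length bs \<in> {6, 3, 2}" using blocks_power_list bs by (simp add: list_all_iff)
    then show ?thesis by auto
  qed
  have injB: "inj_on B (set blocks)"
  proof (rule inj_onI)
    fix bs cs assume bc: "bs \<in> set blocks" "cs \<in> set blocks" "B bs = B cs"
    have "mat2_pi (hd bs) \<in> B bs" using ne[OF bc(1)] by (simp add: B_def)
    then show "bs = cs" using disj[OF bc(1,2)] bc(3) by simp
  qed
  have cardB: "card (B bs) = length bs" if bs: "bs \<in> set blocks" for bs
  proof -
    have "inj_on mat2_pi (set bs)"
      by (rule inj_on_subset[OF mat2_pi_inj_blocks]) (use memL[OF bs] in blast)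
    moreover have "distinct bs" using dist(2) bs by blast
    ultimately show ?thesis unfolding B_def by (simp add: card_image distinct_card)
  qed
  have one: "\<one>\<^bsub>PSL2_7\<^esub> \<notin> B bs" if bs: "bs \<in> set blocks" for bs
  proof
    assume "\<one>\<^bsub>PSL2_7\<^esub> \<in> B bs"
    then obtain A where A: "A \<in> set bs" "mat2_pi A = mat2_pi (1, 0, 0, 1)"
      unfolding B_def one_PSL2_7 by blast
    have "A = (1, 0, 0, 1)" by (rule inj[OF memL[OF bs A(1)] _ A(2)]) simp
    then show False using block_mem(3)[OF bs A(1)] by simp
  qed
  have carr: "carrier PSL2_7 = insert \<one>\<^bsub>PSL2_7\<^esub> (\<Union>?F)"
    unfolding carrier_PSL2_7_blocks(1) one_PSL2_7 B_def by (simp add: image_Union image_image)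
  have pw: "x [^]\<^bsub>PSL2_7\<^esub> n \<in> insert \<one>\<^bsub>PSL2_7\<^esub> (B bs)" if bs: "bs \<in> set blocks" "x \<in> B bs" for bs x and n :: nat
  proof -
    obtain g where g: "g \<in> carrier PSL2_7" "g [^]\<^bsub>PSL2_7\<^esub> (length bs + 1) = \<one>\<^bsub>PSL2_7\<^esub>"
      "B bs = {g [^]\<^bsub>PSL2_7\<^esub> i | i. 1 \<le> i \<and> i \<le> length bs}" "length bs \<in> {6, 3, 2}"
      by (rule block_cyclic[OF bs(1), folded B_def])
    let ?m = "length bs + 1"
    obtain i :: nat where "x = g [^]\<^bsub>PSL2_7\<^esub> i" using bs(2) g(3) by blast
    then have x: "x [^]\<^bsub>PSL2_7\<^esub> n = g [^]\<^bsub>PSL2_7\<^esub> (i * n mod ?m)"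
      using PSL.nat_pow_mod_of_pow_one[OF g(1,2), of "i * n"] by (simp only: PSL.nat_pow_pow[OF g(1)])
    have "i * n mod ?m \<le> length bs" using mod_less_divisor[of ?m "i * n"] by linarith
    then show ?thesis unfolding x g(3) by (cases "i * n mod ?m = 0") auto
  qed
  have "kappa_P PSL2_7 = (\<Prod>C\<in>?F. (card C + 1) ^ (card C - 1))"
  proof (rule PSL.kappa_P_blocks[OF finite_PSL2_7])
    show "\<Union>?F = carrier PSL2_7 - {\<one>\<^bsub>PSL2_7\<^esub>}" unfolding carr using one by blast
    show "{} \<notin> ?F" using ne by (auto simp: B_def)
    fix C assume "C \<in> ?F"
    then obtain bs where bs: "bs \<in> set blocks" "C = B bs" by blast
    show "C \<inter> D = {}" if D: "D \<in> ?F" "C \<noteq> D" for D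
    proof -
      obtain cs where cs: "cs \<in> set blocks" "D = B cs" using D(1) by blast
      have "x \<notin> D" if "x \<in> C" for x
        using disj[OF bs(1) cs(1), of x] that D(2) bs(2) cs(2) by auto
      then show ?thesis by blast
    qed
    fix v w assume v: "v \<in> C"
    show "power_adj PSL2_7 v w" if w: "w \<in> C" "v \<noteq> w"
    proof -
      obtain g where g: "g \<in> carrier PSL2_7" "g [^]\<^bsub>PSL2_7\<^esub> (length bs + 1) = \<one>\<^bsub>PSL2_7\<^esub>"
        "C = {g [^]\<^bsub>PSL2_7\<^esub> i | i. 1 \<le> i \<and> i \<le> length bs}" "length bs \<in> {6, 3, 2}"
        by (rule block_cyclic[OF bs(1), folded B_def bs(2)])
      obtain i :: nat where i: "v = g [^]\<^bsub>PSL2_7\<^esub> i" "i \<le> length bs" using v g(3) by blast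
      obtain j :: nat where j: "w = g [^]\<^bsub>PSL2_7\<^esub> j" "j \<le> length bs" using w(1) g(3) by blast
      show ?thesis
        unfolding i(1) j(1)
        by (rule PSL.power_adj_prime_power_cyclic[OF g(1,2)]) (use g(4) i j w(2) in auto)
    qed
    show "w \<in> C" if w: "w \<in> carrier PSL2_7" "w \<noteq> \<one>\<^bsub>PSL2_7\<^esub>" "power_adj PSL2_7 v w"
    proof -
      obtain cs where cs: "cs \<in> set blocks" "w \<in> B cs" using w(1,2) carr by blast
      consider n :: nat where "w = v [^]\<^bsub>PSL2_7\<^esub> n" | n :: nat where "v = w [^]\<^bsub>PSL2_7\<^esub> n"
        using w(3) unfolding power_adj_def by blast
      then show ?thesis
      proof cases
        case (1 n)
        then show ?thesis using pw[OF bs(1), of v n] v bs(2) w(2) by simp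
      next
        case (2 n)
        then have "v \<in> insert \<one>\<^bsub>PSL2_7\<^esub> (B cs)" using pw[OF cs, of n] by simp
        moreover have "v \<noteq> \<one>\<^bsub>PSL2_7\<^esub>" using v one[OF bs(1)] bs(2) by blast
        ultimately have "bs = cs" using disj[OF bs(1) cs(1), of v] v bs(2) by simp
        then show ?thesis using cs(2) bs(2) by simp
      qed
    qed
  qed
  also have "\<dots> = (\<Prod>bs\<in>set blocks. (length bs + 1) ^ (length bs - 1))"
    by (subst prod.reindex[OF injB]) (simp add: cardB)
  also have "\<dots> = prod_list (map (\<lambda>bs. (length bs + 1) ^ (length bs - 1)) blocks)"
  proof (rule prod.distinct_set_conv_list)
    have "removeAll [] blocks = blocks" using ne by (intro removeAll_id) blast
    then show "distinct blocks" using dist(1) by simp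
  qed
  also have "\<dots> = prod_list (map (\<lambda>n. (n + 1) ^ (n - 1)) (map length blocks))"
    by (simp only: map_map o_def)
  also have "\<dots> = (7 ^ 5) ^ 8 * ((4 ^ 2) ^ 21 * (3 ^ 1) ^ 28)"
    unfolding map_length_blocks by (simp only: map_append map_replicate prod_list.append prod_list_replicate) simp
  also have "\<dots> = (7 ^ 40 * 3 ^ 28 * 4 ^ 42 :: nat)"
    unfolding power_mult[symmetric] by (simp only: mult_ac) simp
  finally show ?thesis .
qed

section \<open>Bounds on the order\<close>

lemma (in simple_group) order_dvd_24_of_small_index:
  assumes fin: "finite (carrier G)" and K: "subgroup K G" "K \<noteq> carrier G" and le: "card (rcosets K) \<le> 4"
  shows "order G dvd 24"
proof -
  have "(fact (card (rcosets K)) :: nat) dvd fact 4" using le by (rule fact_dvd)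
  moreover have "(fact 4 :: nat) = 24" by (simp add: fact_numeral)
  ultimately show ?thesis using order_dvd_fact_index[OF fin K] dvd_trans by metis
qed

definition centralizer_of :: "('a, 'b) monoid_scheme \<Rightarrow> 'a set \<Rightarrow> 'a set" where
  "centralizer_of G D = {x \<in> carrier G. \<forall>d\<in>D. x \<otimes>\<^bsub>G\<^esub> d = d \<otimes>\<^bsub>G\<^esub> x}"

lemma (in group) subgroup_centralizer_of:
  assumes fin: "finite (carrier G)" and D: "D \<subseteq> carrier G"
  shows "subgroup (centralizer_of G D) G"
proof (rule finite_mult_closed_subgroup[OF fin])
  show "centralizer_of G D \<subseteq> carrier G" "\<one> \<in> centralizer_of G D"
    using D by (auto simp: centralizer_of_def)
  fix x y assume xy: "x \<in> centralizer_of G D" "y \<in> centralizer_of G D"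
  have "x \<otimes> y \<otimes> d = d \<otimes> (x \<otimes> y)" if d: "d \<in> D" for d
  proof -
    have c: "x \<in> carrier G" "y \<in> carrier G" "d \<in> carrier G"
      using xy d D by (auto simp: centralizer_of_def)
    have "x \<otimes> d = d \<otimes> x" "y \<otimes> d = d \<otimes> y" using xy d by (simp_all add: centralizer_of_def)
    then show ?thesis using c by (metis m_assoc)
  qed
  then show "x \<otimes> y \<in> centralizer_of G D" using xy by (simp add: centralizer_of_def)
qed

lemma (in group) normal_of_central:
  assumes "subgroup D G" "centralizer_of G D = carrier G"
  shows "D \<lhd> G"
proof (rule normal_invI[OF assms(1)])
  fix x h assume xh: "x \<in> carrier G" "h \<in> D"
  then have "x \<otimes> h = h \<otimes> x" using assms(2) by (auto simp: centralizer_of_def)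
  moreover have "h \<in> carrier G" using xh assms(1) by (rule_tac subgroup.mem_carrier)
  ultimately have "x \<otimes> h \<otimes> inv x = h" using xh(1) by (simp add: m_assoc)
  then show "x \<otimes> h \<otimes> inv x \<in> D" using xh(2) by simp
qed

text \<open>Two elements \<open>s, t\<close> with \<open>s\<^sup>2 = (s g)\<^sup>2 = t\<^sup>2 = (t g)\<^sup>2 = 1\<close> both invert \<open>g\<close>, so they differ by an element of
  the centralizer of \<open>g\<close>.\<close>

lemma (in group) card_square_one_le:
  assumes fin: "finite (carrier G)"
    and cent: "\<And>g. g \<in> carrier G \<Longrightarrow> g \<noteq> \<one> \<Longrightarrow> 5 * card (centralizer_of G {g}) \<le> order G"
  defines "S \<equiv> {s \<in> carrier G. s \<otimes> s = \<one>}"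
  shows "5 * (card S * card S) \<le> 5 * card S + (order G - 1) * order G"
proof -
  let ?T = "\<lambda>g. {s \<in> S. s \<otimes> g \<in> S}"
  have SG: "S \<subseteq> carrier G" and finS: "finite S" using fin by (auto simp: S_def)
  have T: "card (?T g) \<le> card (centralizer_of G {g})" if g: "g \<in> carrier G" for g
  proof (cases "?T g = {}")
    case False
    then obtain t where t: "t \<in> ?T g" by blast
    have inverts: "s \<otimes> g \<otimes> s = inv g" if s: "s \<in> ?T g" for s
    proof -
      have "s \<in> carrier G" "s \<otimes> g \<otimes> (s \<otimes> g) = \<one>" using s SG by (auto simp: S_def)
      then have "(s \<otimes> g \<otimes> s) \<otimes> g = \<one>" using g by (simp add: m_assoc)
      then show ?thesis using g \<open>s \<in> carrier G\<close> by (intro inv_equality[symmetric]) simp_all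
    qed
    have tG: "t \<in> carrier G" "t \<otimes> t = \<one>" using t by (auto simp: S_def)
    have sub: "(\<lambda>s. t \<otimes> s) ` ?T g \<subseteq> centralizer_of G {g}"
    proof
      fix x assume "x \<in> (\<lambda>s. t \<otimes> s) ` ?T g"
      then obtain s where s: "s \<in> ?T g" "x = t \<otimes> s" by blast
      have sG: "s \<in> carrier G" "s \<otimes> s = \<one>" using s(1) by (auto simp: S_def)
      have "t \<otimes> s \<otimes> g = t \<otimes> (s \<otimes> g \<otimes> s) \<otimes> s"
        using sG tG g by (simp add: m_assoc)
      also have "\<dots> = t \<otimes> (t \<otimes> g \<otimes> t) \<otimes> s" using inverts[OF s(1)] inverts[OF t] by simp
      also have "\<dots> = (t \<otimes> t) \<otimes> g \<otimes> t \<otimes> s" using sG(1) tG(1) g by (simp add: m_assoc)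
      also have "\<dots> = g \<otimes> (t \<otimes> s)" using sG tG g by (simp add: m_assoc)
      finally show "x \<in> centralizer_of G {g}"
        using s(2) sG(1) tG(1) by (simp add: centralizer_of_def)
    qed
    have inj: "inj_on (\<lambda>s. t \<otimes> s) (?T g)"
    proof (rule inj_onI)
      fix x y assume "x \<in> ?T g" "y \<in> ?T g" "t \<otimes> x = t \<otimes> y"
      moreover then have "x \<in> carrier G" "y \<in> carrier G" using SG by blast+
      ultimately show "x = y" using tG(1) by simp
    qed
    have "finite (centralizer_of G {g})" using fin by (simp add: centralizer_of_def)
    then show ?thesis by (rule card_inj_on_le[OF inj sub])
  next
    case True
    then show ?thesis by (simp only: card.empty)
  qed
  \<comment> \<open>The pairs (s, t) in S x S are sorted by g = s^-1 t. The identity accounts for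
    \<open>card S\<close> of them, every other g for at most the order of its centralizer, which is
    at most a fifth of the group order.\<close>
  have "card S * card S = card (SIGMA g:carrier G. ?T g)"
  proof -
    have "bij_betw (\<lambda>(s, t). (inv s \<otimes> t, s)) (S \<times> S) (SIGMA g:carrier G. ?T g)"
    proof (rule bij_betwI[of _ _ _ "\<lambda>(g, s). (s, s \<otimes> g)"])
      show "(\<lambda>(s, t). (inv s \<otimes> t, s)) \<in> S \<times> S \<rightarrow> (SIGMA g:carrier G. ?T g)"
      proof
        fix p assume "p \<in> S \<times> S"
        then obtain s t where st: "p = (s, t)" "s \<in> S" "t \<in> S" by blast
        then have "s \<in> carrier G" "t \<in> carrier G" using SG by blast+
        then show "(case p of (s, t) \<Rightarrow> (inv s \<otimes> t, s)) \<in> (SIGMA g:carrier G. ?T g)"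
          using st by (simp flip: m_assoc)
      qed
      show "(\<lambda>(g, s). (s, s \<otimes> g)) \<in> (SIGMA g:carrier G. ?T g) \<rightarrow> S \<times> S" by auto
    next
      fix p assume p: "p \<in> S \<times> S"
      then have "fst p \<in> carrier G" "snd p \<in> carrier G" using SG by auto
      then show "(case case p of (s, t) \<Rightarrow> (inv s \<otimes> t, s) of (g, s) \<Rightarrow> (s, s \<otimes> g)) = p"
        by (cases p) (simp flip: m_assoc)
    next
      fix p assume p: "p \<in> (SIGMA g:carrier G. ?T g)"
      then have "fst p \<in> carrier G" "snd p \<in> carrier G" using SG by auto
      then show "(case case p of (g, s) \<Rightarrow> (s, s \<otimes> g) of (s, t) \<Rightarrow> (inv s \<otimes> t, s)) = p"
        by (cases p) (simp flip: m_assoc)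
    qed
    from bij_betw_same_card[OF this] show ?thesis by (simp add: card_cartesian_product)
  qed
  also have "\<dots> = (\<Sum>g\<in>carrier G. card (?T g))" using fin finS by (simp add: card_SigmaI)
  also have "\<dots> = card (?T \<one>) + (\<Sum>g\<in>carrier G - {\<one>}. card (?T g))"
    using fin by (simp add: sum.remove[of _ \<one>])
  also have "?T \<one> = S" using SG by auto
  finally have "5 * (card S * card S) = 5 * card S + (\<Sum>g\<in>carrier G - {\<one>}. 5 * card (?T g))"
    by (simp add: sum_distrib_left)
  also have "(\<Sum>g\<in>carrier G - {\<one>}. 5 * card (?T g)) \<le> (\<Sum>g\<in>carrier G - {\<one>}. order G)"
  proof (rule sum_mono)
    fix g assume g: "g \<in> carrier G - {\<one>}"
    then have "5 * card (?T g) \<le> 5 * card (centralizer_of G {g})" using T by simp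
    also have "\<dots> \<le> order G" using cent g by blast
    finally show "5 * card (?T g) \<le> order G" .
  qed
  also have "\<dots> = (order G - 1) * order G" using fin by (simp add: order_def)
  finally show ?thesis by simp
qed

lemma prod_subset_le_nat:
  fixes f :: "'b \<Rightarrow> nat"
  assumes "finite B" "A \<subseteq> B" "\<And>b. b \<in> B \<Longrightarrow> 0 < f b"
  shows "prod f A \<le> prod f B"
  using assms prod_dvd_prod_subset[OF assms(1,2), of f] by (intro dvd_imp_le prod_pos) auto

text \<open>An element with nontrivial square forms a triangle with its inverse and the identity,
  contributing \<open>(2 + 1) ^ (2 - 1) = 3\<close>. An involution is a block of one element and
  contributes 1.\<close>

lemma (in group) kappa_P_ge_inverse_pairs:
  assumes fin: "finite (carrier G)"
  obtains m where "order G = card {s \<in> carrier G. s \<otimes> s = \<one>} + 2 * m" "3 ^ m \<le> kappa_P G"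
proof -
  let ?S = "{s \<in> carrier G. s \<otimes> s = \<one>}"
  let ?B = "\<lambda>x. {x, inv x}"
  let ?F = "?B ` (carrier G - {\<one>})" and ?F2 = "?B ` (carrier G - ?S)"
  have eq: "?B x = ?B y" if "x \<in> carrier G" "y \<in> carrier G" "?B x \<inter> ?B y \<noteq> {}" for x y
  proof -
    have "y = x \<or> y = inv x \<or> inv y = x \<or> inv y = inv x" using that(3) by auto
    then have "y = x \<or> y = inv x" using that(1,2) inv_inv by metis
    then show ?thesis using that(1) by (elim disjE) (simp_all add: insert_commute)
  qed
  have inv_ne: "inv x \<noteq> x" if "x \<in> carrier G - ?S" for x
  proof
    assume "inv x = x"
    moreover have "x \<otimes> inv x = \<one>" using that by (intro r_inv) blast
    ultimately show False using that by simp
  qed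
  have disj: "B \<inter> C = {}" if "B \<in> ?F" "C \<in> ?F" "B \<noteq> C" for B C
  proof -
    obtain x where x: "x \<in> carrier G" "B = ?B x" using \<open>B \<in> ?F\<close> by blast
    obtain y where y: "y \<in> carrier G" "C = ?B y" using \<open>C \<in> ?F\<close> by blast
    show ?thesis
    proof (rule ccontr)
      assume "B \<inter> C \<noteq> {}"
      then have "B = C" unfolding x(2) y(2) by (rule eq[OF x(1) y(1)])
      then show False using \<open>B \<noteq> C\<close> by simp
    qed
  qed
  have F2F: "?F2 \<subseteq> ?F" by (rule image_mono) auto
  have finF: "finite ?F" "finite ?F2" using fin by simp_all
  have card2: "card B = 2" if "B \<in> ?F2" for B
  proof -
    from that obtain x where "x \<in> carrier G - ?S" "B = ?B x" by blast
    then show ?thesis using inv_ne[of x] by simp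
  qed
  have "\<Union>?F2 = carrier G - ?S"
  proof
    show "\<Union>?F2 \<subseteq> carrier G - ?S"
    proof
      fix y assume "y \<in> \<Union>?F2"
      then obtain x where x: "x \<in> carrier G" "x \<notin> ?S" "y \<in> ?B x" by blast
      have "inv x \<otimes> inv x \<noteq> \<one>"
      proof
        assume "inv x \<otimes> inv x = \<one>"
        then have "inv (inv x) = inv x" using x(1) by (intro inv_equality) simp_all
        then show False using x(1) inv_ne[of x] x(2) by simp
      qed
      moreover have "y = x \<or> y = inv x" using x(3) by simp
      ultimately show "y \<in> carrier G - ?S" using x(1,2) by (elim disjE) simp_all
    qed
  qed auto
  moreover have "card (\<Union>?F2) = (\<Sum>B\<in>?F2. card B)"
  proof (rule card_Union_disjoint)
    show "pairwise disjnt ?F2"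
    proof (rule pairwiseI)
      fix B C assume "B \<in> ?F2" "C \<in> ?F2" "B \<noteq> C"
      then show "disjnt B C" unfolding disjnt_def using F2F by (intro disj) (erule subsetD, assumption)+
    qed
  qed auto
  moreover have "(\<Sum>B\<in>?F2. card B) = 2 * card ?F2" using card2 by simp
  moreover have "card (carrier G - ?S) = order G - card ?S"
    using fin by (subst card_Diff_subset) (auto simp: order_def)
  moreover have "card ?S \<le> order G" unfolding order_def using fin by (intro card_mono) auto
  ultimately have n: "order G = card ?S + 2 * card ?F2" by simp
  have "3 ^ card ?F2 = (\<Prod>B\<in>?F2. (card B + 1) ^ (card B - 1))"
  proof -
    have "(\<Prod>B\<in>?F2. (card B + 1) ^ (card B - 1)) = (\<Prod>B\<in>?F2. 3)"
      by (rule prod.cong) (simp_all only: card2, simp)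
    then show ?thesis by simp
  qed
  also have "\<dots> \<le> (\<Prod>B\<in>?F. (card B + 1) ^ (card B - 1))"
    by (rule prod_subset_le_nat[OF finF(1) F2F]) simp
  also have "\<dots> \<le> kappa_P G"
  proof (rule kappa_P_ge_blocks[OF fin _ _ disj])
    have "inv x \<noteq> \<one>" if "x \<in> carrier G" "x \<noteq> \<one>" for x
      using that by (metis inv_inv inv_one)
    then have "?B x \<subseteq> carrier G - {\<one>}" if "x \<in> carrier G - {\<one>}" for x using that by simp
    then show "\<Union>?F = carrier G - {\<one>}" by blast
    show "power_adj G v w" if vw: "B \<in> ?F" "v \<in> B" "w \<in> B" "v \<noteq> w" for B v w
    proof -
      obtain x where x: "x \<in> carrier G" "B = ?B x" using vw(1) by blast
      have "x [^] (ord x - 1) \<otimes> x = x [^] Suc (ord x - 1)" by simp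
      also have "\<dots> = x [^] ord x" using ord_ge_1[OF fin x(1)] by (simp del: nat_pow_Suc)
      also have "\<dots> = \<one>" using x(1) by simp
      finally have "inv x = x [^] (ord x - 1)" using x(1) by (intro inv_equality) simp_all
      then have "\<exists>n::nat. inv x = x [^] n" by blast
      moreover have "v = x \<and> w = inv x \<or> v = inv x \<and> w = x" using vw(2,3,4) x(2) by auto
      ultimately show ?thesis using vw(4) unfolding power_adj_def by blast
    qed
  qed auto
  finally show thesis using n that by blast
qed

section \<open>First consequences of simplicity and of the value of the count\<close>

locale simple_group_kappa = simple_group +
  assumes fin: "finite (carrier G)" and kappa: "kappa_P G = kappa_P PSL2_7"
begin

lemma kappa_eq: "kappa_P G = 7 ^ 40 * 3 ^ 28 * 4 ^ 42"
  using kappa kappa_P_PSL2_7 by simp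

text \<open>A group of order n has at most n^(n - 1) parent maps, and \<open>24 ^ 23\<close> is far
  below the count. The threshold 24 is the order of the symmetric group on four points.\<close>

lemma order_gt_24: "order G > 24"
proof (rule ccontr)
  assume "\<not> order G > 24"
  then have le: "order G \<le> 24" by simp
  have "kappa_P G \<le> order G ^ (order G - 1)" by (rule kappa_P_le[OF fin])
  also have "\<dots> \<le> 24 ^ (order G - 1)" using le by (rule power_mono) simp
  also have "\<dots> \<le> 24 ^ 23" using le by (intro power_increasing) auto
  finally show False unfolding kappa_eq by simp
qed

lemma prime_dvd_order:
  assumes p: "prime p" "p dvd order G"
  shows "p = 2 \<or> p = 3 \<or> p = 7"
proof (cases "p > 2")
  case True
  then have "p dvd 7 ^ 40 * 3 ^ 28 * 4 ^ 42"
    using odd_prime_dvd_kappa_P[OF fin p(1) True p(2)] kappa_eq by simp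
  then have "p dvd 7 \<or> p dvd 3 \<or> p dvd 4"
    using p(1) by (metis prime_dvd_mult_iff prime_dvd_power)
  moreover have "p dvd 4 \<Longrightarrow> p dvd 2"
    using prime_dvd_power[OF p(1), of 2 2] by simp
  moreover have "prime (7::nat)" "prime (3::nat)" by simp_all
  ultimately show ?thesis using p(1) True by (metis dvd_imp_le not_less primes_dvd_imp_eq zero_less_numeral)
next
  case False
  then show ?thesis using prime_ge_2_nat[OF p(1)] by simp
qed

lemma order_form: obtains a b c where "order G = 2 ^ a * 3 ^ b * 7 ^ c"
proof -
  have n0: "order G \<noteq> 0" using order_gt_24 by simp
  obtain x where x: "order G = 2 ^ multiplicity 2 (order G) * x" "\<not> 2 dvd x"
    using multiplicity_decompose'[of "order G" 2] n0 by auto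
  have "x \<noteq> 0" using x(2) by (intro notI) simp
  then obtain y where y: "x = 3 ^ multiplicity 3 x * y" "\<not> 3 dvd y"
    using multiplicity_decompose'[of x 3] by auto
  have "y \<noteq> 0" using y(2) by (intro notI) simp
  then obtain z where z: "y = 7 ^ multiplicity 7 y * z" "\<not> 7 dvd z"
    using multiplicity_decompose'[of y 7] by auto
  have "z = 1"
  proof (rule ccontr)
    assume "z \<noteq> 1"
    then obtain p where p: "prime p" "p dvd z" using prime_factor_nat by blast
    have zy: "z dvd y" using z(1) by (metis dvd_triv_right)
    have yx: "y dvd x" using y(1) by (metis dvd_triv_right)
    have xn: "x dvd order G" using x(1) by (metis dvd_triv_right)
    have "p dvd y" "p dvd x" "p dvd order G" using p(2) zy yx xn dvd_trans by blast+
    then show False using prime_dvd_order[OF p(1)] p(2) x(2) y(2) z(2) by blast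
  qed
  then have "order G = 2 ^ multiplicity 2 (order G) * 3 ^ multiplicity 3 x * 7 ^ multiplicity 7 y"
    using x(1) y(1) z(1) by (metis mult.assoc mult.right_neutral)
  then show thesis by (rule that)
qed

text \<open>A proper subgroup of such an index would embed G into the symmetric group on four
  points. The later contradictions are mostly reached by producing a subgroup of index at most
  4.\<close>

lemma small_index:
  assumes K: "subgroup K G" and le: "card (rcosets K) \<le> 4"
  shows "K = carrier G"
proof (rule ccontr)
  assume "K \<noteq> carrier G"
  then have "order G dvd 24" by (rule order_dvd_24_of_small_index[OF fin K _ le])
  then show False using order_gt_24 by (auto dest: dvd_imp_le)
qed

text \<open>This includes the cyclic groups of prime order, which are simple. A subgroup of index
  \<open>p\<close> forces \<open>p ^ k\<close> to divide \<open>fact p\<close>. For 2 and 3 that is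
  at most 6; for 7, already 49 does not divide \<open>fact 7\<close>, and order 7 is too
  small.\<close>

lemma order_not_primepow:
  assumes p: "prime p"
  shows "order G \<noteq> p ^ k"
proof
  assume n: "order G = p ^ k"
  then obtain j where k: "k = Suc j" using order_gt_24 by (cases k) auto
  have p3: "p = 2 \<or> p = 3 \<or> p = 7" using prime_dvd_order[OF p] n k by simp
  obtain H where H: "subgroup H G" "card H = p ^ j"
    using sylow_thm[OF p group_axioms _ fin, of j p] n k by (auto simp: mult.commute)
  have "card (rcosets H) * p ^ j = p * p ^ j" using lagrange[OF H(1)] H(2) n k by simp
  then have idx: "card (rcosets H) = p" using prime_gt_0_nat[OF p] by simp
  have "H \<noteq> carrier G"
    using H(2) n k p prime_gt_1_nat[OF p] by (auto simp: order_def)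
  then have "p ^ k dvd fact p" using order_dvd_fact_index[OF fin H(1)] idx n by simp
  then show False
  proof -
    assume d: "p ^ k dvd fact p"
    consider "p = 2 \<or> p = 3" | "p = 7" "k \<ge> 2" | "p = 7" "k \<le> 1" using p3 by linarith
    then show False
    proof cases
      case 1
      then have "(fact p :: nat) \<le> 6" by (auto simp: fact_numeral)
      then show ?thesis using d order_gt_24 n by (auto dest!: dvd_imp_le)
    next
      case 2
      then have "(7::nat) ^ 2 dvd 7 ^ k" by (intro le_imp_power_dvd)
      then have "(7::nat) ^ 2 dvd fact 7" using d 2(1) dvd_trans by blast
      then show ?thesis by (simp add: fact_numeral)
    next
      case 3
      then have "p ^ k \<le> 7 ^ 1" unfolding 3(1) by (intro power_increasing) auto
      then show ?thesis using order_gt_24 n by simp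
    qed
  qed
qed

lemma normal_primepow_trivial:
  assumes H: "H \<lhd> G" and p: "prime p" "card H = p ^ k" "p dvd card H"
  shows False
proof -
  have "H = carrier G \<or> H = {\<one>}" by (rule no_real_normal_subgroup[OF H])
  moreover have "H \<noteq> {\<one>}" using p by auto
  ultimately show False using order_not_primepow[OF p(1), of k] p(2) by (simp add: order_def)
qed

text \<open>The centre is normal. Were it the whole group, a subgroup of prime order would be
  normal, hence everything, against \<open>order_not_primepow\<close>.\<close>

lemma center_trivial:
  assumes g: "g \<in> carrier G" "centralizer_of G {g} = carrier G"
  shows "g = \<one>"
proof (rule ccontr)
  assume "g \<noteq> \<one>"
  let ?Z = "centralizer_of G (carrier G)"
  have "?Z \<lhd> G"
  proof (rule normal_invI[OF subgroup_centralizer_of[OF fin]])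
    fix x h assume "x \<in> carrier G" "h \<in> ?Z"
    then have h: "h \<in> carrier G" "h \<otimes> x = x \<otimes> h" by (auto simp: centralizer_of_def)
    then have "x \<otimes> h \<otimes> inv x = h" using \<open>x \<in> carrier G\<close> by (metis m_assoc inv_closed r_inv r_one)
    then show "x \<otimes> h \<otimes> inv x \<in> ?Z" using \<open>h \<in> ?Z\<close> by simp
  qed simp
  moreover have "g \<in> ?Z"
  proof -
    have "g \<otimes> x = x \<otimes> g" if "x \<in> carrier G" for x
    proof -
      have "x \<in> centralizer_of G {g}" using that g(2) by simp
      then show ?thesis by (simp add: centralizer_of_def)
    qed
    then show ?thesis using g(1) by (simp add: centralizer_of_def)
  qed
  ultimately have Z: "?Z = carrier G" using no_real_normal_subgroup \<open>g \<noteq> \<one>\<close> by blast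
  obtain p where p: "prime p" "p dvd order G"
    using prime_factor_nat[of "order G"] order_gt_24 by auto
  obtain H where H: "subgroup H G" "card H = p ^ 1"
  proof -
    from p(2) obtain m where "order G = p * m" by (rule dvdE)
    then have "\<exists>H. subgroup H G \<and> card H = p ^ 1"
      by (intro sylow_thm[OF p(1) group_axioms _ fin, of 1 m]) simp
    then show ?thesis using that by blast
  qed
  have "centralizer_of G H = carrier G"
    using Z subgroup.subset[OF H(1)] unfolding centralizer_of_def by blast
  then have "H \<lhd> G" by (rule normal_of_central[OF H(1)])
  then show False by (rule normal_primepow_trivial[OF _ p(1) H(2)]) (simp add: H(2))
qed

lemma order_lt_576: "order G < 576"
proof (rule ccontr)
  assume "\<not> order G < 576"
  \<comment> \<open>Writing the order as 576 + k turns the final contradiction into a comparison of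
    polynomials in k, where each coefficient of 5 (274 + k) (273 + k) exceeds that of (575 + k) (576
    + k).\<close>
  then obtain k where n: "order G = 576 + k" by (auto simp: not_less le_iff_add)
  let ?S = "{s \<in> carrier G. s \<otimes> s = \<one>}"
  have "5 * card (centralizer_of G {g}) \<le> order G" if g: "g \<in> carrier G" "g \<noteq> \<one>" for g
  proof -
    have C: "subgroup (centralizer_of G {g}) G" using g by (intro subgroup_centralizer_of[OF fin]) simp
    have "\<not> card (rcosets (centralizer_of G {g})) \<le> 4"
      using small_index[OF C] center_trivial g by blast
    then have "5 * card (centralizer_of G {g}) \<le> card (rcosets (centralizer_of G {g})) * card (centralizer_of G {g})"
      by (intro mult_right_mono) simp_all
    then show ?thesis using lagrange[OF C] by simp
  qed
  then have S: "5 * (card ?S * card ?S) \<le> 5 * card ?S + (order G - 1) * order G"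
    by (rule card_square_one_le[OF fin])
  obtain m where m: "order G = card ?S + 2 * m" "3 ^ m \<le> kappa_P G"
    by (rule kappa_P_ge_inverse_pairs[OF fin])
  \<comment> \<open>152 is the least exponent for which the power of 3 exceeds the count.\<close>
  have "m < 152"
  proof (rule ccontr)
    assume "\<not> m < 152"
    then have "(3::nat) ^ 152 \<le> 3 ^ m" by (intro power_increasing) auto
    also have "\<dots> \<le> 7 ^ 40 * 3 ^ 28 * 4 ^ 42" using m(2) unfolding kappa_eq .
    finally show False by simp
  qed
  \<comment> \<open>274 = 576 - 2 * 151.\<close>
  then have s: "274 + k \<le> card ?S" using m(1) n by linarith
  have "card ?S * card ?S = card ?S + card ?S * (card ?S - 1)"
    using s by (simp add: algebra_simps diff_mult_distrib2)
  then have "5 * (card ?S * (card ?S - 1)) \<le> (575 + k) * (576 + k)"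
    using S n by simp
  moreover have "(274 + k) * (273 + k) \<le> card ?S * (card ?S - 1)"
    using s by (intro mult_mono) auto
  ultimately have "5 * ((274 + k) * (273 + k)) \<le> (575 + k) * (576 + k)" by linarith
  then show False by (simp add: algebra_simps)
qed

end

section \<open>Sylow 7-subgroups\<close>

lemma card_image_eq_if_same_fibers:
  assumes "\<And>a b. a \<in> A \<Longrightarrow> b \<in> A \<Longrightarrow> f a = f b \<longleftrightarrow> g a = g b"
  shows "card (f ` A) = card (g ` A)"
proof -
  let ?h = "\<lambda>a. (f a, g a)"
  have "inj_on fst (?h ` A)" "inj_on snd (?h ` A)"
    using assms by (auto intro!: inj_onI)
  then have "card (fst ` ?h ` A) = card (snd ` ?h ` A)" by (simp only: card_image)
  then show ?thesis by (simp only: image_image fst_conv snd_conv)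
qed

text \<open>Conjugating by the inverse of \<open>a\<close> makes the result depend only on the right
  coset of the normalizer that contains \<open>a\<close>, so the conjugates correspond to
  \<open>rcosets (conj_stab G P)\<close>.\<close>

definition conjugates :: "('a, 'b) monoid_scheme \<Rightarrow> 'a set \<Rightarrow> 'a set set" where
  "conjugates G P = (\<lambda>a. (\<lambda>x. inv\<^bsub>G\<^esub> a \<otimes>\<^bsub>G\<^esub> x \<otimes>\<^bsub>G\<^esub> inv\<^bsub>G\<^esub> (inv\<^bsub>G\<^esub> a)) ` P) ` carrier G"

lemma (in group) conjugates_subgroup:
  assumes "subgroup P G" "Q \<in> conjugates G P"
  shows "subgroup Q G" "card Q = card P"
proof -
  obtain a where "a \<in> carrier G" "Q = (\<lambda>x. inv a \<otimes> x \<otimes> inv (inv a)) ` P"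
    using assms(2) unfolding conjugates_def by blast
  then show "subgroup Q G" "card Q = card P"
    using subgroup_conj_image[OF assms(1), of "inv a"] by simp_all
qed

lemma (in group) card_conjugates:
  assumes fin: "finite (carrier G)" and P: "subgroup P G"
  shows "card (conjugates G P) = card (rcosets (conj_stab G P))"
proof -
  let ?N = "conj_stab G P" and ?f = "\<lambda>a. (\<lambda>x. inv a \<otimes> x \<otimes> inv (inv a)) ` P"
  have PG: "P \<subseteq> carrier G" by (rule subgroup.subset[OF P])
  have N: "subgroup ?N G" by (rule subgroup_conj_stab[OF fin PG])
  have key: "a \<otimes> inv b \<in> ?N" if ab: "a \<in> carrier G" "b \<in> carrier G" "?f b \<subseteq> ?f a" for a b
  proof -
    have "a \<otimes> inv b \<otimes> x \<otimes> inv (a \<otimes> inv b) \<in> P" if x: "x \<in> P" for x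
    proof -
      obtain y where y: "y \<in> P" "inv b \<otimes> x \<otimes> inv (inv b) = inv a \<otimes> y \<otimes> inv (inv a)"
        using ab(3) x by blast
      have G: "x \<in> carrier G" "y \<in> carrier G" using x y(1) PG by blast+
      have "a \<otimes> inv b \<otimes> x \<otimes> inv (a \<otimes> inv b) = a \<otimes> (inv b \<otimes> x \<otimes> inv (inv b)) \<otimes> inv a"
        using ab(1,2) G(1) conj_mult[of a "inv b" x] by simp
      also have "\<dots> = a \<otimes> (inv a \<otimes> y \<otimes> inv (inv a)) \<otimes> inv a" by (simp only: y(2))
      also have "\<dots> = y" using ab(1) G(2) conj_mult[of a "inv a" y] by simp
      finally show ?thesis using y(1) by simp
    qed
    then show ?thesis using ab(1,2) by (simp add: conj_stab_def)
  qed
  have key2: "?f b \<subseteq> ?f a" if ab: "a \<in> carrier G" "b \<in> carrier G" "a \<otimes> inv b \<in> ?N" for a b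
  proof
    fix z assume "z \<in> ?f b"
    then obtain x where x: "x \<in> P" "z = inv b \<otimes> x \<otimes> inv (inv b)" by blast
    let ?y = "a \<otimes> inv b \<otimes> x \<otimes> inv (a \<otimes> inv b)"
    have xG: "x \<in> carrier G" using x(1) PG by blast
    have y: "?y \<in> P" using ab(3) x(1) by (simp add: conj_stab_def)
    have "inv a \<otimes> ?y \<otimes> inv (inv a) = (inv a \<otimes> (a \<otimes> inv b)) \<otimes> x \<otimes> inv (inv a \<otimes> (a \<otimes> inv b))"
      using ab(1,2) xG by (intro conj_mult[symmetric]) simp_all
    also have "inv a \<otimes> (a \<otimes> inv b) = inv b" using ab(1,2) by (simp flip: m_assoc)
    finally have "z = inv a \<otimes> ?y \<otimes> inv (inv a)" using x(2) by simp
    then show "z \<in> ?f a" using y by blast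
  qed
  have "?f a = ?f b \<longleftrightarrow> ?N #> a = ?N #> b" if ab: "a \<in> carrier G" "b \<in> carrier G" for a b
  proof
    assume "?f a = ?f b"
    then show "?N #> a = ?N #> b" using key[OF ab] rcos_eq_iff[OF N ab] by simp
  next
    assume eq: "?N #> a = ?N #> b"
    have "?f b \<subseteq> ?f a" using key2[OF ab] eq rcos_eq_iff[OF N ab] by simp
    moreover have "?f a \<subseteq> ?f b" using key2[OF ab(2,1)] eq rcos_eq_iff[OF N ab(2,1)] by simp
    ultimately show "?f a = ?f b" by blast
  qed
  then have "card (?f ` carrier G) = card ((\<lambda>a. ?N #> a) ` carrier G)"
    by (rule card_image_eq_if_same_fibers)
  moreover have "(\<lambda>a. ?N #> a) ` carrier G = rcosets ?N" by (auto simp: RCOSETS_def)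
  ultimately show ?thesis by (simp add: conjugates_def)
qed

lemma (in group) card_Int_subgroup_dvd:
  assumes fin: "finite (carrier G)" and Q: "subgroup Q G" and R: "subgroup R G"
  shows "card (Q \<inter> R) dvd card Q"
proof -
  have "subgroup (Q \<inter> R) G" by (rule subgroups_Inter_pair[OF Q R])
  from card_rcosets_mult_dvd(1)[OF this Q Int_lower1 fin] show ?thesis
    by (rule ssubst) (rule dvd_triv_right)
qed

lemma (in group) generate_eq_prime_subgroup:
  assumes fin: "finite (carrier G)" and Q: "subgroup Q G" "card Q = p" "prime p" and x: "x \<in> Q" "x \<noteq> \<one>"
  shows "Q = {x [^] k | k. k \<in> (UNIV :: nat set)}"
proof -
  have xG: "x \<in> carrier G" using x(1) Q(1) by (rule subgroup.mem_carrier[rotated])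
  have gen: "generate G {x} = {x [^] k | k. k \<in> (UNIV :: nat set)}"
    by (rule generate_pow_on_finite_carrier[OF fin xG])
  have sub: "generate G {x} \<subseteq> Q" using x(1) Q(1) by (intro generate_subgroup_incl) simp_all
  have "card (generate G {x}) dvd card Q"
    using card_Int_subgroup_dvd[OF fin Q(1) generate_is_subgroup[of "{x}"]] xG sub
    by (simp add: Int_absorb1)
  moreover have "card (generate G {x}) \<noteq> 1"
    using generate_pow_card[OF xG] ord_eq_1[OF xG] x(2) by simp
  ultimately have "card (generate G {x}) = card Q" using Q(2,3) by (metis prime_nat_iff)
  moreover have "finite Q" using finite_subset[OF subgroup.subset[OF Q(1)] fin] .
  ultimately have "generate G {x} = Q" using sub by (metis card_subset_eq)
  then show ?thesis using gen by simp
qed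

text \<open>Distinct conjugates of a subgroup of prime order meet trivially, and each is a clique on
  \<open>p\<close> vertices including the identity. All remaining elements are made blocks of size
  one, which contribute a factor 1.\<close>

lemma (in group) kappa_P_ge_conjugates:
  assumes fin: "finite (carrier G)" and P: "subgroup P G" "card P = p" "prime p"
  shows "(p ^ (p - 2)) ^ card (rcosets (conj_stab G P)) \<le> kappa_P G"
proof -
  let ?C = "conjugates G P"
  let ?F1 = "(\<lambda>Q. Q - {\<one>}) ` ?C"
  let ?F2 = "(\<lambda>x. {x}) ` (carrier G - {\<one>} - \<Union>?F1)"
  have Q: "subgroup Q G \<and> card Q = p" if "Q \<in> ?C" for Q
    using conjugates_subgroup[OF P(1) that] P(2) by simp
  have p2: "p \<ge> 2" using P(3) by (rule prime_ge_2_nat)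
  have finC: "finite ?C" using fin by (simp add: conjugates_def)
  have finQ: "finite Q" if "Q \<in> ?C" for Q
    using Q[OF that] subgroup.subset finite_subset[OF _ fin] by blast
  have triv: "Q \<inter> R = {\<one>}" if QR: "Q \<in> ?C" "R \<in> ?C" "Q \<noteq> R" for Q R
  proof -
    have "card (Q \<inter> R) dvd p" using card_Int_subgroup_dvd[OF fin, of Q R] Q[OF QR(1)] Q[OF QR(2)] by simp
    moreover have "card (Q \<inter> R) \<noteq> p"
    proof
      assume "card (Q \<inter> R) = p"
      then have "card (Q \<inter> R) = card Q" "card (Q \<inter> R) = card R" using Q[OF QR(1)] Q[OF QR(2)] by simp_all
      then have "Q \<inter> R = Q" "Q \<inter> R = R"
        using card_subset_eq[OF finQ[OF QR(1)] Int_lower1] card_subset_eq[OF finQ[OF QR(2)] Int_lower2] by blast+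
      then show False using QR(3) by simp
    qed
    ultimately have "card (Q \<inter> R) = 1" using P(3) prime_nat_iff by blast
    then obtain z where "Q \<inter> R = {z}" by (rule card_1_singletonE)
    moreover have "\<one> \<in> Q \<inter> R" using Q[OF QR(1)] Q[OF QR(2)] subgroup.one_closed by blast
    ultimately show ?thesis by simp
  qed
  have disj1: "B \<inter> B' = {}" if BB: "B \<in> ?F1" "B' \<in> ?F1" "B \<noteq> B'" for B B'
  proof -
    obtain Q1 where Q1: "Q1 \<in> ?C" "B = Q1 - {\<one>}" using BB(1) by blast
    obtain Q2 where Q2: "Q2 \<in> ?C" "B' = Q2 - {\<one>}" using BB(2) by blast
    have "Q1 \<noteq> Q2" using BB(3) Q1(2) Q2(2) by blast
    then show ?thesis using triv[OF Q1(1) Q2(1)] Q1(2) Q2(2) by blast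
  qed
  have cardF1: "card B = p - 1" if B: "B \<in> ?F1" for B
  proof -
    obtain Q1 where Q1: "Q1 \<in> ?C" "B = Q1 - {\<one>}" using B by blast
    have "\<one> \<in> Q1" using Q[OF Q1(1)] subgroup.one_closed by blast
    then show ?thesis using Q[OF Q1(1)] Q1(2) by simp
  qed
  have inj: "inj_on (\<lambda>Q. Q - {\<one>}) ?C"
  proof (rule inj_onI)
    fix Q1 Q2 assume "Q1 \<in> ?C" "Q2 \<in> ?C" "Q1 - {\<one>} = Q2 - {\<one>}"
    moreover then have "\<one> \<in> Q1" "\<one> \<in> Q2" using Q subgroup.one_closed by blast+
    ultimately show "Q1 = Q2" by blast
  qed
  have sub1: "\<Union>?F1 \<subseteq> carrier G - {\<one>}"
  proof
    fix x assume "x \<in> \<Union>?F1"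
    then obtain Q1 where "Q1 \<in> ?C" "x \<in> Q1" "x \<noteq> \<one>" by blast
    then show "x \<in> carrier G - {\<one>}" using Q subgroup.subset by blast
  qed
  have "(p ^ (p - 2)) ^ card (rcosets (conj_stab G P)) = (\<Prod>B\<in>?F1. (card B + 1) ^ (card B - 1))"
  proof -
    have "(\<Prod>B\<in>?F1. (card B + 1) ^ (card B - 1)) = (\<Prod>B\<in>?F1. p ^ (p - 2))"
    proof (rule prod.cong[OF refl])
      fix B assume "B \<in> ?F1"
      then have "card B = p - 1" by (rule cardF1)
      moreover have "p - 1 + 1 = p" "p - 1 - 1 = p - 2" using p2 by auto
      ultimately show "(card B + 1) ^ (card B - 1) = p ^ (p - 2)" by (simp only:)
    qed
    also have "\<dots> = (p ^ (p - 2)) ^ card ?C" using inj by (simp add: card_image)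
    finally show ?thesis by (simp only: card_conjugates[OF fin P(1)])
  qed
  also have "\<dots> \<le> (\<Prod>B\<in>?F1 \<union> ?F2. (card B + 1) ^ (card B - 1))"
    using finC fin by (intro prod_subset_le_nat) simp_all
  also have "\<dots> \<le> kappa_P G"
  proof (rule kappa_P_ge_blocks[OF fin])
    have "\<Union>?F2 = carrier G - {\<one>} - \<Union>?F1" by simp
    then show "\<Union>(?F1 \<union> ?F2) = carrier G - {\<one>}" using sub1 by (simp only: Union_Un_distrib) blast
    show "{} \<notin> ?F1 \<union> ?F2"
    proof
      assume "{} \<in> ?F1 \<union> ?F2"
      then have "{} \<in> ?F1" by blast
      then have "card ({} :: 'a set) = p - 1" by (rule cardF1)
      then show False using p2 by simp
    qed
    show "B \<inter> B' = {}" if BB: "B \<in> ?F1 \<union> ?F2" "B' \<in> ?F1 \<union> ?F2" "B \<noteq> B'" for B B'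
    proof -
      consider "B \<in> ?F1" "B' \<in> ?F1" | "B \<in> ?F1" "B' \<in> ?F2" | "B \<in> ?F2" "B' \<in> ?F1" | "B \<in> ?F2" "B' \<in> ?F2"
        using BB(1,2) by blast
      then show ?thesis
      proof cases
        case 1
        then show ?thesis using disj1 BB(3) by blast
      next
        case 4
        then show ?thesis using BB(3) by blast
      qed blast+
    qed
    show "power_adj G v w" if B: "B \<in> ?F1 \<union> ?F2" "v \<in> B" "w \<in> B" "v \<noteq> w" for B v w
    proof -
      have "B \<in> ?F1" using B by blast
      then obtain Q1 where Q1: "Q1 \<in> ?C" "B = Q1 - {\<one>}" by blast
      have "Q1 = {v [^] k | k. k \<in> (UNIV :: nat set)}"
        using Q[OF Q1(1)] P(3) B(2) Q1(2) by (intro generate_eq_prime_subgroup[OF fin, of Q1 p v]) auto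
      then obtain n :: nat where "w = v [^] n" using B(3) Q1(2) by blast
      then show ?thesis using B(4) unfolding power_adj_def by blast
    qed
  qed
  finally show ?thesis .
qed

context simple_group_kappa
begin

text \<open>The number of Sylow subgroups appears as the index of a normalizer. It is at least 5,
  since otherwise \<open>small_index\<close> would make \<open>P\<close> normal.\<close>

lemma sylow_facts:
  assumes p: "prime p" and n: "order G = p ^ Suc k * m" "\<not> p dvd m"
  obtains P where "subgroup P G" "card P = p ^ Suc k" "card (rcosets P) = m"
    "card (rcosets (conj_stab G P)) mod p = 1" "card (rcosets (conj_stab G P)) dvd m"
    "5 \<le> card (rcosets (conj_stab G P))"
proof -
  obtain P where P: "subgroup P G" "card P = p ^ Suc k"
    using sylow_thm[OF p group_axioms n(1) fin] by blast
  have "card (rcosets P) * p ^ Suc k = m * p ^ Suc k"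
    using lagrange[OF P(1)] P(2) n(1) by (simp add: mult.commute)
  then have m: "card (rcosets P) = m" using prime_gt_0_nat[OF p] by simp
  have N: "subgroup (conj_stab G P) G" by (rule subgroup_conj_stab[OF fin subgroup.subset[OF P(1)]])
  have "card (rcosets (conj_stab G P)) mod p = 1"
    using sylow_conj_stab_index_cong[OF fin p P] m n(2) by simp
  moreover have "card (rcosets (conj_stab G P)) dvd m"
    using card_rcosets_mult_dvd(2)[OF P(1) N subgroup_le_conj_stab[OF P(1)] fin] m by simp
  moreover have "5 \<le> card (rcosets (conj_stab G P))"
  proof (rule ccontr)
    assume "\<not> ?thesis"
    then have "conj_stab G P = carrier G" by (intro small_index[OF N]) simp
    then have "P \<lhd> G" by (rule normal_of_conj_stab[OF P(1)])
    then show False by (rule normal_primepow_trivial[OF _ p P(2)]) (simp add: P(2))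
  qed
  ultimately show thesis using that P m by blast
qed

lemma order_not_2_3:
  assumes "prime p" "p dvd 2 ^ a * 3 ^ b"
  shows "p = 2 \<or> p = (3::nat)"
proof -
  have "p dvd 2 \<or> p dvd 3" using assms by (metis prime_dvd_mult_iff prime_dvd_power)
  moreover have "prime (2::nat)" "prime (3::nat)" by simp_all
  ultimately show ?thesis using assms(1) primes_dvd_imp_eq by blast
qed

text \<open>The number of Sylow 7-subgroups is 1 modulo 7, at least 5, and has no prime factor
  besides 2 and 3. The candidates 15, 22 and 29 have the factors 5, 11 and 29; the next admissible
  value after 8 is 36, and there the spanning trees are too many.\<close>

lemma sylow_7:
  assumes "7 dvd order G"
  obtains P where "subgroup P G" "card P = 7" "card (rcosets (conj_stab G P)) = 8"
proof -
  obtain a b c where n: "order G = 2 ^ a * 3 ^ b * 7 ^ c" by (rule order_form)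
  have p7: "prime (7::nat)" by simp
  have n7: "\<not> 7 dvd (2::nat) ^ a * 3 ^ b" using order_not_2_3[OF p7, of a b] by auto
  then obtain k where c: "c = Suc k" using assms n by (cases c) auto
  then have n': "order G = 7 ^ Suc k * (2 ^ a * 3 ^ b)" using n by simp
  obtain P where P: "subgroup P G" "card P = 7 ^ Suc k" "card (rcosets P) = 2 ^ a * 3 ^ b"
    "card (rcosets (conj_stab G P)) mod 7 = 1" "card (rcosets (conj_stab G P)) dvd 2 ^ a * 3 ^ b"
    "5 \<le> card (rcosets (conj_stab G P))"
    by (rule sylow_facts[OF p7 n' n7])
  let ?s = "card (rcosets (conj_stab G P))"
  have s_not: "\<not> p dvd ?s" if "prime p" "p \<noteq> 2" "p \<noteq> 3" for p
    using order_not_2_3[of p a b] that P(5) dvd_trans by blast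
  have "?s = 8 \<and> k = 0"
  proof (cases k)
    case 0
    have "(7 ^ 5) ^ ?s \<le> kappa_P G"
      using kappa_P_ge_conjugates[OF fin P(1), of 7] P(2) 0 by simp
    have "?s < 36"
    proof (rule ccontr)
      assume "\<not> ?s < 36"
      then have "((7::nat) ^ 5) ^ 36 \<le> (7 ^ 5) ^ ?s" by (intro power_increasing) auto
      also have "\<dots> \<le> 7 ^ 40 * 3 ^ 28 * 4 ^ 42" using \<open>(7 ^ 5) ^ ?s \<le> kappa_P G\<close> unfolding kappa_eq .
      finally show False by simp
    qed
    then have "?s = 8 \<or> ?s = 15 \<or> ?s = 22 \<or> ?s = 29" using P(4,6) by presburger
    moreover have "?s \<noteq> 15" using s_not[of 5] by auto
    moreover have "?s \<noteq> 22" using s_not[of 11] by auto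
    moreover have "?s \<noteq> 29" using s_not[of 29] by auto
    ultimately show ?thesis using 0 by blast
  next
    case (Suc j)
    \<comment> \<open>If 49 divides the order, the bound 576 leaves only eight Sylow 7-subgroups.
      Then the order divides \<open>fact 8\<close>, which is not a multiple of 49.\<close>
    have "49 * ?s \<le> 7 ^ Suc k * (2 ^ a * 3 ^ b)"
      using P(5) Suc by (intro mult_mono dvd_imp_le) (simp_all add: power_add)
    then have "?s \<le> 11" using order_lt_576 n' by linarith
    then have s8: "?s = 8" using P(4,6) by presburger
    have N: "subgroup (conj_stab G P) G" by (rule subgroup_conj_stab[OF fin subgroup.subset[OF P(1)]])
    have "conj_stab G P \<noteq> carrier G"
    proof
      assume "conj_stab G P = carrier G"
      then have "?s * order G = order G" using lagrange[OF N] by (simp add: order_def)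
      then show False using s8 order_gt_24 by simp
    qed
    then have "order G dvd fact 8" using order_dvd_fact_index[OF fin N] s8 by simp
    moreover have "7 ^ 2 dvd order G" unfolding n' Suc by (intro dvd_mult2 le_imp_power_dvd) simp
    ultimately have "(7::nat) ^ 2 dvd fact 8" using dvd_trans by blast
    then show ?thesis by (simp add: fact_numeral)
  qed
  then show thesis using that[OF P(1)] P(2) by simp
qed

end

text \<open>A subgroup of index \<open>p\<close> in a \<open>p\<close>-group is normal: inside
  \<open>Q\<close> its normalizer is larger by a factor \<open>p\<close> and hence all of
  \<open>Q\<close>.\<close>

lemma (in group) normalizes_index_prime:
  assumes fin: "finite (carrier G)" and p: "prime p"
    and Q: "subgroup Q G" "card Q = p ^ Suc k" and D: "subgroup D G" "card D = p ^ k" "D \<subseteq> Q"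
  shows "Q \<subseteq> conj_stab G D"
proof -
  interpret Q: group "G\<lparr>carrier := Q\<rparr>" by (rule subgroup_imp_group[OF Q(1)])
  have finQ: "finite (carrier (G\<lparr>carrier := Q\<rparr>))" using finite_subset[OF subgroup.subset[OF Q(1)] fin] by simp
  have DQ: "subgroup D (G\<lparr>carrier := Q\<rparr>)" by (rule subgroup_incl[OF D(1) Q(1) D(3)])
  have "card (rcosets\<^bsub>G\<lparr>carrier := Q\<rparr>\<^esub> D) * p ^ k = p * p ^ k"
    using Q.lagrange[OF DQ] D(2) Q(2) by (simp add: order_def)
  then have "card (rcosets\<^bsub>G\<lparr>carrier := Q\<rparr>\<^esub> D) = p" using prime_gt_0_nat[OF p] by simp
  then have "p ^ Suc k dvd card (conj_stab (G\<lparr>carrier := Q\<rparr>) D)"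
    by (intro Q.normalizer_grows[OF finQ p DQ D(2)]) simp
  moreover have sub: "conj_stab (G\<lparr>carrier := Q\<rparr>) D \<subseteq> Q" by (auto simp: conj_stab_def)
  moreover have "\<one> \<in> conj_stab (G\<lparr>carrier := Q\<rparr>) D"
    using subgroup.one_closed[OF Q.subgroup_conj_stab[OF finQ]] D(3) by simp
  ultimately have "card Q \<le> card (conj_stab (G\<lparr>carrier := Q\<rparr>) D)"
    using finQ Q(2) by (intro dvd_imp_le) (auto simp: card_gt_0_iff dest: finite_subset)
  then have "conj_stab (G\<lparr>carrier := Q\<rparr>) D = Q"
    using sub finQ by (intro card_seteq) simp_all
  moreover have "conj_stab (G\<lparr>carrier := Q\<rparr>) D \<subseteq> conj_stab G D"
    using Q(1) subgroup.subset[OF Q(1)] by (auto simp: conj_stab_def)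
  ultimately show ?thesis by simp
qed

text \<open>The number of Sylow 3-subgroups of \<open>L\<close> is a power of 2, is 1 modulo 3, and
  is not 1 because \<open>L\<close> contains both \<open>P\<close> and \<open>R\<close>. Hence it is
  a multiple of 4.\<close>

lemma (in group) sylow3_pair_card_dvd:
  assumes fin: "finite (carrier G)" and n: "order G = 2 ^ a * 3 ^ b"
    and P: "subgroup P G" "card P = 3 ^ b" and R: "subgroup R G" "card R = 3 ^ b" "R \<noteq> P"
    and L: "subgroup L G" "P \<subseteq> L" "R \<subseteq> L"
  shows "4 * 3 ^ b dvd card L"
    and "4 dvd card (rcosets\<^bsub>G\<lparr>carrier := L\<rparr>\<^esub> (conj_stab (G\<lparr>carrier := L\<rparr>) P))"
proof -
  interpret L: group "G\<lparr>carrier := L\<rparr>" by (rule subgroup_imp_group[OF L(1)])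
  let ?L = "G\<lparr>carrier := L\<rparr>"
  let ?N = "conj_stab ?L P"
  have finL: "finite (carrier ?L)" using finite_subset[OF subgroup.subset[OF L(1)] fin] by simp
  have PL: "subgroup P ?L" and RL: "subgroup R ?L" using subgroup_incl P(1) R(1) L by blast+
  have cL: "card L = card (rcosets\<^bsub>?L\<^esub> P) * 3 ^ b"
    using L.lagrange[OF PL] P(2) by (simp add: order_def)
  have "card L dvd 2 ^ a * 3 ^ b" using lagrange[OF L(1)] n by (metis dvd_triv_right)
  then have "card (rcosets\<^bsub>?L\<^esub> P) dvd 2 ^ a" using cL by simp
  then obtain j where j: "card (rcosets\<^bsub>?L\<^esub> P) = 2 ^ j" by (auto simp: divides_primepow_nat)
  have p3: "prime (3::nat)" by simp
  have n3: "\<not> 3 dvd card (rcosets\<^bsub>?L\<^esub> P)"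
  proof
    assume "3 dvd card (rcosets\<^bsub>?L\<^esub> P)"
    then have "3 dvd (2::nat)" using j prime_dvd_power[OF p3] by metis
    then show False by simp
  qed
  have N: "subgroup ?N ?L" using PL subgroup.subset by (intro L.subgroup_conj_stab[OF finL]) blast
  let ?t = "card (rcosets\<^bsub>?L\<^esub> ?N)"
  have t: "?t mod 3 = 1" by (rule L.sylow_conj_stab_index_cong[OF finL p3 PL P(2) n3])
  have td: "?t dvd card (rcosets\<^bsub>?L\<^esub> P)"
    using L.card_rcosets_mult_dvd(2)[OF PL N L.subgroup_le_conj_stab[OF PL] finL] by simp
  then obtain i where i: "?t = 2 ^ i" using j by (auto simp: divides_primepow_nat)
  have "?t \<noteq> 1"
  proof
    assume "?t = 1"
    then have "card ?N = card L" using L.lagrange[OF N] by (simp add: order_def)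
    then have "?N = L" using finL subgroup.subset[OF N] by (intro card_subset_eq) simp_all
    then have "R \<subseteq> P"
      using L.normalizing_p_subgroup_le[OF finL p3 PL n3 RL R(2)] L(3) by simp
    then have "R = P" using P(2) R(2) finite_subset[OF subgroup.subset[OF P(1)] fin]
      by (intro card_subset_eq) simp_all
    then show False using R(3) by simp
  qed
  then have "i \<noteq> 0" "i \<noteq> 1" using i t by (auto intro!: notI)
  then have "(2::nat) ^ 2 dvd 2 ^ i" by (intro le_imp_power_dvd) simp
  then show t4: "4 dvd ?t" using i by simp
  then show "4 * 3 ^ b dvd card L" unfolding cL using td by (intro mult_dvd_mono dvd_refl) (rule dvd_trans)
qed

section \<open>Orders with only the prime factors 2 and 3\<close>

text \<open>\<open>P\<close> acts on the cosets of its normalizer and fixes only the trivial one. If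
  all other orbits had length divisible by 9, the index would be 1 modulo 9; so some orbit has
  length 3. The stabilizer \<open>D\<close> of a point of this orbit has index 3 in \<open>P\<close>
  and lies in the conjugate of \<open>P\<close> belonging to that point.\<close>

lemma (in group) index_3_intersection:
  assumes fin: "finite (carrier G)"
    and P: "subgroup P G" "card P = 3 ^ b" "\<not> 3 dvd card (rcosets P)"
    and s: "card (rcosets (conj_stab G P)) mod 9 \<noteq> 1" "b \<noteq> 0"
  obtains R D where "subgroup R G" "card R = 3 ^ b" "R \<noteq> P" "subgroup D G" "card D = 3 ^ (b - 1)"
    "D \<subseteq> P" "D \<subseteq> R"
proof -
  let ?N = "conj_stab G P"
  have PG: "P \<subseteq> carrier G" by (rule subgroup.subset[OF P(1)])
  have N: "subgroup ?N G" by (rule subgroup_conj_stab[OF fin PG])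
  have NG: "?N \<subseteq> carrier G" by (rule subgroup.subset[OF N])
  have p3: "prime (3::nat)" by simp
  interpret act: group_action G "rcosets ?N" "coset_act G ?N" by (rule group_action_coset_act[OF N])
  interpret A: group_action "G\<lparr>carrier := P\<rparr>" "rcosets ?N" "coset_act G ?N"
    by (rule act.induced_action[OF P(1)])
  have ordP: "order (G\<lparr>carrier := P\<rparr>) = 3 ^ b" using P(2) by (simp add: order_def)
  let ?orb = "orbit (G\<lparr>carrier := P\<rparr>) (coset_act G ?N)"
  have conj_in: "(\<lambda>x. a \<otimes> x \<otimes> inv a) ` Q \<subseteq> P"
    if Q: "subgroup Q G" "card Q = 3 ^ j" "a \<in> carrier G" "\<forall>x\<in>Q. a \<otimes> x \<otimes> inv a \<in> ?N" for Q j a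
    by (rule normalizing_p_subgroup_le[OF fin p3 P(1,3) subgroup_conj_image(1)[OF Q(1,3)], of j])
      (use Q(2,4) subgroup_conj_image(2)[OF Q(1,3)] in auto)
  have "\<exists>x\<in>rcosets ?N. x \<noteq> ?N #> \<one> \<and> \<not> 9 dvd card (?orb x)"
  proof (rule ccontr)
    assume "\<not> ?thesis"
    then have nine: "9 dvd card (?orb x)" if "x \<in> rcosets ?N" "x \<noteq> ?N #> \<one>" for x using that by blast
    let ?F = "{x \<in> rcosets ?N. \<forall>g\<in>carrier (G\<lparr>carrier := P\<rparr>). coset_act G ?N g x = x}"
    have orb1: "?orb x = {x}" if "x \<in> ?F" for x
    proof
      show "?orb x \<subseteq> {x}"
      proof
        fix z assume "z \<in> ?orb x"
        then obtain g where "g \<in> P" "z = coset_act G ?N g x" by (auto simp: orbit_def)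
        then show "z \<in> {x}" using that by simp
      qed
      show "{x} \<subseteq> ?orb x" using that A.orbit_refl[of x] by simp
    qed
    have N1: "?N #> \<one> \<in> ?F"
    proof -
      have "coset_act G ?N g (?N #> \<one>) = ?N #> \<one>" if "g \<in> P" for g
        using coset_act_fixed_iff[OF N one_closed, of g] that PG subgroup_le_conj_stab[OF P(1)] by auto
      then show ?thesis using NG by (simp add: rcosetsI del: coset_mult_one)
    qed
    have "card (rcosets ?N) mod 9 = card ?F mod 9"
    proof (rule A.card_fixed_points_cong_gen)
      show "9 dvd card (?orb x)" if "x \<in> rcosets ?N" "card (?orb x) \<noteq> 1" for x
      proof (rule nine[OF that(1)])
        show "x \<noteq> ?N #> \<one>" using that(2) orb1[OF N1] by (intro notI) simp
      qed
      show "finite (rcosets ?N)" using fin by (simp add: RCOSETS_def)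
    qed
    moreover have "?F = {?N #> \<one>}"
    proof
      show "?F \<subseteq> {?N #> \<one>}"
      proof
        fix x assume x: "x \<in> ?F"
        have "\<not> 9 dvd card (?orb x)" using orb1[OF x] by simp
        then show "x \<in> {?N #> \<one>}" using nine[of x] x by blast
      qed
    qed (use N1 in simp)
    ultimately show False using s(1) by simp
  qed
  then obtain a where a: "a \<in> carrier G" "?N #> a \<in> rcosets ?N" "?N #> a \<noteq> ?N #> \<one>" "\<not> 9 dvd card (?orb (?N #> a))"
    unfolding RCOSETS_def by blast
  have aN: "a \<notin> ?N" using a(1,3) rcos_eq_iff[OF N a(1) one_closed] by simp
  obtain i where i: "card (?orb (?N #> a)) = 3 ^ i" by (rule A.card_orbit_primepow[OF p3 ordP a(2)])
  have "i \<le> 1"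
  proof (rule ccontr)
    assume "\<not> i \<le> 1"
    then have "(3::nat) ^ 2 dvd 3 ^ i" by (intro le_imp_power_dvd) simp
    then show False using a(4) i by simp
  qed
  define D where "D = stabilizer (G\<lparr>carrier := P\<rparr>) (coset_act G ?N) (?N #> a)"
  have D_iff: "x \<in> D \<longleftrightarrow> x \<in> P \<and> a \<otimes> x \<otimes> inv a \<in> ?N" for x
  proof (cases "x \<in> P")
    case True
    then have "x \<in> carrier G" using PG by blast
    then show ?thesis using coset_act_fixed_iff[OF N a(1), of x] True by (simp add: D_def stabilizer_def)
  qed (simp add: D_def stabilizer_def)
  have DG: "subgroup D G"
    using incl_subgroup[OF P(1)] A.stabilizer_subgroup[OF a(2)] D_def by simp
  have cD: "3 ^ i * card D = 3 ^ b"
    using A.orbit_stabilizer_theorem[OF a(2)] i ordP D_def by simp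
  have ib: "i \<le> b" using cD by (metis dvd_triv_left power_dvd_imp_le one_less_numeral_iff semiring_norm(77))
  have cD': "card D = 3 ^ (b - i)"
  proof -
    have "(3::nat) ^ i * card D = 3 ^ i * 3 ^ (b - i)" using cD ib by (simp flip: power_add)
    then show ?thesis by simp
  qed
  have sub: "(\<lambda>x. a \<otimes> x \<otimes> inv a) ` D \<subseteq> P" by (rule conj_in[OF DG cD' a(1)]) (use D_iff in blast)
  \<comment> \<open>Orbit length 1 would mean that \<open>a\<close> conjugates all of
    \<open>P\<close> into \<open>P\<close>, placing \<open>a\<close> in the normalizer.\<close>
  have i1: "i = 1"
  proof (rule ccontr)
    assume "i \<noteq> 1"
    then have "card D = card P" using \<open>i \<le> 1\<close> cD' P(2) by simp
    then have "D = P"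
      using D_iff finite_subset[OF PG fin] by (intro card_subset_eq) auto
    then have "a \<in> ?N" using sub a(1) by (auto simp: conj_stab_def)
    then show False using aN by simp
  qed
  let ?R = "(\<lambda>x. inv a \<otimes> x \<otimes> inv (inv a)) ` P"
  have R: "subgroup ?R G" "card ?R = 3 ^ b"
    using subgroup_conj_image[OF P(1), of "inv a"] a(1) P(2) by simp_all
  have "?R \<noteq> P"
  proof
    assume "?R = P"
    then have "inv a \<otimes> x \<otimes> inv (inv a) \<in> P" if "x \<in> P" for x using that by blast
    then have "inv a \<in> ?N" using a(1) by (simp add: conj_stab_def)
    then have "inv (inv a) \<in> ?N" by (rule subgroup.m_inv_closed[OF N])
    then show False using aN a(1) by simp
  qed
  moreover have "D \<subseteq> ?R"
  proof
    fix x assume x: "x \<in> D"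
    then have xG: "x \<in> carrier G" using DG by (rule_tac subgroup.mem_carrier)
    have "inv a \<otimes> (a \<otimes> x \<otimes> inv a) \<otimes> inv (inv a) = (inv a \<otimes> a) \<otimes> x \<otimes> inv (inv a \<otimes> a)"
      using a(1) xG by (intro conj_mult[symmetric]) simp_all
    then have "x = inv a \<otimes> (a \<otimes> x \<otimes> inv a) \<otimes> inv (inv a)" using a(1) xG by simp
    moreover have "a \<otimes> x \<otimes> inv a \<in> P" using sub x by blast
    ultimately show "x \<in> ?R" by blast
  qed
  moreover have "D \<subseteq> P" using D_iff by blast
  ultimately show thesis using that[OF R _ DG] cD' i1 by simp
qed

text \<open>\<open>Q\<close> acts on \<open>D\<close> by conjugation. The number of fixed points is
  divisible by \<open>p\<close> and positive because of the identity, so all \<open>p\<close>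
  elements are fixed.\<close>

lemma (in group) p_group_centralizes_prime_subgroup:
  assumes fin: "finite (carrier G)" and p: "prime p"
    and Q: "subgroup Q G" "card Q = p ^ k" and D: "subgroup D G" "card D = p"
    and norm: "Q \<subseteq> conj_stab G D"
  shows "Q \<subseteq> centralizer_of G D"
proof -
  have QG: "Q \<subseteq> carrier G" and DG: "D \<subseteq> carrier G" by (rule subgroup.subset[OF Q(1)] subgroup.subset[OF D(1)])+
  interpret Q: group "G\<lparr>carrier := Q\<rparr>" by (rule subgroup_imp_group[OF Q(1)])
  have A: "group_action (G\<lparr>carrier := Q\<rparr>) D (\<lambda>g. \<lambda>x\<in>D. g \<otimes> x \<otimes> inv g)"
  proof (rule Q.group_actionI)
    fix g x assume "g \<in> carrier (G\<lparr>carrier := Q\<rparr>)" "x \<in> D"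
    then show "g \<otimes> x \<otimes> inv g \<in> D" using norm by (auto simp: conj_stab_def)
  next
    fix x assume "x \<in> D"
    then have "x \<in> carrier G" using DG by blast
    then show "\<one>\<^bsub>G\<lparr>carrier := Q\<rparr>\<^esub> \<otimes> x \<otimes> inv \<one>\<^bsub>G\<lparr>carrier := Q\<rparr>\<^esub> = x" by simp
  next
    fix g h x assume "g \<in> carrier (G\<lparr>carrier := Q\<rparr>)" "h \<in> carrier (G\<lparr>carrier := Q\<rparr>)" "x \<in> D"
    then have "g \<in> carrier G" "h \<in> carrier G" "x \<in> carrier G" using QG DG by auto
    from conj_mult[OF this]
    show "g \<otimes>\<^bsub>G\<lparr>carrier := Q\<rparr>\<^esub> h \<otimes> x \<otimes> inv (g \<otimes>\<^bsub>G\<lparr>carrier := Q\<rparr>\<^esub> h) = g \<otimes> (h \<otimes> x \<otimes> inv h) \<otimes> inv g"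
      by simp
  qed
  interpret A: group_action "G\<lparr>carrier := Q\<rparr>" D "\<lambda>g. \<lambda>x\<in>D. g \<otimes> x \<otimes> inv g" by (rule A)
  let ?F = "{x \<in> D. \<forall>g\<in>Q. g \<otimes> x \<otimes> inv g = x}"
  have finD: "finite D" by (rule finite_subset[OF DG fin])
  have "card D mod p = card {x \<in> D. \<forall>g\<in>carrier (G\<lparr>carrier := Q\<rparr>). (\<lambda>x\<in>D. g \<otimes> x \<otimes> inv g) x = x} mod p"
    using Q(2) by (intro A.card_fixed_points_cong[OF p _ finD]) (simp add: order_def)
  also have "{x \<in> D. \<forall>g\<in>carrier (G\<lparr>carrier := Q\<rparr>). (\<lambda>x\<in>D. g \<otimes> x \<otimes> inv g) x = x} = ?F" by auto
  finally have "p dvd card ?F" using D(2) by (simp add: mod_0_imp_dvd)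
  moreover have "\<one> \<in> ?F" using QG subgroup.one_closed[OF D(1)] by auto
  moreover have "finite ?F" using finD by simp
  ultimately have "p \<le> card ?F" by (intro dvd_imp_le) (auto simp: card_gt_0_iff)
  then have "?F = D" using D(2) finD by (intro card_seteq) auto
  then have fix_all: "g \<otimes> x \<otimes> inv g = x" if "x \<in> D" "g \<in> Q" for x g using that by blast
  show ?thesis
  proof
    fix g assume g: "g \<in> Q"
    then have gG: "g \<in> carrier G" using QG by blast
    have "g \<otimes> x = x \<otimes> g" if "x \<in> D" for x
    proof -
      have xG: "x \<in> carrier G" using that DG by blast
      have "g \<otimes> x = g \<otimes> x \<otimes> inv g \<otimes> g" using gG xG by (simp add: m_assoc)
      then show ?thesis using fix_all[OF that g] by simp
    qed
    then show "g \<in> centralizer_of G D" using gG by (simp add: centralizer_of_def)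
  qed
qed

text \<open>In a group of order 36 with a central subgroup \<open>D\<close> of order 3 and at least four Sylow 3-subgroups,
  27 elements have order dividing 9; the others are the products \<open>t d\<close> with \<open>1 \<noteq> t \<in> T\<close>, \<open>d \<in> D\<close>. Hence the
  ninth powers form the Sylow 2-subgroup \<open>T\<close>.\<close>

lemma (in group) sylow2_normal_order_36:
  assumes n: "order G = 36" and P: "subgroup P G" "card P = 9" "4 \<le> card (rcosets (conj_stab G P))"
    and D: "subgroup D G" "card D = 3" "D \<subseteq> P" "centralizer_of G D = carrier G"
    and T: "subgroup T G" "card T = 4"
    and xt: "x \<in> carrier G" "t \<in> T"
  shows "x \<otimes> t \<otimes> inv x \<in> T"
proof -
  have fin: "finite (carrier G)" using n order_gt_0_iff_finite by simp
  have DG: "D \<subseteq> carrier G" and TG: "T \<subseteq> carrier G"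
    by (rule subgroup.subset[OF D(1)] subgroup.subset[OF T(1)])+
  have comm: "y \<otimes> d = d \<otimes> y" if "y \<in> carrier G" "d \<in> D" for y d
  proof -
    have "y \<in> centralizer_of G D" using that(1) D(4) by simp
    then show ?thesis using that(2) by (simp add: centralizer_of_def)
  qed
  have pow_card: "y [^] card H = \<one>" if H: "subgroup H G" "y \<in> H" for y H
  proof -
    interpret H: group "G\<lparr>carrier := H\<rparr>" by (rule subgroup_imp_group[OF H(1)])
    show ?thesis using H.pow_order_eq_1[of y] H(2) by (simp add: order_def flip: nat_pow_consistent)
  qed
  let ?C = "conjugates G P"
  have Q: "subgroup Q G" "card Q = 9" if "Q \<in> ?C" for Q
    using conjugates_subgroup[OF P(1) that] P(2) by simp_all
  have DQ: "D \<subseteq> Q" if QC: "Q \<in> ?C" for Q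
  proof
    obtain a where a: "a \<in> carrier G" "Q = (\<lambda>x. inv a \<otimes> x \<otimes> inv (inv a)) ` P"
      using QC unfolding conjugates_def by blast
    fix d assume d: "d \<in> D"
    then have "d \<in> carrier G" using DG by blast
    then have "inv a \<otimes> d \<otimes> inv (inv a) = d" using comm[of "inv a" d] a(1) d by (simp add: m_assoc)
    then have "d = (\<lambda>x. inv a \<otimes> x \<otimes> inv (inv a)) d" by (rule sym)
    then show "d \<in> Q" unfolding a(2) using d D(3) by (intro image_eqI) auto
  qed
  have finQ: "finite Q" if "Q \<in> ?C" for Q
    by (rule finite_subset[OF subgroup.subset[OF Q(1)[OF that]] fin])
  have inter: "Q \<inter> R = D" if QR: "Q \<in> ?C" "R \<in> ?C" "Q \<noteq> R" for Q R
  proof -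
    have "card (Q \<inter> R) dvd 3 ^ 2"
      using card_Int_subgroup_dvd[OF fin Q(1)[OF QR(1)] Q(1)[OF QR(2)]] Q(2)[OF QR(1)] by simp
    moreover have "prime (3::nat)" by simp
    ultimately obtain i where i: "i \<le> 2" "card (Q \<inter> R) = 3 ^ i" using divides_primepow_nat by blast
    have "i \<noteq> 2"
    proof
      assume "i = 2"
      then have "card (Q \<inter> R) = card Q" "card (Q \<inter> R) = card R" using i Q(2) QR by simp_all
      then have "Q \<inter> R = Q" "Q \<inter> R = R"
        using card_subset_eq[OF finQ[OF QR(1)] Int_lower1] card_subset_eq[OF finQ[OF QR(2)] Int_lower2] by blast+
      then show False using QR(3) by simp
    qed
    then have "card (Q \<inter> R) \<le> card D"
      using i D(2) by (cases "i = 0") (auto simp: le_Suc_eq numeral_2_eq_2)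
    moreover have "D \<subseteq> Q \<inter> R" using DQ QR by blast
    ultimately show ?thesis using finQ[OF QR(1)] by (intro card_seteq[symmetric]) auto
  qed
  let ?A = "{y \<in> carrier G. y [^] (9::nat) = \<one>}"
  let ?F = "(\<lambda>Q. Q - D) ` ?C"
  have finD: "finite D" by (rule finite_subset[OF DG fin])
  \<comment> \<open>Distinct conjugates of \<open>P\<close> meet exactly in \<open>D\<close>, so
    each of the at least four contributes 9 - 3 = 6 elements of its own.\<close>
  have "24 \<le> card (\<Union>?F)"
  proof -
    have "card (\<Union>?F) = (\<Sum>Q\<in>?C. card (Q - D))"
    proof (rule card_UN_disjoint)
      show "finite ?C" using fin by (simp add: conjugates_def)
      show "\<forall>Q\<in>?C. finite (Q - D)" using finQ by blast
      show "\<forall>Q\<in>?C. \<forall>R\<in>?C. Q \<noteq> R \<longrightarrow> (Q - D) \<inter> (R - D) = {}" using inter by blast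
    qed
    also have "\<dots> = (\<Sum>Q\<in>?C. 6)"
      by (rule sum.cong) (simp_all add: card_Diff_subset finD DQ Q(2) D(2))
    also have "\<dots> = 6 * card (rcosets (conj_stab G P))" using card_conjugates[OF fin P(1)] by simp
    finally show ?thesis using P(3) by simp
  qed
  moreover have "card (\<Union>?F \<union> D) = card (\<Union>?F) + card D"
  proof (rule card_Un_disjoint)
    show "finite (\<Union>?F)" using finQ fin by (simp add: conjugates_def)
  qed (use finD in auto)
  moreover have "card (\<Union>?F \<union> D) \<le> card ?A"
  proof (rule card_mono)
    show "finite ?A" using fin by simp
    have "y \<in> ?A" if "Q \<in> ?C" "y \<in> Q" for y Q
      using pow_card[OF Q(1)[OF that(1)] that(2)] Q(2)[OF that(1)] subgroup.mem_carrier[OF Q(1)[OF that(1)] that(2)]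
      by simp
    moreover have "d \<in> ?A" if "d \<in> D" for d
      using pow_card[OF P(1), of d] P(2) that D(3) DG by auto
    ultimately show "\<Union>?F \<union> D \<subseteq> ?A" by blast
  qed
  ultimately have A27: "27 \<le> card ?A" using D(2) by linarith
  \<comment> \<open>9 is 1 modulo 4 and 0 modulo 3, so the ninth power keeps the factor of order
    dividing 4 and kills the central factor of order dividing 3.\<close>
  have td9: "(t \<otimes> d) [^] (9::nat) = t" if t: "t \<in> T" "d \<in> D" for t d
  proof -
    have G: "t \<in> carrier G" "d \<in> carrier G" using t TG DG by blast+
    have "t [^] (4::nat) = \<one>" using pow_card[OF T(1) t(1)] T(2) by simp
    then have "t [^] (9::nat) = t" using nat_pow_mod_of_pow_one[OF G(1), of 4 9] G(1) by simp
    moreover have "d [^] (3::nat) = \<one>" using pow_card[OF D(1) t(2)] D(2) by simp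
    then have "d [^] (9::nat) = \<one>" using nat_pow_mod_of_pow_one[OF G(2), of 3 9] by simp
    ultimately show ?thesis using pow_mult_distrib[OF comm[OF G(1) t(2)] G] G(1) by simp
  qed
  let ?B = "(\<lambda>(t, d). t \<otimes> d) ` ((T - {\<one>}) \<times> D)"
  have "inj_on (\<lambda>(t, d). t \<otimes> d) ((T - {\<one>}) \<times> D)"
  proof (rule inj_onI)
    fix u v assume u: "u \<in> (T - {\<one>}) \<times> D" and v: "v \<in> (T - {\<one>}) \<times> D"
      and eq: "(case u of (t, d) \<Rightarrow> t \<otimes> d) = (case v of (t, d) \<Rightarrow> t \<otimes> d)"
    obtain t d t' d' where uv: "u = (t, d)" "v = (t', d')" by (metis surj_pair)
    have td: "t \<in> T" "d \<in> D" "t' \<in> T" "d' \<in> D" using u v uv by auto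
    then have G: "t \<in> carrier G" "d \<in> carrier G" "d' \<in> carrier G" using TG DG by blast+
    have eq': "t \<otimes> d = t' \<otimes> d'" using eq uv by simp
    then have "t = t'" using td9[OF td(1,2)] td9[OF td(3,4)] by simp
    moreover from this have "d = d'" using eq' G by simp
    ultimately show "u = v" using uv by simp
  qed
  moreover have "card (T - {\<one>}) = 3" using T(2) subgroup.one_closed[OF T(1)] by simp
  ultimately have B9: "card ?B = 9" using D(2) by (simp add: card_image card_cartesian_product)
  have "?A \<inter> ?B = {}"
  proof -
    have "(t \<otimes> d) [^] (9::nat) \<noteq> \<one>" if "t \<in> T - {\<one>}" "d \<in> D" for t d using td9[of t d] that by simp
    then show ?thesis by auto
  qed
  moreover have finB: "finite ?B" using B9 by (intro card_ge_0_finite) simp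
  moreover have finA: "finite ?A" using fin by simp
  ultimately have "card (?A \<union> ?B) = card ?A + card ?B" by (intro card_Un_disjoint)
  moreover have BG: "?A \<union> ?B \<subseteq> carrier G" using TG DG by auto
  ultimately have "?A \<union> ?B = carrier G"
    using fin n A27 B9 by (intro card_seteq) (simp_all add: order_def)
  then have AB: "carrier G \<subseteq> ?A \<union> ?B" by (rule equalityD2)
  have ninth: "y [^] (9::nat) \<in> T" if y: "y \<in> carrier G" for y
  proof (cases "y \<in> ?A")
    case True
    then show ?thesis using subgroup.one_closed[OF T(1)] by simp
  next
    case False
    then have "y \<in> ?B" using y AB by blast
    then obtain t d where "t \<in> T" "d \<in> D" "y = t \<otimes> d" by auto
    then show ?thesis using td9[of t d] by simp
  qed
  have tG: "t \<in> carrier G" using xt(2) TG by blast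
  have d1: "\<one> \<in> D" by (rule subgroup.one_closed[OF D(1)])
  have "t [^] (9::nat) = t" using td9[OF xt(2) d1] tG by simp
  then have "(x \<otimes> t \<otimes> inv x) [^] (9::nat) = x \<otimes> t \<otimes> inv x" by (simp only: conj_nat_pow[OF xt(1) tG])
  then show ?thesis using ninth[of "x \<otimes> t \<otimes> inv x"] xt(1) tG by simp
qed

text \<open>The form of Lagrange's theorem needed for \<open>small_index\<close>: if the group has
  order 4c and the subgroup order is a multiple of c, the index is at most 4.\<close>

lemma factor_le_4:
  assumes "k * (c * m) = c * 4" "c > (0::nat)"
  shows "k \<le> 4"
proof -
  have "c * (k * m) = c * 4" using assms(1) by (simp only: mult_ac)
  then have "k * m = 4" using assms(2) by simp
  then have "k dvd 4" by (rule dvdI[OF sym])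
  then show ?thesis by (rule dvd_imp_le) simp
qed

text \<open>Otherwise the order is 2^a * 3^b. The number of Sylow 2-subgroups divides 3^b and is at
  least 5, so b is at least 2, and the bound 576 = 2^6 * 3^2 gives a \<le> 5. The number of Sylow
  3-subgroups is a power of 2, 1 modulo 3 and at least 5; this leaves 16, which is 7 modulo 9. So
  two Sylow 3-subgroups \<open>P\<close> and \<open>R\<close> share a subgroup \<open>D\<close> of
  index 3, and both normalize it.\<close>

lemma (in simple_group_kappa) seven_dvd_order: "7 dvd order G"
proof (rule ccontr)
  assume not7: "\<not> 7 dvd order G"
  obtain a b c where n0: "order G = 2 ^ a * 3 ^ b * 7 ^ c" by (rule order_form)
  then have "c = 0" using not7 by (cases c) auto
  then have n: "order G = 2 ^ a * 3 ^ b" using n0 by simp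
  have p2: "prime (2::nat)" and p3: "prime (3::nat)" by simp_all
  have "a \<noteq> 0" using order_not_primepow[OF p3, of b] n by (intro notI) simp
  moreover have "b \<noteq> 0" using order_not_primepow[OF p2, of a] n by (intro notI) simp
  ultimately obtain a' b' where ab: "a = Suc a'" "b = Suc b'" by (metis not0_implies_Suc)
  have n3: "\<not> 3 dvd (2::nat) ^ a" using prime_dvd_power[OF p3, of 2 a] by auto
  have n2: "\<not> 2 dvd (3::nat) ^ b" using prime_dvd_power[OF p2, of 3 b] by auto
  have nP: "order G = 3 ^ Suc b' * 2 ^ a" and nT: "order G = 2 ^ Suc a' * 3 ^ b" using n ab by simp_all
  obtain P where P: "subgroup P G" "card P = 3 ^ Suc b'" "card (rcosets P) = 2 ^ a"
    "card (rcosets (conj_stab G P)) mod 3 = 1" "card (rcosets (conj_stab G P)) dvd 2 ^ a"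
    "5 \<le> card (rcosets (conj_stab G P))"
    by (rule sylow_facts[OF p3 nP n3])
  obtain T where T: "card (rcosets (conj_stab G T)) dvd 3 ^ b" "5 \<le> card (rcosets (conj_stab G T))"
    by (rule sylow_facts[OF p2 nT n2])
  have b2: "2 \<le> b"
  proof (rule ccontr)
    assume "\<not> 2 \<le> b"
    then have "(3::nat) ^ b \<le> 3 ^ 1" by (intro power_increasing) auto
    then show False using T dvd_imp_le[OF T(1)] by simp
  qed
  obtain i where i: "i \<le> a" "card (rcosets (conj_stab G P)) = 2 ^ i"
    using P(5) divides_primepow_nat[OF p2] by blast
  have i4: "4 \<le> i"
  proof (rule ccontr)
    assume "\<not> 4 \<le> i"
    then have "i = 0 \<or> i = 1 \<or> i = 2 \<or> i = 3" by auto
    then show False using P(4,6) i(2) by auto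
  qed
  have a5: "a \<le> 5"
  proof (rule ccontr)
    assume "\<not> a \<le> 5"
    then have "(2::nat) ^ 6 * 3 ^ 2 \<le> 2 ^ a * 3 ^ b" using b2 by (intro mult_mono power_increasing) auto
    then show False using order_lt_576 n by simp
  qed
  have i_eq: "i = 4"
  proof (rule ccontr)
    assume "i \<noteq> 4"
    then have "i = 5" using i4 i(1) a5 by simp
    then show False using P(4) i(2) by simp
  qed
  have s16: "card (rcosets (conj_stab G P)) mod 9 \<noteq> 1" using i(2) i_eq by simp
  have n3': "\<not> 3 dvd card (rcosets P)" using P(3) n3 by simp
  obtain R D where R: "subgroup R G" "card R = 3 ^ Suc b'" "R \<noteq> P"
    and D: "subgroup D G" "card D = 3 ^ (Suc b' - 1)" "D \<subseteq> P" "D \<subseteq> R"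
    by (rule index_3_intersection[OF fin P(1,2) n3' s16]) auto
  have cD: "card D = 3 ^ b'" using D(2) by simp
  have dG: "D \<subseteq> carrier G" by (rule subgroup.subset[OF D(1)])
  have D_not_normal: "\<not> D \<lhd> G"
  proof
    assume "D \<lhd> G"
    then show False
      by (rule normal_primepow_trivial[OF _ p3 cD]) (use cD b2 ab in \<open>cases b'; simp\<close>)
  qed
  have normP: "P \<subseteq> conj_stab G D" by (rule normalizes_index_prime[OF fin p3 P(1,2) D(1) cD D(3)])
  have normR: "R \<subseteq> conj_stab G D" by (rule normalizes_index_prime[OF fin p3 R(1,2) D(1) cD D(4)])
  have nab: "order G = 2 ^ a * 3 ^ Suc b'" using n ab by simp
  have big: "card (rcosets L) * (4 * m) = 2 ^ a" if L: "subgroup L G" "card L = 4 * 3 ^ Suc b' * m" for L m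
  proof -
    have "card (rcosets L) * (4 * m) * 3 ^ Suc b' = 2 ^ a * 3 ^ Suc b'"
      using lagrange[OF L(1)] L(2) nab by (simp add: mult_ac)
    then show ?thesis by (rule mult_right_cancel[THEN iffD1, rotated]) simp
  qed
  have a45: "a = 4 \<or> a = 5" using i(1) i_eq a5 by auto
  then show False
  proof
    \<comment> \<open>The normalizer of \<open>D\<close> contains \<open>P\<close> and
      \<open>R\<close>, so its order is a multiple of 4 * 3^b, a quarter of the group order.\<close>
    assume a4: "a = 4"
    have L: "subgroup (conj_stab G D) G" by (rule subgroup_conj_stab[OF fin dG])
    obtain m where m: "card (conj_stab G D) = 4 * 3 ^ Suc b' * m"
      using sylow3_pair_card_dvd(1)[OF fin nab P(1,2) R L normP normR] by (rule dvdE)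
    have "card (rcosets (conj_stab G D)) \<le> 4"
      by (rule factor_le_4[of _ 4 m]) (use big[OF L m] a4 in simp_all)
    then have "conj_stab G D = carrier G" by (rule small_index[OF L])
    then show False using normal_of_conj_stab[OF D(1)] D_not_normal by blast
  next
    \<comment> \<open>Now the order is 2^5 * 3^2 = 288 and \<open>D\<close> has order 3, so that
      \<open>P\<close> and \<open>R\<close> even centralize it. The normalizer of a suitable
      subgroup \<open>T\<close> of order 4 replaces that of \<open>D\<close>.\<close>
    assume a5: "a = 5"
    have b: "b = 2"
    proof (rule ccontr)
      assume "b \<noteq> 2"
      then have "(2::nat) ^ 5 * 3 ^ 3 \<le> 2 ^ a * 3 ^ b" using b2 a5 by (intro mult_mono power_increasing) auto
      then show False using order_lt_576 n by simp
    qed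
    then have b': "b' = 1" using ab by simp
    have cD3: "card D = 3" using cD b' by simp
    let ?L = "centralizer_of G D"
    have L: "subgroup ?L G" by (rule subgroup_centralizer_of[OF fin dG])
    have PL: "P \<subseteq> ?L" by (rule p_group_centralizes_prime_subgroup[OF fin p3 P(1,2) D(1) cD3 normP])
    have RL: "R \<subseteq> ?L" by (rule p_group_centralizes_prime_subgroup[OF fin p3 R(1,2) D(1) cD3 normR])
    obtain m where m: "card ?L = 4 * 3 ^ Suc b' * m"
      using sylow3_pair_card_dvd(1)[OF fin nab P(1,2) R L PL RL] by (rule dvdE)
    have "\<not> card (rcosets ?L) \<le> 4"
    proof
      assume "card (rcosets ?L) \<le> 4"
      then have "?L = carrier G" by (rule small_index[OF L])
      then show False using normal_of_central[OF D(1)] D_not_normal by blast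
    qed
    moreover have idx: "card (rcosets ?L) * (4 * m) = 32" using big[OF L m] a5 by simp
    \<comment> \<open>The centralizer has index at least 5, and the product of that index with 4m is
      32; m \<ge> 2 would leave an index of at most 4.\<close>
    have "m = 1"
    proof -
      have "m \<noteq> 0" using idx by (intro notI) simp
      moreover have "\<not> 2 \<le> m"
      proof
        assume "2 \<le> m"
        then have "card (rcosets ?L) * (4 * 2) \<le> card (rcosets ?L) * (4 * m)" by (intro mult_left_mono) auto
        then show False using idx \<open>\<not> card (rcosets ?L) \<le> 4\<close> by linarith
      qed
      ultimately show ?thesis by simp
    qed
    then have c36: "card ?L = 36" using m b' by simp
    interpret L: group "G\<lparr>carrier := ?L\<rparr>" by (rule subgroup_imp_group[OF L])
    have finL: "finite (carrier (G\<lparr>carrier := ?L\<rparr>))" using finite_subset[OF subgroup.subset[OF L] fin] by simp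
    have o36: "order (G\<lparr>carrier := ?L\<rparr>) = 36" using c36 by (simp add: order_def)
    obtain T where T: "subgroup T (G\<lparr>carrier := ?L\<rparr>)" "card T = 2 ^ 2"
      using sylow_thm[OF p2 L.group_axioms _ finL, of 2 9] o36 by auto
    have TG: "subgroup T G" by (rule incl_subgroup[OF L T(1)])
    have PLs: "subgroup P (G\<lparr>carrier := ?L\<rparr>)" and DLs: "subgroup D (G\<lparr>carrier := ?L\<rparr>)"
      using subgroup_incl[OF P(1) L PL] subgroup_incl[OF D(1) L] D(3) PL by blast+
    \<comment> \<open>The group \<open>?L\<close> has order 36, \<open>D\<close> is central in it
      and it has at least four Sylow 3-subgroups, so its Sylow 2-subgroup \<open>T\<close> is
      normal.\<close>
    have "?L \<subseteq> conj_stab G T"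
    proof
      fix x assume x: "x \<in> ?L"
      have "x \<otimes> t \<otimes> inv x \<in> T" if t: "t \<in> T" for t
      proof -
        have four: "4 \<le> card (rcosets\<^bsub>G\<lparr>carrier := ?L\<rparr>\<^esub> (conj_stab (G\<lparr>carrier := ?L\<rparr>) P))"
        proof (rule dvd_imp_le)
          show "4 dvd card (rcosets\<^bsub>G\<lparr>carrier := ?L\<rparr>\<^esub> (conj_stab (G\<lparr>carrier := ?L\<rparr>) P))"
            by (rule sylow3_pair_card_dvd(2)[OF fin nab P(1,2) R L PL RL])
          have "conj_stab (G\<lparr>carrier := ?L\<rparr>) P \<in> rcosets\<^bsub>G\<lparr>carrier := ?L\<rparr>\<^esub> (conj_stab (G\<lparr>carrier := ?L\<rparr>) P)"
            using subgroup.subgroup_in_rcosets[OF L.subgroup_conj_stab[OF finL subgroup.subset[OF PLs]] L.group_axioms] .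
          then show "0 < card (rcosets\<^bsub>G\<lparr>carrier := ?L\<rparr>\<^esub> (conj_stab (G\<lparr>carrier := ?L\<rparr>) P))"
            using finL by (auto simp: card_gt_0_iff RCOSETS_def)
        qed
        have "x \<otimes>\<^bsub>G\<lparr>carrier := ?L\<rparr>\<^esub> t \<otimes>\<^bsub>G\<lparr>carrier := ?L\<rparr>\<^esub> inv\<^bsub>G\<lparr>carrier := ?L\<rparr>\<^esub> x \<in> T"
        proof (rule L.sylow2_normal_order_36[OF o36 PLs _ four DLs cD3 D(3) _ T(1)])
          show "card P = 9" using P(2) b' by simp
          show "card T = 4" using T(2) by simp
          show "centralizer_of (G\<lparr>carrier := ?L\<rparr>) D = carrier (G\<lparr>carrier := ?L\<rparr>)"
            by (auto simp: centralizer_of_def)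
          show "x \<in> carrier (G\<lparr>carrier := ?L\<rparr>)" using x by simp
        qed (rule t)
        then show ?thesis using x L by simp
      qed
      then show "x \<in> conj_stab G T" using x by (simp add: conj_stab_def centralizer_of_def)
    qed
    have N: "subgroup (conj_stab G T) G" by (rule subgroup_conj_stab[OF fin subgroup.subset[OF TG]])
    \<comment> \<open>The normalizer of \<open>T\<close> has order divisible by 36, as it contains
      \<open>?L\<close>, and by 8, as \<open>T\<close> is not a full Sylow 2-subgroup and its
      normalizer grows. Hence 72 divides its order and its index is at most 4.\<close>
    have "card (rcosets T) * 4 = 288" using lagrange[OF TG] T(2) nab a5 b' by simp
    then have "2 dvd card (rcosets T)" by presburger
    then have d8: "2 ^ Suc 2 dvd card (conj_stab G T)" by (rule normalizer_grows[OF fin p2 TG T(2)])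
    have "36 dvd card (conj_stab G T)"
      using card_rcosets_mult_dvd(1)[OF L N \<open>?L \<subseteq> conj_stab G T\<close> fin] c36 by simp
    then have "9 dvd card (conj_stab G T)" by (rule dvd_trans[rotated]) simp
    moreover have "coprime (2 ^ Suc 2) (9::nat)" unfolding coprime_power_left_iff by simp
    ultimately have "2 ^ Suc 2 * 9 dvd card (conj_stab G T)" using d8 divides_mult by blast
    then obtain q where q: "card (conj_stab G T) = 2 ^ Suc 2 * 9 * q" by (rule dvdE)
    have "card (rcosets (conj_stab G T)) * (72 * q) = 288" using lagrange[OF N] q nab a5 b' by simp
    then have "card (rcosets (conj_stab G T)) \<le> 4" by (intro factor_le_4[of _ 72 q]) simp_all
    then have "conj_stab G T = carrier G" by (rule small_index[OF N])
    then have "T \<lhd> G" by (rule normal_of_conj_stab[OF TG])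
    then show False by (rule normal_primepow_trivial[OF _ p2 T(2)]) (simp add: T(2))
  qed
qed

section \<open>Relations characterizing PSL(2,7)\<close>

text \<open>The model on the projective line is \<open>p\<close>: x -> x + 1, \<open>h\<close>: x ->
  2x and \<open>u\<close>: x -> -1/x. The last relation holds because both sides send x to -x/(x -
  1).\<close>

locale psl_relations = group +
  fixes p h u
  assumes gens: "p \<in> carrier G" "h \<in> carrier G" "u \<in> carrier G"
    and p7: "p [^] (7::nat) = \<one>" and h3: "h [^] (3::nat) = \<one>" and u2: "u \<otimes> u = \<one>"
    and hp: "h \<otimes> p = p [^] (2::nat) \<otimes> h" and uh: "u \<otimes> h = h [^] (2::nat) \<otimes> u"
    and upu: "u \<otimes> p \<otimes> u = p [^] (6::nat) \<otimes> u \<otimes> p [^] (6::nat)"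
begin

definition borel :: "'a set" where
  "borel = (\<lambda>(i, j). p [^] i \<otimes> h [^] j) ` ({..<7::nat} \<times> {..<3::nat})"

text \<open>The Borel subgroup together with the big cell B u U: at most 21 + 21 * 7 = 168 elements.
  Closure under multiplication is all that is left to prove for the bound on the generated
  subgroup.\<close>

definition bruhat :: "'a set" where
  "bruhat = borel \<union> (\<lambda>(x, k). x \<otimes> u \<otimes> p [^] k) ` (borel \<times> {..<7::nat})"

lemma borelI: "p [^] (i::nat) \<otimes> h [^] (j::nat) \<in> borel"
proof -
  have "p [^] i \<otimes> h [^] j = p [^] (i mod 7) \<otimes> h [^] (j mod 3)"
    using nat_pow_mod_of_pow_one[OF gens(1) p7, of i] nat_pow_mod_of_pow_one[OF gens(2) h3, of j] by simp
  then show ?thesis by (auto simp: borel_def)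
qed

lemma borelE:
  assumes "x \<in> borel"
  obtains i j :: nat where "x = p [^] i \<otimes> h [^] j"
  using assms unfolding borel_def by auto

lemma bruhatI: "x \<in> borel \<Longrightarrow> x \<otimes> u \<otimes> p [^] (k::nat) \<in> bruhat"
  unfolding bruhat_def nat_pow_mod_of_pow_one[OF gens(1) p7, of k] by force

lemma borel_sub: "borel \<subseteq> carrier G"
  using gens by (auto simp: borel_def)

lemma bruhat_sub: "bruhat \<subseteq> carrier G"
  using gens borel_sub by (auto simp: bruhat_def)

lemma borel_le_bruhat: "borel \<subseteq> bruhat"
  by (simp add: bruhat_def)

lemma card_bruhat_le: "card bruhat \<le> 168"
proof -
  have fin: "finite borel" by (simp add: borel_def)
  have "card borel \<le> card ({..<7::nat} \<times> {..<3::nat})" unfolding borel_def by (rule card_image_le) simp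
  then have b: "card borel \<le> 21" by simp
  have "card ((\<lambda>(x, k). x \<otimes> u \<otimes> p [^] k) ` (borel \<times> {..<7::nat})) \<le> card (borel \<times> {..<7::nat})"
    by (rule card_image_le) (use fin in simp)
  also have "\<dots> = card borel * 7" by (simp add: card_cartesian_product)
  finally show ?thesis
    unfolding bruhat_def using b card_Un_le[of borel "(\<lambda>(x, k). x \<otimes> u \<otimes> p [^] k) ` (borel \<times> {..<7::nat})"]
    by linarith
qed

lemma h_p_pow: "h \<otimes> p [^] (k::nat) = p [^] (2 * k) \<otimes> h"
proof (induction k)
  case (Suc k)
  have "h \<otimes> p [^] Suc k = (h \<otimes> p [^] k) \<otimes> p" using gens by (simp add: m_assoc)
  also have "\<dots> = p [^] (2 * k) \<otimes> (h \<otimes> p)" using gens by (simp add: Suc m_assoc)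
  also have "\<dots> = p [^] (2 * k) \<otimes> p [^] (2::nat) \<otimes> h" using gens by (simp add: hp m_assoc)
  also have "\<dots> = p [^] (2 * Suc k) \<otimes> h" using gens by (simp add: nat_pow_mult)
  finally show ?case .
qed (use gens in simp)

lemma h_pow_p_pow: "h [^] (j::nat) \<otimes> p [^] (k::nat) = p [^] (2 ^ j * k) \<otimes> h [^] j"
proof (induction j arbitrary: k)
  case (Suc j)
  have "h [^] Suc j \<otimes> p [^] k = h [^] j \<otimes> (h \<otimes> p [^] k)" using gens by (simp add: m_assoc)
  also have "\<dots> = (h [^] j \<otimes> p [^] (2 * k)) \<otimes> h" using gens by (simp add: h_p_pow m_assoc)
  also have "\<dots> = p [^] (2 ^ j * (2 * k)) \<otimes> (h [^] j \<otimes> h)" using gens by (simp add: Suc m_assoc)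
  finally show ?case by (simp add: mult_ac)
qed (use gens in simp)

lemma borel_mult: "x \<in> borel \<Longrightarrow> y \<in> borel \<Longrightarrow> x \<otimes> y \<in> borel"
proof -
  assume "x \<in> borel" "y \<in> borel"
  then obtain i j k l :: nat where xy: "x = p [^] i \<otimes> h [^] j" "y = p [^] k \<otimes> h [^] l"
    by (metis borelE)
  have "x \<otimes> y = p [^] i \<otimes> (h [^] j \<otimes> p [^] k) \<otimes> h [^] l" using gens by (simp add: xy m_assoc)
  also have "\<dots> = p [^] i \<otimes> p [^] (2 ^ j * k) \<otimes> (h [^] j \<otimes> h [^] l)"
    using gens by (simp add: h_pow_p_pow m_assoc)
  also have "\<dots> = p [^] (i + 2 ^ j * k) \<otimes> h [^] (j + l)" using gens by (simp add: nat_pow_mult)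
  finally show ?thesis using borelI by simp
qed

lemma borel_bruhat_mult: "x \<in> borel \<Longrightarrow> y \<in> bruhat \<Longrightarrow> x \<otimes> y \<in> bruhat"
proof -
  assume x: "x \<in> borel" and y: "y \<in> bruhat"
  have xG: "x \<in> carrier G" using x borel_sub by blast
  from y consider "y \<in> borel" | z k where "z \<in> borel" "y = z \<otimes> u \<otimes> p [^] (k::nat)"
    unfolding bruhat_def by auto
  then show ?thesis
  proof cases
    case 1
    then show ?thesis using borel_mult[OF x] borel_le_bruhat by blast
  next
    case (2 z k)
    have "z \<in> carrier G" using 2(1) borel_sub by blast
    then have "x \<otimes> y = (x \<otimes> z) \<otimes> u \<otimes> p [^] k" using 2 xG gens by (simp add: m_assoc)
    then show ?thesis using bruhatI[OF borel_mult[OF x 2(1)]] by simp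
  qed
qed

lemma p_in: "p [^] (k::nat) \<in> borel" and h_in: "h [^] (k::nat) \<in> borel"
  using borelI[of k 0] borelI[of 0 k] gens by simp_all

lemma bruhat_mult_p: "y \<in> bruhat \<Longrightarrow> y \<otimes> p [^] (l::nat) \<in> bruhat"
proof -
  assume "y \<in> bruhat"
  then consider "y \<in> borel" | z k where "z \<in> borel" "y = z \<otimes> u \<otimes> p [^] (k::nat)"
    unfolding bruhat_def by auto
  then show ?thesis
  proof cases
    case 1
    then show ?thesis using borel_mult[OF 1 p_in] borel_le_bruhat by blast
  next
    case (2 z k)
    have "z \<in> carrier G" using 2(1) borel_sub by blast
    then have "y \<otimes> p [^] l = z \<otimes> u \<otimes> p [^] (k + l)" using 2 gens by (simp add: m_assoc nat_pow_mult)
    then show ?thesis using bruhatI[OF 2(1)] by simp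
  qed
qed

text \<open>4 is the inverse of 2 modulo 7, so moving \<open>h\<close> to the left multiplies the
  exponent by 4.\<close>

lemma p_pow_h: "p [^] (k::nat) \<otimes> h = h \<otimes> p [^] (4 * k)"
proof -
  have "p [^] (7 * k) = (p [^] (7::nat)) [^] k" using nat_pow_pow[OF gens(1)] by simp
  then have "p [^] (7 * k) = \<one>" using p7 by simp
  then have "p [^] (7 * k + k) = p [^] k" using nat_pow_mult[OF gens(1), of "7 * k" k] gens(1) by simp
  moreover have "2 * (4 * k) = 7 * k + k" by simp
  ultimately show ?thesis using h_p_pow[of "4 * k"] by (simp only:)
qed

lemma bruhat_mult_h: "y \<in> bruhat \<Longrightarrow> y \<otimes> h \<in> bruhat"
proof -
  assume "y \<in> bruhat"
  then consider "y \<in> borel" | z k where "z \<in> borel" "y = z \<otimes> u \<otimes> p [^] (k::nat)"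
    unfolding bruhat_def by auto
  then show ?thesis
  proof cases
    case 1
    then show ?thesis using borel_mult[OF 1 h_in[of 1]] borel_le_bruhat gens by auto
  next
    case (2 z k)
    have zG: "z \<in> carrier G" using 2(1) borel_sub by blast
    have "y \<otimes> h = z \<otimes> (u \<otimes> (p [^] k \<otimes> h))" using 2(2) zG gens by (simp add: m_assoc)
    also have "\<dots> = z \<otimes> ((u \<otimes> h) \<otimes> p [^] (4 * k))" using gens by (simp add: p_pow_h m_assoc)
    also have "\<dots> = (z \<otimes> h [^] (2::nat)) \<otimes> u \<otimes> p [^] (4 * k)" using gens zG by (simp add: uh m_assoc)
    finally show ?thesis using bruhatI[OF borel_mult[OF 2(1) h_in]] by simp
  qed
qed

text \<open>Conjugation by \<open>h\<close> doubles the exponent, and \<open>u\<close> carries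
  \<open>h\<close> to its square, so membership passes from k to 2k. The classes modulo 7 under
  doubling are {0}, {1, 2, 4} and {3, 5, 6}; the exponent 1 is the given relation, and 6 is obtained
  by inverting it.\<close>

lemma u_p_pow_u: "u \<otimes> p [^] (k::nat) \<otimes> u \<in> bruhat"
proof -
  let ?U = "\<lambda>k::nat. u \<otimes> p [^] k \<otimes> u \<in> bruhat"
  have modU: "?U k" if "?U l" "k mod 7 = l mod 7" for k l
    using that nat_pow_mod_of_pow_one[OF gens(1) p7, of k] nat_pow_mod_of_pow_one[OF gens(1) p7, of l] by simp
  have dbl: "?U (2 * k)" if k: "?U k" for k
  proof -
    have "h \<otimes> p [^] k \<otimes> h [^] (2::nat) = p [^] (2 * k) \<otimes> (h \<otimes> h [^] (2::nat))"
      using gens by (simp add: h_p_pow m_assoc)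
    also have "h \<otimes> h [^] (2::nat) = \<one>" using h3 gens by (simp add: numeral_eq_Suc m_assoc)
    finally have e: "p [^] (2 * k) = h \<otimes> p [^] k \<otimes> h [^] (2::nat)" using gens by simp
    have "u \<otimes> p [^] (2 * k) \<otimes> u = (u \<otimes> h) \<otimes> p [^] k \<otimes> (h [^] (2::nat) \<otimes> u)"
      using gens by (simp add: e m_assoc)
    also have "\<dots> = (h [^] (2::nat) \<otimes> u) \<otimes> p [^] k \<otimes> (u \<otimes> h)" by (simp only: uh)
    also have "\<dots> = h [^] (2::nat) \<otimes> (u \<otimes> p [^] k \<otimes> u) \<otimes> h" using gens by (simp add: m_assoc)
    finally show ?thesis
      using bruhat_mult_h[OF borel_bruhat_mult[OF h_in k, of 2]] by simp
  qed
  have U0: "?U 0"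
    using u2 gens borelI[of 0 0] borel_le_bruhat by auto
  have U1: "?U 1"
  proof -
    have "u \<otimes> p [^] (1::nat) \<otimes> u = p [^] (6::nat) \<otimes> u \<otimes> p [^] (6::nat)" using upu gens by simp
    then show ?thesis using bruhatI[OF p_in, of 6 6] by simp
  qed
  have U6: "?U 6"
  proof -
    have pp: "p \<otimes> p [^] (6::nat) = \<one>" "p [^] (6::nat) \<otimes> p = \<one>"
      using p7 gens nat_pow_Suc[of p 6] nat_pow_Suc2[of p 6] by simp_all
    have "(p \<otimes> u \<otimes> p) \<otimes> (u \<otimes> p \<otimes> u) = (p \<otimes> u \<otimes> p) \<otimes> (p [^] (6::nat) \<otimes> u \<otimes> p [^] (6::nat))"
      by (simp only: upu)
    also have "\<dots> = p \<otimes> (u \<otimes> ((p \<otimes> p [^] (6::nat)) \<otimes> (u \<otimes> p [^] (6::nat))))" using gens by (simp add: m_assoc)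
    also have "\<dots> = p \<otimes> ((u \<otimes> u) \<otimes> p [^] (6::nat))" using gens by (simp add: pp m_assoc)
    also have "\<dots> = \<one>" using gens by (simp add: u2 pp)
    finally have "p \<otimes> u \<otimes> p = inv (u \<otimes> p \<otimes> u)" using gens by (intro inv_equality[symmetric]) simp_all
    also have "\<dots> = u \<otimes> inv p \<otimes> u"
    proof -
      have "inv u = u" using u2 gens by (intro inv_equality) simp_all
      then show ?thesis using gens by (simp add: inv_mult_group m_assoc)
    qed
    also have "inv p = p [^] (6::nat)" using pp gens by (intro inv_equality) simp_all
    finally have "u \<otimes> p [^] (6::nat) \<otimes> u = p [^] (1::nat) \<otimes> u \<otimes> p [^] (1::nat)" using gens by simp
    then show ?thesis using bruhatI[OF p_in, of 1 1] by simp
  qed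
  have U2: "?U 2" using dbl[OF U1] by simp
  have U4: "?U 4" using dbl[OF U2] by simp
  have U5: "?U 5" by (rule modU[OF dbl[OF U6]]) simp
  have U3: "?U 3" by (rule modU[OF dbl[OF U5]]) simp
  have "k mod 7 < 7" by simp
  then consider "k mod 7 = 0" | "k mod 7 = 1" | "k mod 7 = 2" | "k mod 7 = 3" | "k mod 7 = 4"
    | "k mod 7 = 5" | "k mod 7 = 6" by linarith
  then show ?thesis
    by cases (auto intro: modU[OF U0] modU[OF U1] modU[OF U2] modU[OF U3] modU[OF U4] modU[OF U5] modU[OF U6])
qed

lemma bruhat_mult_u: "y \<in> bruhat \<Longrightarrow> y \<otimes> u \<in> bruhat"
proof -
  assume "y \<in> bruhat"
  then consider "y \<in> borel" | z k where "z \<in> borel" "y = z \<otimes> u \<otimes> p [^] (k::nat)"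
    unfolding bruhat_def by auto
  then show ?thesis
  proof cases
    case 1
    then have "y \<in> carrier G" using borel_sub by blast
    then show ?thesis using bruhatI[OF 1, of 0] gens by simp
  next
    case (2 z k)
    have "z \<in> carrier G" using 2(1) borel_sub by blast
    then have "y \<otimes> u = z \<otimes> (u \<otimes> p [^] k \<otimes> u)" using 2(2) gens by (simp add: m_assoc)
    then show ?thesis using borel_bruhat_mult[OF 2(1) u_p_pow_u] by simp
  qed
qed

lemma bruhat_mult: "x \<in> bruhat \<Longrightarrow> y \<in> bruhat \<Longrightarrow> x \<otimes> y \<in> bruhat"
proof -
  assume x: "x \<in> bruhat" and y: "y \<in> bruhat"
  have xG: "x \<in> carrier G" using x bruhat_sub by blast
  have h: "z \<otimes> h [^] (j::nat) \<in> bruhat" if z: "z \<in> bruhat" for z j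
  proof (induction j)
    case 0
    then show ?case using z bruhat_sub by auto
  next
    case (Suc j)
    have "z \<otimes> h [^] Suc j = (z \<otimes> h [^] j) \<otimes> h" using z bruhat_sub gens by (auto simp: m_assoc)
    then show ?case using bruhat_mult_h[OF Suc] by simp
  qed
  have b: "x \<otimes> z \<in> bruhat" if z: "z \<in> borel" for z
  proof -
    obtain i j :: nat where "z = p [^] i \<otimes> h [^] j" using z by (rule borelE)
    then have "x \<otimes> z = x \<otimes> p [^] i \<otimes> h [^] j" using xG gens by (simp add: m_assoc)
    then show ?thesis using h[OF bruhat_mult_p[OF x]] by simp
  qed
  from y consider "y \<in> borel" | z k where "z \<in> borel" "y = z \<otimes> u \<otimes> p [^] (k::nat)"
    unfolding bruhat_def by auto
  then show ?thesis
  proof cases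
    case (2 z k)
    have "z \<in> carrier G" using 2(1) borel_sub by blast
    then have "x \<otimes> y = x \<otimes> z \<otimes> u \<otimes> p [^] k" using 2(2) xG gens by (simp add: m_assoc)
    then show ?thesis using bruhat_mult_p[OF bruhat_mult_u[OF b[OF 2(1)]]] by simp
  qed (rule b)
qed

lemma gens_in_bruhat: "p \<in> bruhat" "h \<in> bruhat" "u \<in> bruhat" "\<one> \<in> bruhat"
  using p_in[of 1] h_in[of 1] bruhatI[OF borelI[of 0 0], of 0] borelI[of 0 0] gens borel_le_bruhat by auto

end

section \<open>From the relations to an isomorphism\<close>

lemma psl_relations_PSL2_7:
  "psl_relations PSL2_7 (mat2_pi (1, 1, 0, 1)) (mat2_pi (3, 0, 0, 5)) (mat2_pi (0, 6, 1, 0))"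
proof -
  interpret h: group_hom SL2_7 PSL2_7 mat2_pi
    by (intro group_hom.intro group_hom_axioms.intro SL.is_group PSL.is_group mat2_pi_hom)
  have c: "(1, 1, 0, 1) \<in> carrier SL2_7" "(3, 0, 0, 5) \<in> carrier SL2_7" "(0, 6, 1, 0) \<in> carrier SL2_7"
    by (simp_all add: carrier_SL2_7)
  have m1: "mat2_pi (6, 0, 0, 6) = \<one>\<^bsub>PSL2_7\<^esub>"
    unfolding one_PSL2_7 using mat2_pi_neg[OF one_mem_SL2_7(1)] by (simp add: mat2_mult_mod7_pair)
  have pw: "mat2_pi A [^]\<^bsub>PSL2_7\<^esub> (n::nat) = mat2_pi (A [^]\<^bsub>SL2_7\<^esub> n)" if "A \<in> carrier SL2_7" for A n
    using h.hom_nat_pow[OF that] by simp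
  note [simp] = c pw mat2_pi_mult carrier_SL2_7 mult_SL2_7 one_SL2_7 mat2_mult_mod7_pair
  have P: "(1, 1, 0, 1) [^]\<^bsub>SL2_7\<^esub> (2::nat) = (1, 2, 0, 1)" "(1, 1, 0, 1) [^]\<^bsub>SL2_7\<^esub> (6::nat) = (1, 6, 0, 1)"
    "(1, 1, 0, 1) [^]\<^bsub>SL2_7\<^esub> (7::nat) = (1, 0, 0, 1)" "(3, 0, 0, 5) [^]\<^bsub>SL2_7\<^esub> (2::nat) = (2, 0, 0, 4)"
    "(3, 0, 0, 5) [^]\<^bsub>SL2_7\<^esub> (3::nat) = (6, 0, 0, 6)"
    by (simp_all add: numeral_eq_Suc)
  show ?thesis
  proof (intro psl_relations.intro psl_relations_axioms.intro PSL.is_group)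
    \<comment> \<open>In SL(2,7) the two sides are (0, 2, 3, 0) and its negative; they agree only
      modulo the centre.\<close>
    show "mat2_pi (0, 6, 1, 0) \<otimes>\<^bsub>PSL2_7\<^esub> mat2_pi (3, 0, 0, 5)
        = mat2_pi (3, 0, 0, 5) [^]\<^bsub>PSL2_7\<^esub> (2::nat) \<otimes>\<^bsub>PSL2_7\<^esub> mat2_pi (0, 6, 1, 0)"
      using mat2_pi_neg[of "(0, 2, 3, 0)"] by (simp add: P)
  qed (simp_all add: P m1 one_PSL2_7[symmetric])
qed

lemma mat2_pi_swap_ne_one: "mat2_pi (0, 6, 1, 0) \<noteq> \<one>\<^bsub>PSL2_7\<^esub>"
  unfolding one_PSL2_7 by (simp add: mat2_pi_eq carrier_SL2_7 mat2_mult_mod7_pair doubleton_eq_iff)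

lemma (in psl_relations) psl_relations_DirProd:
  assumes "psl_relations H p' h' u'"
  shows "psl_relations (G \<times>\<times> H) (p, p') (h, h') (u, u')"
proof -
  interpret H: psl_relations H p' h' u' by (rule assms)
  have pw: "(a, b) [^]\<^bsub>G \<times>\<times> H\<^esub> (n::nat) = (a [^] n, b [^]\<^bsub>H\<^esub> n)" for a b n
    by (induction n) simp_all
  show ?thesis
    by (intro psl_relations.intro psl_relations_axioms.intro DirProd_group is_group H.is_group)
      (simp_all add: pw gens H.gens p7 H.p7 h3 H.h3 u2 H.u2 hp H.hp uh H.uh upu H.upu)
qed

text \<open>Elements of orders 7, 3 and 2 make the order of \<open>K\<close> a multiple of 42 =
  168/4, so the index is at most 4.\<close>

lemma (in simple_group_kappa) subgroup_order_168_eq: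
  assumes n: "order G = 168" and K: "subgroup K G"
    and p: "p \<in> K" "p [^] (7::nat) = \<one>" "p \<noteq> \<one>" and h: "h \<in> K" "h [^] (3::nat) = \<one>" "h \<noteq> \<one>"
    and u: "u \<in> K" "u \<otimes> u = \<one>" "u \<noteq> \<one>"
  shows "K = carrier G"
proof -
  have ord_dvd: "q dvd card K" if x: "x \<in> K" "x [^] q = \<one>" "x \<noteq> \<one>" "prime q" for x q
  proof -
    have xG: "x \<in> carrier G" using x(1) subgroup.mem_carrier[OF K] by blast
    have "ord x = q"
      using x(2,3,4) pow_eq_id[OF xG, of q] ord_eq_1[OF xG] by (auto simp: prime_nat_iff)
    moreover have "generate G {x} \<subseteq> K" using x by (intro generate_subgroup_incl[OF _ K]) simp
    ultimately show ?thesis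
      using card_Int_subgroup_dvd[OF fin K generate_is_subgroup[of "{x}"]] xG generate_pow_card[OF xG]
      by (simp add: Int_absorb1)
  qed
  have "u \<in> carrier G" using u(1) subgroup.mem_carrier[OF K] by blast
  then have u2: "u [^] (2::nat) = \<one>" using u(2) by (simp add: numeral_2_eq_2)
  have "7 dvd card K" by (rule ord_dvd[OF p]) simp
  moreover have "3 dvd card K" by (rule ord_dvd[OF h]) simp
  moreover have "2 dvd card K" by (rule ord_dvd[OF u(1) u2 u(3)]) simp
  moreover have "42 dvd k" if "7 dvd k" "3 dvd k" "2 dvd k" for k :: nat using that by presburger
  ultimately have "42 dvd card K" by blast
  then obtain m where "card K = 42 * m" by (rule dvdE)
  then have "card (rcosets K) * (42 * m) = 42 * 4" using lagrange[OF K] n by simp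
  then have "card (rcosets K) \<le> 4" by (rule factor_le_4) simp
  then show ?thesis by (rule small_index[OF K])
qed

text \<open>The subgroup of the product has at most 168 elements and projects onto G, which has 168;
  so the projection is injective and the subgroup is the graph of a map. This map is a homomorphism,
  nontrivial at \<open>u\<close>, hence injective by simplicity and bijective by
  cardinality.\<close>

lemma (in simple_group_kappa) iso_of_relations:
  assumes n: "order G = 168" and rel: "psl_relations G p h u" and ne: "p \<noteq> \<one>" "h \<noteq> \<one>" "u \<noteq> \<one>"
  shows "G \<cong> PSL2_7"
proof -
  interpret R: psl_relations G p h u by (rule rel)
  let ?p = "mat2_pi (1, 1, 0, 1)" and ?h = "mat2_pi (3, 0, 0, 5)" and ?u = "mat2_pi (0, 6, 1, 0)"
  let ?D = "G \<times>\<times> PSL2_7"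
  interpret D: psl_relations ?D "(p, ?p)" "(h, ?h)" "(u, ?u)"
    by (rule R.psl_relations_DirProd[OF psl_relations_PSL2_7])
  let ?S = "D.bruhat"
  have finS: "finite ?S" by (simp add: D.bruhat_def D.borel_def)
  have SD: "fst x \<in> carrier G" "snd x \<in> carrier PSL2_7" if "x \<in> ?S" for x
    using D.bruhat_sub that by (auto simp: DirProd_def)
  have multS: "(fst x \<otimes> fst y, snd x \<otimes>\<^bsub>PSL2_7\<^esub> snd y) \<in> ?S" if "x \<in> ?S" "y \<in> ?S" for x y
    using D.bruhat_mult[OF that] by (simp add: DirProd_def case_prod_beta)
  have gen: "(p, ?p) \<in> ?S" "(h, ?h) \<in> ?S" "(u, ?u) \<in> ?S" by (rule D.gens_in_bruhat)+
  have one: "(\<one>, \<one>\<^bsub>PSL2_7\<^esub>) \<in> ?S" using D.gens_in_bruhat(4) by simp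
  let ?K = "fst ` ?S"
  have K: "subgroup ?K G"
  proof (rule finite_mult_closed_subgroup[OF fin])
    show "?K \<subseteq> carrier G" using SD by blast
    show "\<one> \<in> ?K" using one by force
    fix x y assume "x \<in> ?K" "y \<in> ?K"
    then obtain v w where "v \<in> ?S" "w \<in> ?S" "x = fst v" "y = fst w" by blast
    then show "x \<otimes> y \<in> ?K" using multS[of v w] by force
  qed
  have "p \<in> ?K" "h \<in> ?K" "u \<in> ?K" using gen by force+
  then have KG: "?K = carrier G"
    by (rule subgroup_order_168_eq[OF n K _ R.p7 ne(1) _ R.h3 ne(2) _ R.u2 ne(3)])
  have inj: "inj_on fst ?S"
  proof (rule eq_card_imp_inj_on[OF finS])
    have "card ?K \<le> card ?S" by (rule card_image_le[OF finS])
    then show "card ?K = card ?S" using D.card_bruhat_le KG n by (simp add: order_def)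
  qed
  define \<phi> where "\<phi> g = snd (inv_into ?S fst g)" for g
  have \<phi>S: "(g, \<phi> g) \<in> ?S" if "g \<in> carrier G" for g
  proof -
    have g: "g \<in> fst ` ?S" using that KG by simp
    have "(fst (inv_into ?S fst g), snd (inv_into ?S fst g)) \<in> ?S" using inv_into_into[OF g] by simp
    then show ?thesis unfolding \<phi>_def f_inv_into_f[OF g] .
  qed
  have \<phi>I: "\<phi> g = y" if "(g, y) \<in> ?S" for g y
    using inv_into_f_f[OF inj that] by (simp add: \<phi>_def)
  have hom: "\<phi> \<in> hom G PSL2_7"
  proof (rule homI)
    show "\<phi> g \<in> carrier PSL2_7" if "g \<in> carrier G" for g using SD(2)[OF \<phi>S[OF that]] by simp
    show "\<phi> (g \<otimes> k) = \<phi> g \<otimes>\<^bsub>PSL2_7\<^esub> \<phi> k" if "g \<in> carrier G" "k \<in> carrier G" for g k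
      using multS[OF \<phi>S[OF that(1)] \<phi>S[OF that(2)]] by (intro \<phi>I) simp
  qed
  interpret \<phi>: group_hom G PSL2_7 \<phi>
    by (intro group_hom.intro group_hom_axioms.intro is_group PSL.is_group hom)
  have "kernel G PSL2_7 \<phi> \<noteq> carrier G"
  proof
    assume "kernel G PSL2_7 \<phi> = carrier G"
    then have "\<phi> u = \<one>\<^bsub>PSL2_7\<^esub>" using R.gens(3) by (auto simp: kernel_def)
    then show False using \<phi>I[OF gen(3)] mat2_pi_swap_ne_one by simp
  qed
  then have "kernel G PSL2_7 \<phi> = {\<one>}" using no_real_normal_subgroup[OF \<phi>.normal_kernel] by blast
  then have inj\<phi>: "inj_on \<phi> (carrier G)" by (rule \<phi>.trivial_ker_imp_inj)
  have "\<phi> ` carrier G = carrier PSL2_7"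
  proof (rule card_subset_eq[OF finite_PSL2_7])
    show "\<phi> ` carrier G \<subseteq> carrier PSL2_7" using \<phi>.hom_closed by blast
    show "card (\<phi> ` carrier G) = card (carrier PSL2_7)"
      using card_image[OF inj\<phi>] n carrier_PSL2_7_blocks(2) by (simp add: order_def)
  qed
  then have "\<phi> \<in> iso G PSL2_7" using hom inj\<phi> by (simp add: iso_def bij_betw_def)
  then show ?thesis by (rule is_isoI)
qed

section \<open>The action on eight points\<close>

text \<open>The action on the projective line over the field with seven elements; the point at infinity is 7.\<close>

locale projective_line_action = simple_group_kappa +
  fixes \<sigma> :: "'a \<Rightarrow> nat \<Rightarrow> nat" and p :: 'a
  assumes \<sigma>_lt: "\<And>g i. g \<in> carrier G \<Longrightarrow> i < 8 \<Longrightarrow> \<sigma> g i < 8"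
    and \<sigma>_mult: "\<And>g k i. g \<in> carrier G \<Longrightarrow> k \<in> carrier G \<Longrightarrow> i < 8 \<Longrightarrow> \<sigma> (g \<otimes> k) i = \<sigma> g (\<sigma> k i)"
    and \<sigma>_one: "\<And>i. i < 8 \<Longrightarrow> \<sigma> \<one> i = i"
    and \<sigma>_faithful: "\<And>g. g \<in> carrier G \<Longrightarrow> (\<And>i. i < 8 \<Longrightarrow> \<sigma> g i = i) \<Longrightarrow> g = \<one>"
    and \<sigma>_trans: "\<And>i. i < 8 \<Longrightarrow> \<exists>g\<in>carrier G. \<sigma> g 7 = i"
    and p: "p \<in> carrier G" "p [^] (7::nat) = \<one>"
    and \<sigma>_p: "\<sigma> p 7 = 7" "\<And>i. i < 7 \<Longrightarrow> \<sigma> p i = (i + 1) mod 7"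
    and \<sigma>_norm: "\<And>g. g \<in> carrier G \<Longrightarrow> \<sigma> g 7 = 7 \<Longrightarrow> \<exists>k::nat. g \<otimes> p = p [^] k \<otimes> g"

text \<open>The points are the eight cosets of the normalizer of a Sylow 7-subgroup
  \<open>P\<close>, generated by \<open>p\<close>. The coset fixed by \<open>P\<close> receives the
  label 7, and the translates of any other coset by the powers of \<open>p\<close> receive 0 to 6,
  so that \<open>p\<close> acts as x -> x + 1.\<close>

lemma (in simple_group_kappa) exists_projective_line_action:
  obtains \<sigma> p where "projective_line_action G \<sigma> p"
proof -
  obtain P where P: "subgroup P G" "card P = 7" "card (rcosets (conj_stab G P)) = 8"
    by (rule sylow_7[OF seven_dvd_order])
  let ?N = "conj_stab G P"
  have p7: "prime (7::nat)" by simp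
  have PG: "P \<subseteq> carrier G" by (rule subgroup.subset[OF P(1)])
  have N: "subgroup ?N G" by (rule subgroup_conj_stab[OF fin PG])
  have NG: "?N \<subseteq> carrier G" by (rule subgroup.subset[OF N])
  have PN: "P \<subseteq> ?N" by (rule subgroup_le_conj_stab[OF P(1)])
  have Nne: "?N \<noteq> carrier G"
  proof
    assume "?N = carrier G"
    then have "8 * order G = order G" using lagrange[OF N] P(3) by (simp add: order_def)
    then show False using order_gt_24 by simp
  qed
  have n7: "\<not> 7 dvd card (rcosets P)"
  proof
    assume "7 dvd card (rcosets P)"
    then have "7 * 7 dvd card (rcosets P) * card P" unfolding P(2) by (rule mult_dvd_mono) simp
    then have "7 * 7 dvd order G" unfolding lagrange[OF P(1)] .
    moreover have "order G dvd fact 8" using order_dvd_fact_index[OF fin N Nne] P(3) by simp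
    ultimately have "(7::nat) * 7 dvd fact 8" by (rule dvd_trans)
    then show False by (simp add: fact_numeral)
  qed
  have "\<exists>x\<in>P. x \<noteq> \<one>"
  proof (rule ccontr)
    assume "\<not> ?thesis"
    then have "P \<subseteq> {\<one>}" by blast
    then have "card P \<le> card {\<one>}" by (intro card_mono) simp_all
    then show False using P(2) by simp
  qed
  then obtain p where p: "p \<in> P" "p \<noteq> \<one>" by blast
  have pG: "p \<in> carrier G" using p(1) PG by blast
  have Pgen: "P = {p [^] k | k. k \<in> (UNIV :: nat set)}"
    by (rule generate_eq_prime_subgroup[OF fin P(1,2) p7 p])
  have p_powP: "p [^] (k::nat) \<in> P" for k
    by (subst Pgen) blast
  have p_pow7: "p [^] (7::nat) = \<one>"
  proof -
    interpret Q: group "G\<lparr>carrier := P\<rparr>" by (rule subgroup_imp_group[OF P(1)])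
    show ?thesis using Q.pow_order_eq_1[of p] p(1) P(2) by (simp add: order_def flip: nat_pow_consistent)
  qed
  have ordp: "ord p = 7"
    using p(2) pow_eq_id[OF pG, of 7] ord_eq_1[OF pG] p_pow7 p7 by (auto simp: prime_nat_iff)
  have "\<exists>b\<in>carrier G. ?N #> b \<noteq> ?N #> \<one>"
  proof (rule ccontr)
    assume no: "\<not> ?thesis"
    have "rcosets ?N \<subseteq> {?N #> \<one>}"
    proof
      fix R assume "R \<in> rcosets ?N"
      then obtain a where a: "a \<in> carrier G" "R = ?N #> a" unfolding RCOSETS_def by blast
      have "\<forall>b\<in>carrier G. ?N #> b = ?N #> \<one>" using no by (simp only: bex_simps not_not)
      then have "?N #> a = ?N #> \<one>" using a(1) by (rule bspec)
      then show "R \<in> {?N #> \<one>}" unfolding a(2) by (rule ssubst) (rule singletonI)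
    qed
    then have "card (rcosets ?N) \<le> card {?N #> \<one>}" by (intro card_mono) simp_all
    then show False using P(3) by simp
  qed
  then obtain b where b: "b \<in> carrier G" "?N #> b \<noteq> ?N #> \<one>" by blast
  have bN: "b \<notin> ?N" using b rcos_eq_iff[OF N b(1) one_closed] by simp
  \<comment> \<open>If a nontrivial power of \<open>p\<close> fixed the coset of \<open>b\<close>,
    the conjugate of \<open>P\<close> by \<open>b\<close> would lie in the normalizer of
    \<open>P\<close> and hence in \<open>P\<close>; then \<open>b\<close> would represent the
    trivial coset.\<close>
  have free: "b \<otimes> p [^] k \<otimes> inv b \<notin> ?N" if k: "\<not> 7 dvd k" for k :: nat
  proof
    assume y: "b \<otimes> p [^] k \<otimes> inv b \<in> ?N"
    let ?Q = "(\<lambda>x. b \<otimes> x \<otimes> inv b) ` P" and ?y = "b \<otimes> p [^] k \<otimes> inv b"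
    have Q: "subgroup ?Q G" "card ?Q = 7" using subgroup_conj_image[OF P(1) b(1)] P(2) by simp_all
    have yQ: "?y \<in> ?Q" using p_powP by (rule imageI)
    have "p [^] k \<noteq> \<one>" using k ordp pow_eq_id[OF pG, of k] by simp
    have "?y \<noteq> \<one>"
    proof
      assume "?y = \<one>"
      then have "b \<otimes> p [^] k \<otimes> inv b = b \<otimes> \<one> \<otimes> inv b" using b(1) by simp
      then have "p [^] k = \<one>" by (rule conjugation_is_inj[OF b(1), rotated -1]) (use pG in simp_all)
      then show False using \<open>p [^] k \<noteq> \<one>\<close> by contradiction
    qed
    then have Qy: "?Q = {?y [^] m | m. m \<in> (UNIV :: nat set)}"
      by (rule generate_eq_prime_subgroup[OF fin Q p7 yQ])
    have yN: "?y [^] m \<in> ?N" for m :: nat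
    proof (induction m)
      case 0
      then show ?case using subgroup.one_closed[OF N] by simp
    next
      case (Suc m)
      then show ?case using subgroup.m_closed[OF N Suc y] by simp
    qed
    have "?Q \<subseteq> ?N"
    proof
      fix z assume "z \<in> ?Q"
      then obtain m where "z = ?y [^] (m::nat)" using Qy by blast
      then show "z \<in> ?N" using yN by simp
    qed
    moreover have c7: "card ?Q = 7 ^ 1" using Q(2) by simp
    ultimately have QP: "?Q \<subseteq> P" by (rule normalizing_p_subgroup_le[OF fin p7 P(1) n7 Q(1), rotated])
    have "b \<otimes> x \<otimes> inv b \<in> P" if "x \<in> P" for x using QP that by blast
    then have "b \<in> ?N" using b(1) by (simp add: conj_stab_def)
    then show False using bN by simp
  qed
  interpret act: group_action G "rcosets ?N" "coset_act G ?N" by (rule group_action_coset_act[OF N])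
  let ?act = "coset_act G ?N"
  define pt where "pt i = (if i < 7 then ?act (p [^] i) (?N #> b) else ?N #> \<one>)" for i :: nat
  have X: "?N #> a \<in> rcosets ?N" if "a \<in> carrier G" for a using that NG by (intro rcosetsI)
  have pt_lt: "pt i = ?N #> (b \<otimes> inv (p [^] i))" if "i < 7" for i
    using that coset_act_rcos[OF N b(1)] pG by (simp add: pt_def)
  have ptX: "pt i \<in> rcosets ?N" for i
  proof (cases "i < 7")
    case True
    have "?N #> (b \<otimes> inv (p [^] i)) \<in> rcosets ?N" using b(1) pG by (intro X) simp
    then show ?thesis by (simp only: pt_lt[OF True])
  next
    case False
    then show ?thesis using X[OF one_closed] by (simp only: pt_def if_False)
  qed
  have ne: "pt i \<noteq> pt j" if ij: "i < j" "j < 8" for i j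
  proof
    assume eq: "pt i = pt j"
    have i7: "i < 7" using ij by simp
    show False
    proof (cases "j < 7")
      case True
      have c: "b \<otimes> inv (p [^] i) \<in> carrier G" "b \<otimes> inv (p [^] j) \<in> carrier G" using b(1) pG by simp_all
      have "(b \<otimes> inv (p [^] i)) \<otimes> inv (b \<otimes> inv (p [^] j)) \<in> ?N"
        using eq rcos_eq_iff[OF N c] pt_lt[OF i7] pt_lt[OF True] by simp
      also have "(b \<otimes> inv (p [^] i)) \<otimes> inv (b \<otimes> inv (p [^] j)) = b \<otimes> (inv (p [^] i) \<otimes> p [^] j) \<otimes> inv b"
        using b(1) pG by (simp add: inv_mult_group m_assoc)
      also have "inv (p [^] i) \<otimes> p [^] j = p [^] (j - i)"
      proof -
        have "p [^] j = p [^] i \<otimes> p [^] (j - i)" using pG ij by (simp add: nat_pow_mult)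
        then show ?thesis using pG by (simp flip: m_assoc)
      qed
      finally have "b \<otimes> p [^] (j - i) \<otimes> inv b \<in> ?N" .
      moreover have "\<not> 7 dvd j - i" using ij True by (auto dest: dvd_imp_le)
      ultimately show False using free by blast
    next
      case False
      have pi: "p [^] i \<in> ?N" using PN p_powP by (rule subsetD)
      have "b \<otimes> inv (p [^] i) \<in> ?N"
        using eq False pt_lt[OF i7] rcos_eq_iff[OF N _ one_closed, of "b \<otimes> inv (p [^] i)"] b(1) pG
        by (simp add: pt_def del: coset_mult_one)
      then have "b \<otimes> inv (p [^] i) \<otimes> p [^] i \<in> ?N" using pi by (rule subgroup.m_closed[OF N])
      then show False using bN b(1) pG by (simp add: m_assoc)
    qed
  qed
  have injpt: "inj_on pt {..<8}"
    by (rule linorder_inj_onI) (use ne in auto)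
  have "pt ` {..<8} = rcosets ?N"
  proof (rule card_subset_eq)
    show "finite (rcosets ?N)" using fin by (simp add: RCOSETS_def)
    show "pt ` {..<8} \<subseteq> rcosets ?N" using ptX by blast
    show "card (pt ` {..<8}) = card (rcosets ?N)" using card_image[OF injpt] P(3) by simp
  qed
  then have bij: "bij_betw pt {..<8} (rcosets ?N)" using injpt by (simp add: bij_betw_def)
  define \<sigma> where "\<sigma> g i = inv_into {..<8} pt (?act g (pt i))" for g i
  have actX: "?act g x \<in> rcosets ?N" if "g \<in> carrier G" "x \<in> rcosets ?N" for g x
    using act.element_image[OF that] by simp
  have \<sigma>_lt: "\<sigma> g i < 8" if "g \<in> carrier G" for g i
    using bij_betw_apply[OF bij_betw_inv_into[OF bij] actX[OF that ptX]] by (simp add: \<sigma>_def)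
  have pt_\<sigma>: "pt (\<sigma> g i) = ?act g (pt i)" if "g \<in> carrier G" for g i
    using bij_betw_inv_into_right[OF bij actX[OF that ptX]] by (simp add: \<sigma>_def)
  have \<sigma>_eq: "\<sigma> g i = j" if "?act g (pt i) = pt j" "j < 8" for g i j
    using that inv_into_f_f[OF injpt, of j] by (simp add: \<sigma>_def)
  have "projective_line_action G \<sigma> p"
  proof (intro projective_line_action.intro projective_line_action_axioms.intro)
    show "simple_group_kappa G" by (rule simple_group_kappa_axioms)
    show "\<sigma> g i < 8" if "g \<in> carrier G" "i < 8" for g i by (rule \<sigma>_lt[OF that(1)])
    show "\<sigma> (g \<otimes> k) i = \<sigma> g (\<sigma> k i)" if "g \<in> carrier G" "k \<in> carrier G" "i < 8" for g k i
    proof (rule \<sigma>_eq)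
      show "?act (g \<otimes> k) (pt i) = pt (\<sigma> g (\<sigma> k i))"
        using act.composition_rule[OF ptX that(1,2)] pt_\<sigma>[OF that(1)] pt_\<sigma>[OF that(2)] by simp
    qed (rule \<sigma>_lt[OF that(1)])
    show one: "\<sigma> \<one> i = i" if "i < 8" for i
    proof (rule \<sigma>_eq[OF _ that])
      show "?act \<one> (pt i) = pt i" using fun_cong[OF act.id_eq_one, of "pt i"] ptX[of i] by simp
    qed
    show "g = \<one>" if g: "g \<in> carrier G" "\<And>i. i < 8 \<Longrightarrow> \<sigma> g i = i" for g
    proof (rule coset_act_faithful[OF N Nne g(1)])
      fix R assume "R \<in> rcosets ?N"
      then obtain i where i: "i < 8" "R = pt i" using \<open>pt ` {..<8} = rcosets ?N\<close> by blast
      then show "?act g R = R" using pt_\<sigma>[OF g(1), of i] g(2)[OF i(1)] by simp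
    qed
    show "\<exists>g\<in>carrier G. \<sigma> g 7 = i" if i: "i < 8" for i
    proof -
      have "pt i \<in> rcosets ?N" by (rule ptX)
      then obtain a where a: "a \<in> carrier G" "pt i = ?N #> a" by (auto simp: RCOSETS_def)
      have "?act (inv a) (pt 7) = ?N #> (\<one> \<otimes> inv (inv a))"
        using coset_act_rcos[OF N one_closed, of "inv a"] a(1) by (simp add: pt_def del: coset_mult_one)
      then have "\<sigma> (inv a) 7 = i" using a i by (intro \<sigma>_eq) simp_all
      then show ?thesis using a(1) by (intro bexI[of _ "inv a"]) simp_all
    qed
    show "p \<in> carrier G" "p [^] (7::nat) = \<one>" by (rule pG p_pow7)+
    show "\<sigma> p 7 = 7"
    proof (rule \<sigma>_eq)
      show "?act p (pt 7) = pt 7"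
        using coset_act_fixed_iff[OF N one_closed pG] p(1) PN pG by (auto simp: pt_def simp del: coset_mult_one)
    qed simp
    show "\<sigma> p i = (i + 1) mod 7" if i: "i < 7" for i
    proof (rule \<sigma>_eq)
      have "?act p (pt i) = ?act (p [^] (i + 1)) (?N #> b)"
        using act.composition_rule[OF X[OF b(1)] pG, of "p [^] i"] pG i nat_pow_Suc2[OF pG, of i]
        by (simp add: pt_def del: nat_pow_Suc)
      also have "p [^] (i + 1) = p [^] ((i + 1) mod 7)" by (rule nat_pow_mod_of_pow_one[OF pG p_pow7])
      finally show "?act p (pt i) = pt ((i + 1) mod 7)" by (simp add: pt_def)
    qed (simp add: less_Suc_eq_le)
    \<comment> \<open>Fixing the point 7 means lying in the normalizer of \<open>P\<close>, whose
      elements are the powers of \<open>p\<close>.\<close>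
    show "\<exists>k::nat. g \<otimes> p = p [^] k \<otimes> g" if g: "g \<in> carrier G" "\<sigma> g 7 = 7" for g
    proof -
      have "?act g (?N #> \<one>) = ?N #> \<one>" using pt_\<sigma>[OF g(1), of 7] g(2) by (simp add: pt_def del: coset_mult_one)
      then have "g \<in> ?N" using coset_act_fixed_iff[OF N one_closed g(1)] g(1) by simp
      then have "g \<otimes> p \<otimes> inv g \<in> P" using p(1) by (simp add: conj_stab_def)
      then obtain k :: nat where "g \<otimes> p \<otimes> inv g = p [^] k" using Pgen by blast
      then have "g \<otimes> p \<otimes> inv g \<otimes> g = p [^] k \<otimes> g" by simp
      moreover have "g \<otimes> p \<otimes> inv g \<otimes> g = g \<otimes> p" using g(1) pG by (simp add: m_assoc)
      ultimately show ?thesis by (intro exI[of _ k]) simp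
    qed
  qed
  then show thesis by (rule that)
qed

section \<open>Stabilizers of one and of two points, and the order of the group\<close>

context projective_line_action
begin

lemma \<sigma>_eqI:
  assumes "g \<in> carrier G" "k \<in> carrier G" "\<And>i. i < 8 \<Longrightarrow> \<sigma> g i = \<sigma> k i"
  shows "g = k"
proof -
  have "inv k \<otimes> g = \<one>"
  proof (rule \<sigma>_faithful)
    show "inv k \<otimes> g \<in> carrier G" using assms by simp
    fix i :: nat assume i: "i < 8"
    have "\<sigma> (inv k \<otimes> g) i = \<sigma> (inv k) (\<sigma> k i)" using assms i by (simp add: \<sigma>_mult)
    also have "\<dots> = \<sigma> (inv k \<otimes> k) i" using assms(2) i by (simp only: \<sigma>_mult inv_closed)
    also have "\<dots> = i" using assms(2) i by (simp add: \<sigma>_one)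
    finally show "\<sigma> (inv k \<otimes> g) i = i" .
  qed
  then have "k \<otimes> (inv k \<otimes> g) = k" using assms by simp
  then show ?thesis using assms by (simp flip: m_assoc)
qed

lemma \<sigma>_inv: "g \<in> carrier G \<Longrightarrow> i < 8 \<Longrightarrow> \<sigma> (inv g) (\<sigma> g i) = i"
  using \<sigma>_mult[of "inv g" g i] \<sigma>_one[of i] by simp

lemma \<sigma>_inj:
  assumes "g \<in> carrier G" "i < 8" "j < 8" "\<sigma> g i = \<sigma> g j"
  shows "i = j"
proof -
  have "i = \<sigma> (inv g) (\<sigma> g i)" by (rule \<sigma>_inv[OF assms(1,2), symmetric])
  also have "\<dots> = j" unfolding assms(4) by (rule \<sigma>_inv[OF assms(1,3)])
  finally show ?thesis .
qed

lemma \<sigma>_p_pow: "i < 7 \<Longrightarrow> \<sigma> (p [^] (k::nat)) i = (i + k) mod 7" "\<sigma> (p [^] (k::nat)) 7 = 7"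
proof -
  show "\<sigma> (p [^] k) 7 = 7"
  proof (induction k)
    case 0
    then show ?case by (simp add: \<sigma>_one)
  next
    case (Suc k)
    then show ?case using p(1) by (simp add: \<sigma>_mult \<sigma>_p)
  qed
  show "\<sigma> (p [^] k) i = (i + k) mod 7" if "i < 7"
    using that
  proof (induction k arbitrary: i)
    case 0
    then show ?case by (simp add: \<sigma>_one)
  next
    case (Suc k)
    have "\<sigma> (p [^] Suc k) i = \<sigma> (p [^] k) ((i + 1) mod 7)"
      using p(1) Suc.prems by (simp add: \<sigma>_mult \<sigma>_p)
    also have "\<dots> = ((i + 1) mod 7 + k) mod 7" by (rule Suc.IH) simp
    also have "\<dots> = (i + Suc k) mod 7" by (simp add: mod_add_left_eq)
    finally show ?case .
  qed
qed

text \<open>After a group element has sent 7 to \<open>i\<close>, a power of \<open>p\<close> fixes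
  7 and moves 0 to any desired finite point.\<close>

lemma two_transitive:
  assumes "i < 8" "j < 8" "i \<noteq> j"
  obtains g where "g \<in> carrier G" "\<sigma> g 7 = i" "\<sigma> g 0 = j"
proof -
  obtain t where t: "t \<in> carrier G" "\<sigma> t 7 = i" using \<sigma>_trans[OF assms(1)] by blast
  let ?m = "\<sigma> (inv t) j"
  have m8: "?m < 8" using t(1) assms(2) by (intro \<sigma>_lt) simp_all
  have tm: "\<sigma> t ?m = j" using \<sigma>_inv[of "inv t" j] t(1) assms(2) by simp
  have "?m \<noteq> 7" using tm t(2) assms(3) by (intro notI) simp
  then have m7: "?m < 7" using m8 by simp
  show thesis
  proof (rule that)
    show "t \<otimes> p [^] ?m \<in> carrier G" using t(1) p(1) by simp
    show "\<sigma> (t \<otimes> p [^] ?m) 7 = i" using t p(1) by (simp add: \<sigma>_mult \<sigma>_p_pow)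
    show "\<sigma> (t \<otimes> p [^] ?m) 0 = j" using t(1) p(1) m7 tm by (simp add: \<sigma>_mult \<sigma>_p_pow)
  qed
qed

definition scales :: "'a \<Rightarrow> nat \<Rightarrow> bool" where
  "scales g k \<longleftrightarrow> g \<in> carrier G \<and> \<sigma> g 7 = 7 \<and> (\<forall>i<7. \<sigma> g i = (k * i) mod 7)"

definition torus :: "'a set" where
  "torus = {g \<in> carrier G. \<sigma> g 7 = 7 \<and> \<sigma> g 0 = 0}"

lemma scales_unique: "scales g k \<Longrightarrow> scales g' k \<Longrightarrow> g = g'"
proof (rule \<sigma>_eqI)
  fix i :: nat assume a: "scales g k" "scales g' k" "i < 8"
  show "\<sigma> g i = \<sigma> g' i" using a by (cases "i = 7") (simp_all add: scales_def)
qed (simp_all add: scales_def)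

lemma scales_one: "scales \<one> 1"
  by (simp add: scales_def \<sigma>_one)

lemma scales_mult:
  assumes "scales g k" "scales g' k'"
  shows "scales (g \<otimes> g') (k * k' mod 7)"
proof -
  have "\<sigma> (g \<otimes> g') i = (k * k' mod 7 * i) mod 7" if "i < 7" for i
  proof -
    have "\<sigma> (g \<otimes> g') i = (k * (k' * i mod 7)) mod 7"
      using assms that by (simp add: scales_def \<sigma>_mult)
    also have "\<dots> = (k * k' mod 7 * i) mod 7"
      by (simp add: mod_mult_right_eq mod_mult_left_eq mult.assoc)
    finally show ?thesis .
  qed
  then show ?thesis using assms by (simp add: scales_def \<sigma>_mult)
qed

text \<open>From \<open>g \<otimes> p = p [^] k0 \<otimes> g\<close> the action of \<open>g\<close>
  satisfies g(i + 1) = g(i) + k0. Starting at g(0) = 0 it is multiplication by k0, and injectivity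
  excludes k0 = 0 modulo 7.\<close>

lemma torus_scales:
  assumes g: "g \<in> torus"
  obtains k where "1 \<le> k" "k \<le> 6" "scales g k"
proof -
  have gG: "g \<in> carrier G" and g7: "\<sigma> g 7 = 7" and g0: "\<sigma> g 0 = 0" using g by (auto simp: torus_def)
  obtain k0 :: nat where k0: "g \<otimes> p = p [^] k0 \<otimes> g" using \<sigma>_norm[OF gG g7] by blast
  have lt7: "\<sigma> g i < 7" if "i < 7" for i
  proof -
    have "\<sigma> g i \<noteq> 7" using \<sigma>_inj[OF gG, of i 7] g7 that by auto
    then show ?thesis using \<sigma>_lt[OF gG, of i] that by simp
  qed
  have mul: "i < 7 \<Longrightarrow> \<sigma> g i = (k0 * i) mod 7" for i
  proof (induction i)
    case 0
    then show ?case using g0 by simp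
  next
    case (Suc i)
    have "\<sigma> g (Suc i) = \<sigma> g (\<sigma> p i)" using Suc.prems by (simp add: \<sigma>_p)
    also have "\<dots> = \<sigma> (g \<otimes> p) i" using gG p(1) Suc.prems by (simp add: \<sigma>_mult)
    also have "\<dots> = \<sigma> (p [^] k0) (\<sigma> g i)" unfolding k0 using gG p(1) Suc.prems by (simp add: \<sigma>_mult)
    also have "\<dots> = (\<sigma> g i + k0) mod 7" using lt7[of i] Suc.prems by (simp add: \<sigma>_p_pow)
    also have "\<dots> = (k0 * i mod 7 + k0) mod 7" using Suc by simp
    also have "\<dots> = (k0 * i + k0) mod 7" by (rule mod_add_left_eq)
    also have "\<dots> = (k0 * Suc i) mod 7" by (simp add: add.commute)
    finally show ?case .
  qed
  have "scales g (k0 mod 7)" using gG g7 mul by (simp add: scales_def mod_mult_left_eq)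
  moreover have "k0 mod 7 \<noteq> 0"
  proof
    assume "k0 mod 7 = 0"
    then have "\<sigma> g 1 = \<sigma> g 0" using mul[of 1] g0 by simp
    then show False using \<sigma>_inj[OF gG, of 1 0] by simp
  qed
  moreover have "k0 mod 7 < 7" by simp
  ultimately show thesis using that[of "k0 mod 7"] by simp
qed

lemma scales_torus: "scales g k \<Longrightarrow> g \<in> torus"
  by (simp add: scales_def torus_def)

lemma subgroup_torus: "subgroup torus G"
proof (rule finite_mult_closed_subgroup[OF fin])
  show "torus \<subseteq> carrier G" "\<one> \<in> torus" by (auto simp: torus_def \<sigma>_one)
  show "x \<otimes> y \<in> torus" if "x \<in> torus" "y \<in> torus" for x y
    using that by (simp add: torus_def \<sigma>_mult)
qed

text \<open>Multiplication by \<open>-1\<close> would be an odd permutation, and the even elements would form a normal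
  subgroup of index 2.\<close>

lemma not_scales_6: "\<not> scales s 6"
proof
  assume s: "scales s 6"
  define q where "q g = (\<lambda>x::nat. if x < 8 then \<sigma> g x else x)" for g
  have perm: "q g permutes {..<8}" if g: "g \<in> carrier G" for g
  proof (rule bij_imp_permutes)
    have "inj_on (\<sigma> g) {..<8}" using \<sigma>_inj[OF g] by (intro inj_onI) simp
    moreover have "\<sigma> g ` {..<8} \<subseteq> {..<8}" using \<sigma>_lt[OF g] by auto
    ultimately have "bij_betw (\<sigma> g) {..<8} {..<8}" by (simp add: bij_betw_def endo_inj_surj)
    moreover have "bij_betw (q g) {..<8} {..<8} \<longleftrightarrow> bij_betw (\<sigma> g) {..<8} {..<8}"
      by (rule bij_betw_cong) (simp add: q_def)
    ultimately show "bij_betw (q g) {..<8} {..<8}" by simp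
  qed (simp add: q_def)
  have pm: "permutation (q g)" if "g \<in> carrier G" for g
    using perm[OF that] permutation_permutes by blast
  have qm: "q (g \<otimes> k) = q g \<circ> q k" if "g \<in> carrier G" "k \<in> carrier G" for g k
    using that \<sigma>_lt by (auto simp: q_def \<sigma>_mult fun_eq_iff)
  have q1: "q \<one> = id" by (simp add: q_def \<sigma>_one fun_eq_iff)
  have sg: "sign (q (g \<otimes> k)) = sign (q g) * sign (q k)" if "g \<in> carrier G" "k \<in> carrier G" for g k
    using that pm by (simp add: qm sign_compose)
  let ?A = "{g \<in> carrier G. sign (q g) = 1}"
  have sgi: "sign (q g) * sign (q (inv g)) = 1" if "g \<in> carrier G" for g
    using sg[OF that inv_closed[OF that]] that by (simp add: q1)
  have "?A \<lhd> G"
  proof (rule normal_invI)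
    show "subgroup ?A G"
      by (rule finite_mult_closed_subgroup[OF fin]) (auto simp: sg q1)
    fix x h assume x: "x \<in> carrier G" and h: "h \<in> ?A"
    then have "sign (q (x \<otimes> h \<otimes> inv x)) = sign (q x) * sign (q (inv x))" by (simp add: sg)
    then show "x \<otimes> h \<otimes> inv x \<in> ?A" using x h sgi[OF x] by simp
  qed
  moreover have "?A \<noteq> carrier G"
  proof
    assume A: "?A = carrier G"
    have sG: "s \<in> carrier G" and sv: "\<sigma> s 7 = 7" "\<And>i. i < 7 \<Longrightarrow> \<sigma> s i = 6 * i mod 7" using s by (auto simp: scales_def)
    \<comment> \<open>Multiplication by -1 on the line is a product of three transpositions, hence
      odd.\<close>
    have "q s = transpose 1 6 \<circ> (transpose 2 5 \<circ> transpose 3 4)"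
    proof
      fix x :: nat
      consider "x = 0" | "x = 1" | "x = 2" | "x = 3" | "x = 4" | "x = 5" | "x = 6" | "x = 7" | "x > 7"
        by linarith
      then show "q s x = (transpose 1 6 \<circ> (transpose 2 5 \<circ> transpose 3 4)) x"
        by cases (simp_all add: q_def sv transpose_def)
    qed
    then have "sign (q s) = - 1" by (simp add: sign_compose sign_swap_id permutation_compose permutation_swap_id)
    moreover have "sign (q s) = 1" using A sG by blast
    ultimately show False by simp
  qed
  ultimately have A1: "?A = {\<one>}" using no_real_normal_subgroup by blast
  \<comment> \<open>A square is an even permutation, and this one is not the identity.\<close>
  have "p \<otimes> p \<in> ?A" using p(1) sg[OF p(1) p(1)] by simp
  then have "p \<otimes> p = \<one>" using A1 by blast
  then have "\<sigma> (p \<otimes> p) 0 = 0" by (simp add: \<sigma>_one)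
  then show False using p(1) by (simp add: \<sigma>_mult \<sigma>_p)
qed

lemma scales_cube: "scales g k \<Longrightarrow> scales (g \<otimes> (g \<otimes> g)) (k * (k * k mod 7) mod 7)"
  by (intro scales_mult)

text \<open>The cubes of 3 and 5 are 6 modulo 7, so these multipliers would produce -1. The squares
  1, 2, 4 remain.\<close>

lemma torus_cases:
  assumes "g \<in> torus"
  shows "g = \<one> \<or> scales g 2 \<or> scales g 4"
proof -
  obtain k where k: "1 \<le> k" "k \<le> 6" "scales g k" by (rule torus_scales[OF assms])
  then consider "k = 1" | "k = 2" | "k = 3" | "k = 4" | "k = 5" | "k = 6" by linarith
  then show ?thesis
  proof cases
    case 1
    then show ?thesis using scales_unique[OF _ scales_one] k(3) by simp
  next
    case 3
    then show ?thesis using scales_cube[OF k(3)] not_scales_6 by simp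
  next
    case 5
    then show ?thesis using scales_cube[OF k(3)] not_scales_6 by simp
  next
    case 6
    then show ?thesis using k(3) not_scales_6 by simp
  qed (use k(3) in simp_all)
qed

lemma torus_cube: "g \<in> torus \<Longrightarrow> g \<otimes> (g \<otimes> g) = \<one>"
proof -
  assume g: "g \<in> torus"
  then consider "g = \<one>" | k where "k = 2 \<or> k = 4" "scales g k" using torus_cases by blast
  then show ?thesis
  proof cases
    case (2 k)
    then have "scales (g \<otimes> (g \<otimes> g)) 1" using scales_cube[OF 2(2)] by auto
    then show ?thesis using scales_unique scales_one by blast
  qed simp
qed

text \<open>The coset of \<open>a\<close> modulo the torus is determined by the images of 7 and 0
  under the inverse of \<open>a\<close>. By double transitivity all 8 * 7 = 56 ordered pairs of
  distinct points occur.\<close>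

lemma order_eq: "order G = 56 * card torus"
proof -
  let ?f = "\<lambda>a. (\<sigma> (inv a) 7, \<sigma> (inv a) 0)"
  have same: "torus #> a = torus #> b \<longleftrightarrow> ?f a = ?f b" if ab: "a \<in> carrier G" "b \<in> carrier G" for a b
  proof -
    have key: "\<sigma> (a \<otimes> inv b) i = i \<longleftrightarrow> \<sigma> (inv a) i = \<sigma> (inv b) i" if i: "i < 8" for i
    proof
      assume "\<sigma> (a \<otimes> inv b) i = i"
      then have "\<sigma> a (\<sigma> (inv b) i) = i" using ab i by (simp add: \<sigma>_mult)
      then show "\<sigma> (inv a) i = \<sigma> (inv b) i" using \<sigma>_inv[OF ab(1), of "\<sigma> (inv b) i"] ab i \<sigma>_lt by simp
    next
      assume "\<sigma> (inv a) i = \<sigma> (inv b) i"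
      then show "\<sigma> (a \<otimes> inv b) i = i" using \<sigma>_inv[of "inv a" i] ab i by (simp add: \<sigma>_mult)
    qed
    have "torus #> a = torus #> b \<longleftrightarrow> a \<otimes> inv b \<in> torus" by (rule rcos_eq_iff[OF subgroup_torus ab])
    then show ?thesis using ab key[of 7] key[of 0] by (simp add: torus_def)
  qed
  have "rcosets torus = (\<lambda>a. torus #> a) ` carrier G" by (auto simp: RCOSETS_def)
  then have "card (rcosets torus) = card (?f ` carrier G)"
    using card_image_eq_if_same_fibers[of "carrier G" "\<lambda>a. torus #> a" ?f] same by simp
  also have "?f ` carrier G = (SIGMA i:{..<8}. {..<8} - {i})"
  proof
    show "?f ` carrier G \<subseteq> (SIGMA i:{..<8}. {..<8} - {i})"
    proof
      fix t assume "t \<in> ?f ` carrier G"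
      then obtain a where a: "a \<in> carrier G" "t = ?f a" by blast
      have "\<sigma> (inv a) 0 \<noteq> \<sigma> (inv a) 7" using \<sigma>_inj[of "inv a" 0 7] a(1) by auto
      then show "t \<in> (SIGMA i:{..<8}. {..<8} - {i})" using a \<sigma>_lt[of "inv a"] by simp
    qed
    show "(SIGMA i:{..<8}. {..<8} - {i}) \<subseteq> ?f ` carrier G"
    proof
      fix t :: "nat \<times> nat" assume "t \<in> (SIGMA i:{..<8}. {..<8} - {i})"
      then obtain i j where t: "t = (i, j)" "i < 8" "j < 8" "i \<noteq> j" by auto
      obtain g where g: "g \<in> carrier G" "\<sigma> g 7 = i" "\<sigma> g 0 = j" by (rule two_transitive[OF t(2-4)])
      then have "t = ?f (inv g)" using t(1) by simp
      then show "t \<in> ?f ` carrier G" using g(1) by (intro image_eqI[of _ _ "inv g"]) simp_all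
    qed
  qed
  also have "card (SIGMA i:{..<8::nat}. {..<8::nat} - {i}) = 56" by (subst card_SigmaI) simp_all
  finally show ?thesis using lagrange[OF subgroup_torus] by simp
qed

text \<open>With a trivial torus the order would be 56. The conjugates of the powers of
  \<open>p\<close> at the eight points give 48 distinct elements of order 7, so a Sylow 2-subgroup
  consists of everything else and is normal.\<close>

lemma torus_nontrivial: "torus \<noteq> {\<one>}"
proof
  assume "torus = {\<one>}"
  then have n: "order G = 2 ^ Suc 2 * 7" using order_eq by simp
  have p2: "prime (2::nat)" by simp
  obtain T where T: "subgroup T G" "card T = 2 ^ Suc 2" by (rule sylow_facts[OF p2 n]) auto
  have TG: "T \<subseteq> carrier G" by (rule subgroup.subset[OF T(1)])
  let ?E = "{g \<in> carrier G. g [^] (7::nat) = \<one>}"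
  obtain t where t: "\<And>i. i < 8 \<Longrightarrow> t i \<in> carrier G \<and> \<sigma> (t i) 7 = i"
    using \<sigma>_trans by metis
  let ?c = "\<lambda>(i, k). t i \<otimes> p [^] k \<otimes> inv (t i)"
  let ?I = "{..<8::nat} \<times> {1..6::nat}"
  have fixed: "j = i" if ik: "i < 8" "1 \<le> k" "k \<le> 6" "j < 8" "\<sigma> (t i \<otimes> p [^] k \<otimes> inv (t i)) j = j" for i and k :: nat and j
  proof -
    have ti: "t i \<in> carrier G" "\<sigma> (t i) 7 = i" using t[OF ik(1)] by simp_all
    let ?m = "\<sigma> (inv (t i)) j"
    have m8: "?m < 8" using ti(1) ik(4) by (intro \<sigma>_lt) simp_all
    have "\<sigma> (t i \<otimes> p [^] k \<otimes> inv (t i)) j = \<sigma> (t i \<otimes> p [^] k) ?m"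
      by (rule \<sigma>_mult) (use ti(1) p(1) ik(4) in simp_all)
    also have "\<dots> = \<sigma> (t i) (\<sigma> (p [^] k) ?m)" by (rule \<sigma>_mult) (use ti(1) p(1) m8 in simp_all)
    finally have "\<sigma> (t i) (\<sigma> (p [^] k) ?m) = j" using ik(5) by simp
    then have "\<sigma> (p [^] k) ?m = ?m" using \<sigma>_inv[OF ti(1), of "\<sigma> (p [^] k) ?m"] \<sigma>_lt[of "p [^] k" ?m] m8 p(1) by simp
    have "?m = 7"
    proof (rule ccontr)
      assume "?m \<noteq> 7"
      then have m7: "?m < 7" using m8 by simp
      then have "(?m + k) mod 7 = ?m" using \<open>\<sigma> (p [^] k) ?m = ?m\<close> by (simp add: \<sigma>_p_pow)
      moreover have "(n + k) mod 7 \<noteq> n" if "n < 7" for n :: nat using that ik(2,3) by presburger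
      ultimately show False using m7 by blast
    qed
    then show ?thesis using \<sigma>_inv[of "inv (t i)" j] ti ik(4) by simp
  qed
  have fix_i: "\<sigma> (t i \<otimes> p [^] k \<otimes> inv (t i)) i = i" if "i < 8" for i and k :: nat
  proof -
    have ti: "t i \<in> carrier G" "\<sigma> (t i) 7 = i" using t[OF that] by simp_all
    have "\<sigma> (inv (t i)) i = 7" using \<sigma>_inv[OF ti(1), of 7] ti(2) by simp
    then show ?thesis using ti p(1) that by (simp add: \<sigma>_mult \<sigma>_p_pow)
  qed
  have "inj_on ?c ?I"
  proof (rule inj_onI)
    fix x y assume xy: "x \<in> ?I" "y \<in> ?I" "?c x = ?c y"
    obtain i k i' k' :: nat where e: "x = (i, k)" "y = (i', k')" by (metis surj_pair)
    have r: "i < 8" "1 \<le> k" "k \<le> 6" "i' < 8" "1 \<le> k'" "k' \<le> 6" using xy(1,2) e by auto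
    have eq: "t i \<otimes> p [^] k \<otimes> inv (t i) = t i' \<otimes> p [^] k' \<otimes> inv (t i')" using xy(3) e by simp
    have "i = i'" using fixed[OF r(4-6) r(1)] fix_i[OF r(1), of k] eq by simp
    then have "p [^] k = p [^] k'"
      using eq conjugation_is_inj[of "t i" "p [^] k" "p [^] k'"] t[OF r(1)] p(1) by simp
    then have "\<sigma> (p [^] k) 0 = \<sigma> (p [^] k') 0" by simp
    then have "k = k'" using r by (simp add: \<sigma>_p_pow)
    then show "x = y" using e \<open>i = i'\<close> by simp
  qed
  moreover have "?c ` ?I \<subseteq> ?E - {\<one>}"
  proof
    fix y assume "y \<in> ?c ` ?I"
    then obtain i and k :: nat where ik: "i < 8" "1 \<le> k" "k \<le> 6" "y = t i \<otimes> p [^] k \<otimes> inv (t i)" by auto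
    have ti: "t i \<in> carrier G" using t[OF ik(1)] by simp
    have "p [^] (k * 7) = (p [^] (7::nat)) [^] k" using p(1) by (simp add: nat_pow_pow mult.commute)
    then have "y [^] (7::nat) = \<one>" unfolding ik(4) conj_nat_pow[OF ti nat_pow_closed[OF p(1)]] using p ti by (simp add: nat_pow_pow)
    moreover have "y \<noteq> \<one>"
    proof
      assume "y = \<one>"
      then have "\<sigma> y 0 = 0" "\<sigma> y 1 = 1" by (simp_all add: \<sigma>_one)
      then show False using fixed[OF ik(1-3), of 0] fixed[OF ik(1-3), of 1] ik(4) by simp
    qed
    moreover have "y \<in> carrier G" using ik(4) ti p(1) by simp
    ultimately show "y \<in> ?E - {\<one>}" by simp
  qed
  moreover have finE: "finite (?E - {\<one>})" using fin by simp
  ultimately have "card ?I \<le> card (?E - {\<one>})" by (rule card_inj_on_le)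
  then have E48: "48 \<le> card (?E - {\<one>})" by (simp add: card_cartesian_product)
  have TE: "x = \<one>" if x: "x \<in> T" "x [^] (7::nat) = \<one>" for x
  proof -
    have xG: "x \<in> carrier G" using x(1) TG by blast
    interpret T: group "G\<lparr>carrier := T\<rparr>" by (rule subgroup_imp_group[OF T(1)])
    have "x [^] (8::nat) = \<one>"
      using T.pow_order_eq_1[of x] x(1) T(2) by (simp add: order_def flip: nat_pow_consistent)
    then have "x [^] (7::nat) \<otimes> x = \<one>" using nat_pow_Suc[of x 7] by simp
    then show ?thesis using x(2) xG by simp
  qed
  have "card (?E - {\<one>} \<union> T) = card (?E - {\<one>}) + card T"
  proof (rule card_Un_disjoint)
    show "finite T" by (rule finite_subset[OF TG fin])
    show "(?E - {\<one>}) \<inter> T = {}" using TE by blast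
  qed (rule finE)
  then have "card (carrier G) \<le> card (?E - {\<one>} \<union> T)" using E48 T(2) n by (simp add: order_def)
  moreover have "?E - {\<one>} \<union> T \<subseteq> carrier G" using TG by blast
  ultimately have cover: "?E - {\<one>} \<union> T = carrier G" using fin by (intro card_seteq)
  have "T \<lhd> G"
  proof (rule normal_invI[OF T(1)])
    fix x h assume xh: "x \<in> carrier G" "h \<in> T"
    have hG: "h \<in> carrier G" using xh(2) TG by blast
    let ?y = "x \<otimes> h \<otimes> inv x"
    have "?y \<in> ?E - {\<one>} \<union> T" unfolding cover using xh(1) hG by simp
    moreover have "?y \<notin> ?E - {\<one>}"
    proof
      assume y: "?y \<in> ?E - {\<one>}"
      have "x \<otimes> h [^] (7::nat) \<otimes> inv x = x \<otimes> \<one> \<otimes> inv x" using y xh(1) conj_nat_pow[OF xh(1) hG, of 7] by simp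
      then have "h [^] (7::nat) = \<one>" using conjugation_is_inj[OF xh(1)] hG by simp
      then have "h = \<one>" using TE xh(2) by simp
      then show False using y xh(1) by simp
    qed
    ultimately show "?y \<in> T" by blast
  qed
  then show False by (rule normal_primepow_trivial[OF _ p2 T(2)]) (simp add: T(2))
qed

lemma exists_scales_2: obtains h where "scales h 2"
proof -
  have "\<one> \<in> torus" using subgroup.one_closed[OF subgroup_torus] .
  then obtain g where g: "g \<in> torus" "g \<noteq> \<one>" using torus_nontrivial by blast
  then consider "scales g 2" | "scales g 4" using torus_cases by blast
  then show thesis
  proof cases
    case 2
    then have "scales (g \<otimes> g) 2" using scales_mult[OF 2 2] by simp
    then show ?thesis by (rule that)
  qed (rule that)
qed

lemma torus_eq:
  assumes h: "scales h 2"
  shows "torus = {\<one>, h, h \<otimes> h}" "card torus = 3"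
proof -
  have h4: "scales (h \<otimes> h) 4" using scales_mult[OF h h] by simp
  show *: "torus = {\<one>, h, h \<otimes> h}"
  proof
    show "torus \<subseteq> {\<one>, h, h \<otimes> h}"
    proof
      fix g assume "g \<in> torus"
      then consider "g = \<one>" | "scales g 2" | "scales g 4" using torus_cases by blast
      then show "g \<in> {\<one>, h, h \<otimes> h}"
        by cases (use scales_unique[OF _ h] scales_unique[OF _ h4] in auto)
    qed
    show "{\<one>, h, h \<otimes> h} \<subseteq> torus"
      using scales_torus[OF scales_one] scales_torus[OF h] scales_torus[OF h4] by simp
  qed
  have "\<sigma> \<one> 1 = 1" "\<sigma> h 1 = 2" "\<sigma> (h \<otimes> h) 1 = 4"
    using scales_one h h4 by (simp_all add: scales_def)
  then have "\<one> \<noteq> h" "\<one> \<noteq> h \<otimes> h" "h \<noteq> h \<otimes> h" by force+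
  then show "card torus = 3" unfolding * by simp
qed

lemma order_168: "order G = 168"
  using order_eq torus_eq(2) exists_scales_2 by fastforce

text \<open>Double transitivity moves the two fixed points to 7 and 0, so \<open>g\<close> is
  conjugate to a torus element. Such elements have trivial cube, and x -> 2x and x -> 4x fix no
  third point.\<close>

lemma two_fixed_points:
  assumes g: "g \<in> carrier G" "i < 8" "j < 8" "i \<noteq> j" "\<sigma> g i = i" "\<sigma> g j = j"
  shows "g \<otimes> (g \<otimes> g) = \<one>" and "m < 8 \<Longrightarrow> m \<noteq> i \<Longrightarrow> m \<noteq> j \<Longrightarrow> \<sigma> g m = m \<Longrightarrow> g = \<one>"
proof -
  obtain t where t: "t \<in> carrier G" "\<sigma> t 7 = i" "\<sigma> t 0 = j" by (rule two_transitive[OF g(2-4)])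
  let ?x = "inv t \<otimes> g \<otimes> t"
  have xG: "?x \<in> carrier G" using t(1) g(1) by simp
  have x: "\<sigma> ?x k = \<sigma> (inv t) (\<sigma> g (\<sigma> t k))" if "k < 8" for k
    using t(1) g(1) that by (simp add: \<sigma>_mult \<sigma>_lt)
  have "\<sigma> ?x 7 = 7" "\<sigma> ?x 0 = 0"
    using x[of 7] x[of 0] t g(5,6) \<sigma>_inv[OF t(1), of 7] \<sigma>_inv[OF t(1), of 0] by simp_all
  then have xt: "?x \<in> torus" using xG by (simp add: torus_def)
  have c: "inv t \<otimes> (t \<otimes> z) = z" "t \<otimes> (inv t \<otimes> z) = z" if "z \<in> carrier G" for z
    using t(1) that by (simp_all flip: m_assoc)
  have gx: "g = t \<otimes> ?x \<otimes> inv t" using t(1) g(1) by (simp add: m_assoc c)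
  have "g \<otimes> (g \<otimes> g) = t \<otimes> (?x \<otimes> (?x \<otimes> ?x)) \<otimes> inv t" using t(1) g(1) by (simp add: m_assoc c)
  then show "g \<otimes> (g \<otimes> g) = \<one>" using torus_cube[OF xt] t(1) by simp
  show "g = \<one>" if m: "m < 8" "m \<noteq> i" "m \<noteq> j" "\<sigma> g m = m"
  proof -
    let ?m = "\<sigma> (inv t) m"
    have m8: "?m < 8" using t(1) m(1) by (intro \<sigma>_lt) simp_all
    have tm: "\<sigma> t ?m = m" using \<sigma>_inv[of "inv t" m] t(1) m(1) by simp
    have "?m \<noteq> 7"
    proof
      assume "?m = 7"
      then show False using tm t(2) m(2) by simp
    qed
    moreover have "?m \<noteq> 0"
    proof
      assume "?m = 0"
      then show False using tm t(3) m(3) by simp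
    qed
    ultimately have m7: "?m < 7" "1 \<le> ?m" using m8 by simp_all
    have xm: "\<sigma> ?x ?m = ?m" using x[OF m8] tm m(4) by simp
    have "\<not> scales ?x k" if "k = 2 \<or> k = 4" for k
    proof
      assume "scales ?x k"
      then have "(k * ?m) mod 7 = ?m" using xm m7(1) by (simp add: scales_def)
      moreover have "2 * n mod 7 \<noteq> n" "4 * n mod 7 \<noteq> n" if "n < 7" "1 \<le> n" for n :: nat
        using that by presburger+
      ultimately show False using m7 that by blast
    qed
    then have "?x = \<one>" using torus_cases[OF xt] by blast
    then show "g = \<one>" using gx t(1) by simp
  qed
qed

end

section \<open>Recovering the relations\<close>

text \<open>The translation x -> x + k with 7 as the point at infinity, in executable form;
  \<open>7 - k\<close> plays the role of -k.\<close>

definition line_shift :: "nat \<Rightarrow> nat \<Rightarrow> nat" where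
  "line_shift k x = (if x = 7 then 7 else (x + k) mod 7)"

text \<open>The two exceptional involutions below occur in the affine semilinear group over the field with
  eight elements, which also has order 168: there the translates of \<open>w\<close> form a normal subgroup.\<close>

definition translates_closed :: "nat list \<Rightarrow> bool" where
  "translates_closed W \<longleftrightarrow> list_all (\<lambda>i. list_all (\<lambda>j. i = j \<or> list_ex (\<lambda>k. list_all (\<lambda>x.
     line_shift i (W ! line_shift (7 - i) (line_shift j (W ! line_shift (7 - j) x)))
       = line_shift k (W ! line_shift (7 - k) x)) [0,1,2,3,4,5,6,7]) [0,1,2,3,4,5,6]) [0,1,2,3,4,5,6]) [0,1,2,3,4,5,6]"

lemma translates_closed_3: "translates_closed [7, 3, 6, 1, 5, 4, 2, 0]"
  by code_simp

lemma translates_closed_5: "translates_closed [7, 5, 3, 2, 6, 1, 4, 0]"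
  by code_simp

lemma less_8_cases:
  assumes "(i::nat) < 8"
  obtains "i = 0" | "i = 1" | "i = 2" | "i = 3" | "i = 4" | "i = 5" | "i = 6" | "i = 7"
  using assms by linarith

section \<open>Identifying the involution that exchanges zero and infinity\<close>

context projective_line_action
begin

lemma \<sigma>_p_pow_shift: "x < 8 \<Longrightarrow> \<sigma> (p [^] (k::nat)) x = line_shift k x"
  by (cases "x = 7") (simp_all add: line_shift_def \<sigma>_p_pow)

lemma line_shift_lt: "x < 8 \<Longrightarrow> line_shift k x < 8"
  using mod_less_divisor[of 7 "x + k"] by (auto simp: line_shift_def)

text \<open>If \<open>g\<close> exchanges 7 and 0, its square lies in the torus and has trivial
  cube, so the cube of \<open>g\<close> is an involution that still exchanges the two points. It
  normalizes the torus of order 3, so it centralizes or inverts \<open>h\<close>.\<close>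

lemma involution_swap:
  assumes h: "scales h 2"
  obtains w where "w \<in> carrier G" "w \<otimes> w = \<one>" "\<sigma> w 7 = 0" "\<sigma> w 0 = 7"
    "w \<otimes> h = h \<otimes> w \<or> w \<otimes> h = (h \<otimes> h) \<otimes> w"
proof -
  have hG: "h \<in> carrier G" using h by (simp add: scales_def)
  have h0: "\<sigma> h 7 = 7" "\<sigma> h 0 = 0" using h by (simp_all add: scales_def)
  obtain g where g: "g \<in> carrier G" "\<sigma> g 7 = 0" "\<sigma> g 0 = 7"
    by (rule two_transitive[of 0 7]) simp_all
  have "g \<otimes> g \<in> torus" using g by (simp add: torus_def \<sigma>_mult)
  then have g6: "(g \<otimes> g) \<otimes> ((g \<otimes> g) \<otimes> (g \<otimes> g)) = \<one>" by (rule torus_cube)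
  define w where "w = g \<otimes> (g \<otimes> g)"
  have w: "w \<in> carrier G" "w \<otimes> w = \<one>" "\<sigma> w 7 = 0" "\<sigma> w 0 = 7"
    using g g6 by (simp_all add: w_def \<sigma>_mult m_assoc)
  have "w \<otimes> h \<otimes> w \<in> torus" using w hG h0 by (simp add: torus_def \<sigma>_mult)
  then consider "w \<otimes> h \<otimes> w = \<one>" | "w \<otimes> h \<otimes> w = h" | "w \<otimes> h \<otimes> w = h \<otimes> h"
    using torus_eq(1)[OF h] by blast
  moreover have wh: "w \<otimes> h \<otimes> w \<otimes> w = w \<otimes> h" using w hG by (simp add: m_assoc)
  moreover have "w \<otimes> h \<otimes> w \<noteq> \<one>"
  proof
    assume "w \<otimes> h \<otimes> w = \<one>"
    then have "w \<otimes> h = w" using wh w by simp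
    then have "h = \<one>" using w(1) hG by (metis l_cancel_one')
    then have "\<sigma> h 1 = 1" by (simp add: \<sigma>_one)
    then show False using h by (simp add: scales_def)
  qed
  ultimately have "w \<otimes> h = h \<otimes> w \<or> w \<otimes> h = (h \<otimes> h) \<otimes> w" by metis
  then show thesis using that w by blast
qed

text \<open>Closure would make the identity and the conjugates of \<open>w\<close> by powers of
  \<open>p\<close> a subgroup of at most eight elements. It is normalized by \<open>p\<close>, by
  \<open>h\<close> (which commutes with \<open>w\<close> and doubles the exponent) and by
  \<open>w\<close>. Its normalizer is therefore everything, against simplicity.\<close>

lemma not_translates_closed:
  assumes h: "scales h 2" and w: "w \<in> carrier G" "w \<otimes> w = \<one>" "w \<otimes> h = h \<otimes> w"
    and W: "\<And>x. x < 8 \<Longrightarrow> \<sigma> w x = W ! x" "W ! 0 = 7"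
  shows "\<not> translates_closed W"
proof
  assume closed: "translates_closed W"
  have hG: "h \<in> carrier G" using h by (simp add: scales_def)
  define v where "v i = p [^] i \<otimes> w \<otimes> inv (p [^] i)" for i :: nat
  have vG: "v i \<in> carrier G" for i using w(1) p(1) by (simp add: v_def)
  have v_mod: "v i = v (i mod 7)" for i
    unfolding v_def using nat_pow_mod_of_pow_one[OF p(1,2), of i] by simp
  have inv_pow: "inv (p [^] i) = p [^] (7 - i)" if "i < 7" for i :: nat
  proof (rule inv_equality)
    show "p [^] (7 - i) \<otimes> p [^] i = \<one>" using that p by (simp add: nat_pow_mult)
  qed (use p(1) in simp_all)
  have Wlt: "W ! x < 8" if "x < 8" for x using \<sigma>_lt[OF w(1) that] W(1)[OF that] by simp
  have \<sigma>v: "\<sigma> (v i) x = line_shift i (W ! line_shift (7 - i) x)" if "i < 7" "x < 8" for i x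
  proof -
    have "\<sigma> (v i) x = \<sigma> (p [^] i \<otimes> w) (\<sigma> (p [^] (7 - i)) x)"
      unfolding v_def inv_pow[OF that(1)] using w(1) p(1) that(2) by (intro \<sigma>_mult) simp_all
    also have "\<dots> = \<sigma> (p [^] i \<otimes> w) (line_shift (7 - i) x)" using that(2) by (simp add: \<sigma>_p_pow_shift)
    also have "\<dots> = \<sigma> (p [^] i) (\<sigma> w (line_shift (7 - i) x))"
      using w(1) p(1) line_shift_lt[OF that(2)] by (intro \<sigma>_mult) simp_all
    also have "\<dots> = line_shift i (W ! line_shift (7 - i) x)"
      using W(1) Wlt line_shift_lt[OF that(2)] by (simp add: \<sigma>_p_pow_shift)
    finally show ?thesis .
  qed
  let ?V = "insert \<one> (v ` {..<7})"
  have vV: "v i \<in> ?V" for i unfolding v_mod[of i] by simp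
  have vv: "v i \<otimes> v i = \<one>" for i
  proof -
    have "inv (p [^] i) \<otimes> (p [^] i \<otimes> z) = z" "w \<otimes> (w \<otimes> z) = z" if "z \<in> carrier G" for z
      using p(1) w(1,2) that by (simp_all flip: m_assoc)
    then show ?thesis using w(1) p(1) by (simp add: v_def m_assoc)
  qed
  have vprod: "v i \<otimes> v j \<in> ?V" if ij: "i < 7" "j < 7" for i j
  proof (cases "i = j")
    case True
    then show ?thesis using vv by simp
  next
    case False
    have mem7: "k \<in> set [0,1,2,3,4,5,6]" if "k < 7" for k :: nat using that by auto
    have mem8: "k \<in> set [0,1,2,3,4,5,6,7]" if "k < 8" for k :: nat using that by auto
    obtain k where k: "k \<in> set [0,1,2,3,4,5,6]" "\<forall>x\<in>set [0,1,2,3,4,5,6,7].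
       line_shift i (W ! line_shift (7 - i) (line_shift j (W ! line_shift (7 - j) x)))
         = line_shift k (W ! line_shift (7 - k) x)"
      using closed mem7[OF ij(1)] mem7[OF ij(2)] False
      unfolding translates_closed_def list_all_iff list_ex_iff by blast
    have k7: "k < 7" using k(1) by auto
    have "v i \<otimes> v j = v k"
    proof (rule \<sigma>_eqI)
      fix x :: nat assume x: "x < 8"
      have "\<sigma> (v j) x < 8" by (rule \<sigma>_lt[OF vG x])
      then have "\<sigma> (v i \<otimes> v j) x = line_shift i (W ! line_shift (7 - i) (\<sigma> (v j) x))"
        using \<sigma>_mult[OF vG vG x] \<sigma>v[OF ij(1)] by simp
      also have "\<dots> = \<sigma> (v k) x" unfolding \<sigma>v[OF ij(2) x] \<sigma>v[OF k7 x] using k(2) mem8[OF x] by (rule bspec)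
      finally show "\<sigma> (v i \<otimes> v j) x = \<sigma> (v k) x" .
    qed (use vG in simp_all)
    then show ?thesis using vV[of k] by simp
  qed
  have VG: "?V \<subseteq> carrier G" using vG by auto
  have V: "subgroup ?V G"
  proof (rule finite_mult_closed_subgroup[OF fin VG])
    fix x y assume xy: "x \<in> ?V" "y \<in> ?V"
    show "x \<otimes> y \<in> ?V"
    proof (cases "x = \<one> \<or> y = \<one>")
      case True
      then show ?thesis using xy VG by (metis l_one r_one subsetD)
    next
      case False
      then obtain i j where "i < 7" "j < 7" "x = v i" "y = v j" using xy by blast
      then show ?thesis using vprod by simp
    qed
  qed simp
  have stabI: "g \<in> conj_stab G ?V" if g: "g \<in> carrier G" "\<And>i. g \<otimes> v i \<otimes> inv g \<in> ?V" for g
    using g by (simp add: conj_stab_def)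
  have pst: "p \<in> conj_stab G ?V"
  proof (rule stabI[OF p(1)])
    fix i
    have "p \<otimes> v i \<otimes> inv p = v (Suc i)"
      unfolding v_def nat_pow_Suc2[OF p(1)] using p(1) w(1) by (simp add: m_assoc inv_mult_group)
    then show "p \<otimes> v i \<otimes> inv p \<in> ?V" using vV by simp
  qed
  have hp: "h \<otimes> p [^] i = p [^] (2 * i) \<otimes> h" for i :: nat
  proof (rule \<sigma>_eqI)
    fix x :: nat assume x: "x < 8"
    have hs: "\<sigma> h y = (if y = 7 then 7 else 2 * y mod 7)" if "y < 8" for y using h that by (auto simp: scales_def)
    have "\<sigma> (h \<otimes> p [^] i) x = \<sigma> h (line_shift i x)" using hG p(1) x by (simp add: \<sigma>_mult \<sigma>_p_pow_shift)
    also have "\<dots> = line_shift (2 * i) (\<sigma> h x)"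
    proof (cases "x = 7")
      case False
      have lt: "(x + i) mod 7 < 7" "2 * x mod 7 < 7" by simp_all
      then have ne: "(x + i) mod 7 \<noteq> 7" "2 * x mod 7 \<noteq> 7" by linarith+
      have lt8: "(x + i) mod 7 < 8" using lt(1) by linarith
      have "\<sigma> h (line_shift i x) = 2 * ((x + i) mod 7) mod 7" using False ne(1) hs[OF lt8] by (simp add: line_shift_def)
      also have "\<dots> = (2 * x + 2 * i) mod 7" by (simp add: mod_mult_right_eq add_mult_distrib2)
      also have "\<dots> = line_shift (2 * i) (\<sigma> h x)"
        using False ne(2) hs[OF x] by (simp add: line_shift_def mod_add_left_eq)
      finally show ?thesis .
    qed (simp add: line_shift_def hs)
    also have "\<dots> = \<sigma> (p [^] (2 * i) \<otimes> h) x" using hG p(1) x \<sigma>_lt[OF hG x] by (simp add: \<sigma>_mult \<sigma>_p_pow_shift)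
    finally show "\<sigma> (h \<otimes> p [^] i) x = \<sigma> (p [^] (2 * i) \<otimes> h) x" .
  qed (use hG p(1) in simp_all)
  have hst: "h \<in> conj_stab G ?V"
  proof (rule stabI[OF hG])
    fix i
    have "h \<otimes> v i \<otimes> inv h = (h \<otimes> p [^] i) \<otimes> w \<otimes> inv (h \<otimes> p [^] i)"
      using hG p(1) w(1) by (simp add: v_def m_assoc inv_mult_group)
    also have "\<dots> = p [^] (2 * i) \<otimes> (h \<otimes> w \<otimes> inv h) \<otimes> inv (p [^] (2 * i))"
      unfolding hp using hG p(1) w(1) by (simp add: m_assoc inv_mult_group)
    also have "h \<otimes> w \<otimes> inv h = w" unfolding w(3)[symmetric] using hG w(1) by (simp add: m_assoc)
    finally have "h \<otimes> v i \<otimes> inv h = v (2 * i)" by (simp add: v_def)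
    then show "h \<otimes> v i \<otimes> inv h \<in> ?V" using vV by simp
  qed
  have wV: "w \<in> ?V" using vV[of 0] w(1) by (simp add: v_def)
  have wst: "w \<in> conj_stab G ?V" using subgroup_le_conj_stab[OF V] wV by blast
  have ne: "p \<noteq> \<one>" "h \<noteq> \<one>" "w \<noteq> \<one>"
  proof -
    have "\<sigma> p 0 \<noteq> 0" "\<sigma> h 1 \<noteq> 1" "\<sigma> w 0 \<noteq> 0" using \<sigma>_p h W by (simp_all add: scales_def)
    then show "p \<noteq> \<one>" "h \<noteq> \<one>" "w \<noteq> \<one>" using \<sigma>_one by auto
  qed
  have h3: "h [^] (3::nat) = \<one>"
    using torus_cube[OF scales_torus[OF h]] hG by (simp add: numeral_eq_Suc m_assoc)
  have "conj_stab G ?V = carrier G"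
    by (rule subgroup_order_168_eq[OF order_168 subgroup_conj_stab[OF fin VG] pst p(2) ne(1) hst h3 ne(2) wst w(2) ne(3)])
  then have "?V \<lhd> G" by (rule normal_of_conj_stab[OF V])
  then have "?V = carrier G \<or> ?V = {\<one>}" by (rule no_real_normal_subgroup)
  moreover have "card ?V \<le> Suc (card (v ` {..<7}))" by (rule card_insert_le_m1) simp_all
  moreover have "card (v ` {..<7}) \<le> 7" using card_image_le[of "{..<7}" v] by simp
  ultimately show False using order_168 wV ne(3) by (auto simp: order_def)
qed

text \<open>The involution \<open>w\<close> exchanging 0 and infinity either commutes with
  \<open>h\<close> or inverts it. When it commutes, its value at 1 determines its values at 2 and 4,
  and each of the six possibilities is contradictory. When it inverts \<open>h\<close>, a product of
  \<open>w\<close> with a power of \<open>h\<close> is x -> -1/x, which yields the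
  relations.\<close>

lemma iso_PSL2_7: "G \<cong> PSL2_7"
proof -
  obtain h where h: "scales h 2" by (rule exists_scales_2)
  have hG: "h \<in> carrier G" using h by (simp add: scales_def)
  have hs: "\<sigma> h 7 = 7" "\<sigma> h 0 = 0" "\<sigma> h 1 = 2" "\<sigma> h 2 = 4" "\<sigma> h 3 = 6" "\<sigma> h 4 = 1" "\<sigma> h 5 = 3" "\<sigma> h 6 = 5"
    using h by (simp_all add: scales_def)
  have h3: "h \<otimes> (h \<otimes> h) = \<one>" by (rule torus_cube[OF scales_torus[OF h]])
  obtain w where w: "w \<in> carrier G" "w \<otimes> w = \<one>" "\<sigma> w 7 = 0" "\<sigma> w 0 = 7"
    and wh: "w \<otimes> h = h \<otimes> w \<or> w \<otimes> h = (h \<otimes> h) \<otimes> w"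
    by (rule involution_swap[OF h])
  have inner: "\<sigma> g x \<in> {1, 2, 3, 4, 5, 6}" if g: "g \<in> carrier G" "\<sigma> g 7 = 0" "\<sigma> g 0 = 7" "x \<in> {1, 2, 3, 4, 5, 6}" for g x
  proof -
    have x8: "x < 8" "x \<noteq> 0" "x \<noteq> 7" using g(4) by auto
    have "\<sigma> g x \<noteq> 7" "\<sigma> g x \<noteq> 0" using \<sigma>_inj[OF g(1) x8(1), of 0] \<sigma>_inj[OF g(1) x8(1), of 7] g(2,3) x8 by auto
    then show ?thesis using \<sigma>_lt[OF g(1) x8(1)] by auto
  qed
  have hinv: "\<sigma> (h \<otimes> g) x = \<sigma> h (\<sigma> g x)" "\<sigma> (g \<otimes> h) x = \<sigma> g (\<sigma> h x)" if "g \<in> carrier G" "x < 8" for g x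
    using that hG by (simp_all add: \<sigma>_mult)
  have hval: "\<sigma> h y = 2 * y mod 7" if "y \<in> {1, 2, 3, 4, 5, 6}" for y using hs that by auto
  have pv: "\<sigma> p 0 = 1" "\<sigma> p 1 = 2" "\<sigma> p 2 = 3" "\<sigma> p 3 = 4" "\<sigma> p 4 = 5" "\<sigma> p 5 = 6" "\<sigma> p 6 = 0" "\<sigma> p 7 = 7"
    by (simp_all add: \<sigma>_p)
  have not_comm: "w \<otimes> h \<noteq> h \<otimes> w"
  proof
    assume c: "w \<otimes> h = h \<otimes> w"
    have step: "\<sigma> w (\<sigma> h x) = 2 * \<sigma> w x mod 7" if "x \<in> {1, 2, 3, 4, 5, 6}" for x
    proof -
      have "x < 8" using that by auto
      then have "\<sigma> w (\<sigma> h x) = \<sigma> h (\<sigma> w x)" using hinv[OF w(1), of x] c by simp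
      then show ?thesis using hval inner[OF w(1,3,4) that] by simp
    qed
    have s2: "\<sigma> w 2 = 2 * \<sigma> w 1 mod 7" and s4: "\<sigma> w 4 = 2 * \<sigma> w 2 mod 7"
      and s6: "\<sigma> w 6 = 2 * \<sigma> w 3 mod 7" and s5: "\<sigma> w 5 = 2 * \<sigma> w 6 mod 7"
      using step[of 1] step[of 2] step[of 3] step[of 6] hs by simp_all
    have ww: "\<sigma> w (\<sigma> w x) = x" if "x < 8" for x
      using \<sigma>_mult[OF w(1) w(1) that] w(2) \<sigma>_one[OF that] by simp
    have c1: "\<sigma> w 1 \<in> {1, 2, 3, 4, 5, 6}" and c3: "\<sigma> w 3 \<in> {1, 2, 3, 4, 5, 6}"
      using inner[OF w(1,3,4)] by simp_all
    \<comment> \<open>If \<open>w\<close> maps 1 to a square, then one of \<open>w\<close>,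
      \<open>w \<otimes> h\<close>, \<open>w \<otimes> (h \<otimes> h)\<close> fixes the three
      points 1, 2, 4, although it moves 7.\<close>
    have three: False if x: "x \<in> {w, w \<otimes> h, w \<otimes> (h \<otimes> h)}" "\<sigma> x 1 = 1" "\<sigma> x 2 = 2" "\<sigma> x 4 = 4" for x
    proof -
      have xG: "x \<in> carrier G" and x7: "\<sigma> x 7 = 0" using x(1) w(1,3) hG hs by (auto simp: \<sigma>_mult)
      have "x = \<one>" by (rule two_fixed_points(2)[OF xG, of 1 2 4]) (use x in simp_all)
      then show False using x7 by (simp add: \<sigma>_one)
    qed
    consider "\<sigma> w 1 = 1" | "\<sigma> w 1 = 2" | "\<sigma> w 1 = 4" | "\<sigma> w 1 = 3" | "\<sigma> w 1 = 5" | "\<sigma> w 1 = 6"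
      using c1 by blast
    then show False
    proof cases
      case 1
      then show False using three[of w] s2 s4 by simp
    next
      case 2
      then have "\<sigma> w 2 = 4" "\<sigma> w 4 = 1" using s2 s4 by simp_all
      then show False using three[of "w \<otimes> (h \<otimes> h)"] 2 w(1) hG hs by (simp add: \<sigma>_mult)
    next
      case 3
      then have "\<sigma> w 2 = 1" "\<sigma> w 4 = 2" using s2 s4 by simp_all
      then show False using three[of "w \<otimes> h"] 3 w(1) hG hs by (simp add: \<sigma>_mult)
    next
      case 4
      \<comment> \<open>This value and the value 5 are the two exceptional involutions of the
        semilinear group; the remaining entries follow from commutation with \<open>h\<close> and
        from \<open>w \<otimes> w = \<one>\<close>.\<close>
      have v: "\<sigma> w 2 = 6" "\<sigma> w 4 = 5" "\<sigma> w 3 = 1" "\<sigma> w 6 = 2" "\<sigma> w 5 = 4"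
        using 4 s2 s4 ww[of 1] ww[of 2] ww[of 4] by simp_all
      have "\<sigma> w x = [7, 3, 6, 1, 5, 4, 2, 0] ! x" if "x < 8" for x
        using that by (rule less_8_cases) (simp_all add: v 4[unfolded One_nat_def] w(3,4))
      then show False using not_translates_closed[OF h w(1,2) c] translates_closed_3 by simp
    next
      case 5
      have v: "\<sigma> w 2 = 3" "\<sigma> w 4 = 6" "\<sigma> w 3 = 2" "\<sigma> w 6 = 4" "\<sigma> w 5 = 1"
        using 5 s2 s4 ww[of 1] ww[of 2] ww[of 4] by simp_all
      have "\<sigma> w x = [7, 5, 3, 2, 6, 1, 4, 0] ! x" if "x < 8" for x
        using that by (rule less_8_cases) (simp_all add: v 5[unfolded One_nat_def] w(3,4))
      then show False using not_translates_closed[OF h w(1,2) c] translates_closed_5 by simp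
    next
      case 6
      have v: "\<sigma> w 2 = 5" "\<sigma> w 4 = 3" "\<sigma> w 3 = 4" "\<sigma> w 6 = 1" "\<sigma> w 5 = 2"
        using 6 s2 s4 ww[of 1] ww[of 2] ww[of 4] by simp_all
      \<comment> \<open>Here \<open>w\<close> negates the nonzero finite points. For x = 1, 2, 3
        both x + 1 and -x are nonzero, so applying x -> -(x + 1) twice brings these points back,
        while 0 goes to 7.\<close>
      let ?x = "w \<otimes> (p \<otimes> (w \<otimes> p))"
      have xG: "?x \<in> carrier G" using w(1) p(1) by simp
      have xv: "\<sigma> ?x 1 = 1" "\<sigma> ?x 2 = 2" "\<sigma> ?x 3 = 3" "\<sigma> ?x 0 = 7"
        by (simp_all add: \<sigma>_mult w p(1) v 6[unfolded One_nat_def] pv[unfolded One_nat_def])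
      have "?x = \<one>" by (rule two_fixed_points(2)[OF xG, of 1 2 3]) (use xv in simp_all)
      then show False using xv(4) by (simp add: \<sigma>_one)
    qed
  qed
  then have w2: "w \<otimes> h = (h \<otimes> h) \<otimes> w" using wh by blast
  have step_gen: "\<sigma> g (\<sigma> h x) = 4 * \<sigma> g x mod 7"
    if g: "g \<in> carrier G" "\<sigma> g 7 = 0" "\<sigma> g 0 = 7" "g \<otimes> h = (h \<otimes> h) \<otimes> g" and x: "x \<in> {1, 2, 3, 4, 5, 6}" for g x
  proof -
    have x8: "x < 8" using x by auto
    have "\<sigma> g (\<sigma> h x) = \<sigma> (g \<otimes> h) x" using hinv[OF g(1) x8] by simp
    also have "\<dots> = \<sigma> h (\<sigma> h (\<sigma> g x))" unfolding g(4) using g(1) hG x8 \<sigma>_lt[OF g(1) x8] by (simp add: \<sigma>_mult)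
    also have "\<dots> = 4 * \<sigma> g x mod 7" using inner[OF g(1-3) x] by (elim insertE) (simp_all add: hs[unfolded One_nat_def])
    finally show ?thesis .
  qed
  have "\<exists>u. u \<in> carrier G \<and> u \<otimes> u = \<one> \<and> \<sigma> u 7 = 0 \<and> \<sigma> u 0 = 7 \<and> u \<otimes> h = (h \<otimes> h) \<otimes> u \<and> \<sigma> u 1 \<in> {1, 6}"
  proof -
    let ?Q = "\<lambda>u. u \<in> carrier G \<and> u \<otimes> u = \<one> \<and> \<sigma> u 7 = 0 \<and> \<sigma> u 0 = 7 \<and> u \<otimes> h = (h \<otimes> h) \<otimes> u"
    \<comment> \<open>Passing from \<open>u\<close> to \<open>u \<otimes> h\<close> keeps all
      properties and multiplies the value at 1 by 4. The orbits of this multiplication on the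
      nonzero residues are {1, 2, 4} and {3, 5, 6}, so 1 or 6 can be reached.\<close>
    have Qstep: "?Q (u \<otimes> h)" if u: "?Q u" for u
    proof -
      have uG: "u \<in> carrier G" and uu: "u \<otimes> u = \<one>" and uh: "u \<otimes> h = (h \<otimes> h) \<otimes> u" using u by simp_all
      have "(u \<otimes> h) \<otimes> (u \<otimes> h) = ((h \<otimes> h) \<otimes> u) \<otimes> (u \<otimes> h)" by (simp only: uh)
      also have "\<dots> = (h \<otimes> h) \<otimes> ((u \<otimes> u) \<otimes> h)" using uG hG by (simp add: m_assoc)
      also have "\<dots> = h \<otimes> (h \<otimes> h)" using hG by (simp add: uu m_assoc)
      finally have "(u \<otimes> h) \<otimes> (u \<otimes> h) = \<one>" using h3 by simp
      moreover have "(u \<otimes> h) \<otimes> h = (h \<otimes> h) \<otimes> (u \<otimes> h)" using uG hG by (simp add: uh m_assoc)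
      ultimately show ?thesis using u hG hs by (simp add: \<sigma>_mult)
    qed
    have Qval: "\<sigma> (u \<otimes> h) 1 = 4 * \<sigma> u 1 mod 7" if u: "?Q u" for u
      using step_gen[of u 1] u hinv(2)[of u 1] by simp
    have Qw: "?Q w" using w w2 by simp
    have Q1: "?Q (w \<otimes> h)" by (rule Qstep[OF Qw])
    have Q2: "?Q (w \<otimes> h \<otimes> h)" by (rule Qstep[OF Q1])
    have v1: "\<sigma> (w \<otimes> h) 1 = 4 * \<sigma> w 1 mod 7" by (rule Qval[OF Qw])
    have v2: "\<sigma> (w \<otimes> h \<otimes> h) 1 = 4 * \<sigma> (w \<otimes> h) 1 mod 7" by (rule Qval[OF Q1])
    have "\<sigma> w 1 \<in> {1, 2, 3, 4, 5, 6}" using inner[OF w(1,3,4)] by simp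
    then have "\<sigma> w 1 \<in> {1, 6} \<or> \<sigma> (w \<otimes> h) 1 \<in> {1, 6} \<or> \<sigma> (w \<otimes> h \<otimes> h) 1 \<in> {1, 6}"
      using v1 v2 by (elim insertE) simp_all
    then show ?thesis using Qw Q1 Q2 by blast
  qed
  then obtain u where u: "u \<in> carrier G" "u \<otimes> u = \<one>" "\<sigma> u 7 = 0" "\<sigma> u 0 = 7"
    and uh: "u \<otimes> h = (h \<otimes> h) \<otimes> u" and u1: "\<sigma> u 1 = 1 \<or> \<sigma> u 1 = 6" by blast
  have s2: "\<sigma> u 2 = 4 * \<sigma> u 1 mod 7" and s4: "\<sigma> u 4 = 4 * \<sigma> u 2 mod 7"
    and s6: "\<sigma> u 6 = 4 * \<sigma> u 3 mod 7" and s5: "\<sigma> u 5 = 4 * \<sigma> u 6 mod 7"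
    using step_gen[OF u(1,3,4) uh, of 1] step_gen[OF u(1,3,4) uh, of 2]
      step_gen[OF u(1,3,4) uh, of 3] step_gen[OF u(1,3,4) uh, of 6] hs by simp_all
  have uu: "\<sigma> u (\<sigma> u x) = x" if "x < 8" for x
    using \<sigma>_mult[OF u(1) u(1) that] u(2) \<sigma>_one[OF that] by simp
  have "\<sigma> u 1 \<noteq> 1"
  proof
    assume c: "\<sigma> u 1 = 1"
    then have v: "\<sigma> u 2 = 4" "\<sigma> u 4 = 2" using s2 s4 by simp_all
    \<comment> \<open>A second fixed point would give \<open>u\<close> a trivial cube, and with a
      trivial square it would be the identity. Such a point exists: \<open>u\<close> permutes 3, 5,
      6, and the relation with \<open>h\<close> makes one of them fixed, whichever value
      \<open>u\<close> takes at 3.\<close>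
    have two: False if x: "x < 8" "x \<noteq> 1" "\<sigma> u x = x" for x
    proof -
      have "u \<otimes> (u \<otimes> u) = \<one>" by (rule two_fixed_points(1)[OF u(1), of 1 x]) (use x c in simp_all)
      then have "u = \<one>" using u(1,2) by simp
      then show False using u(3) by (simp add: \<sigma>_one)
    qed
    have "\<sigma> u 3 \<in> {1, 2, 3, 4, 5, 6}" using inner[OF u(1,3,4)] by simp
    moreover have "\<sigma> u 3 \<noteq> 1" using \<sigma>_inj[OF u(1), of 3 1] c by auto
    moreover have "\<sigma> u 3 \<noteq> 2" using \<sigma>_inj[OF u(1), of 3 4] v by auto
    moreover have "\<sigma> u 3 \<noteq> 4" using \<sigma>_inj[OF u(1), of 3 2] v by auto
    ultimately consider "\<sigma> u 3 = 3" | "\<sigma> u 3 = 5" | "\<sigma> u 3 = 6" by blast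
    then show False
    proof cases
      case 1
      then show ?thesis using two[of 3] by simp
    next
      case 2
      then show ?thesis using two[of 6] s6 by simp
    next
      case 3
      then show ?thesis using two[of 5] s6 s5 by simp
    qed
  qed
  then have c6: "\<sigma> u 1 = 6" using u1 by blast
  have uv: "\<sigma> u 2 = 3" "\<sigma> u 4 = 5" "\<sigma> u 6 = 1" "\<sigma> u 3 = 2" "\<sigma> u 5 = 4"
    using c6 s2 s4 uu[of 1] uu[of 2] uu[of 4] by simp_all
  have h2: "h [^] (2::nat) = h \<otimes> h" using hG by (simp add: numeral_2_eq_2)
  have rel: "psl_relations G p h u"
  proof (intro psl_relations.intro psl_relations_axioms.intro is_group)
    show "p \<in> carrier G" "h \<in> carrier G" "u \<in> carrier G" by (rule p(1) hG u(1))+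
    show "p [^] (7::nat) = \<one>" by (rule p(2))
    show "h [^] (3::nat) = \<one>" using h3 hG by (simp add: numeral_eq_Suc m_assoc)
    show "u \<otimes> u = \<one>" by (rule u(2))
    show "u \<otimes> h = h [^] (2::nat) \<otimes> u" using uh by (simp add: h2)
    show "h \<otimes> p = p [^] (2::nat) \<otimes> h"
    proof (rule \<sigma>_eqI)
      fix x :: nat assume "x < 8"
      then show "\<sigma> (h \<otimes> p) x = \<sigma> (p [^] (2::nat) \<otimes> h) x"
        by (rule less_8_cases) (simp_all add: \<sigma>_mult hG p(1) hs[unfolded One_nat_def] pv[unfolded One_nat_def] \<sigma>_p_pow)
    qed (use hG p(1) in simp_all)
    show "u \<otimes> p \<otimes> u = p [^] (6::nat) \<otimes> u \<otimes> p [^] (6::nat)"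
    proof (rule \<sigma>_eqI)
      fix x :: nat assume "x < 8"
      then show "\<sigma> (u \<otimes> p \<otimes> u) x = \<sigma> (p [^] (6::nat) \<otimes> u \<otimes> p [^] (6::nat)) x"
        by (rule less_8_cases) (simp_all add: \<sigma>_mult u p(1) uv c6[unfolded One_nat_def] pv[unfolded One_nat_def] \<sigma>_p_pow)
    qed (use u(1) p(1) in simp_all)
  qed
  have "p \<noteq> \<one>" using pv(1) \<sigma>_one[of 0] by auto
  moreover have "h \<noteq> \<one>" using hs(3) \<sigma>_one[of 1] by auto
  moreover have "u \<noteq> \<one>" using u(3) \<sigma>_one[of 7] by auto
  ultimately show ?thesis by (rule iso_of_relations[OF order_168 rel])
qed

end

theorem theorem3p2:
  fixes G :: "('a, 'b) monoid_scheme"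
  assumes "simple_group G"
    and "finite (carrier G)"
    and "kappa_P G = kappa_P PSL2_7"
  shows "G \<cong> PSL2_7"
proof -
  interpret simple_group_kappa G
    using assms by (simp add: simple_group_kappa_def simple_group_kappa_axioms_def)
  obtain \<sigma> p where "projective_line_action G \<sigma> p" by (rule exists_projective_line_action)
  then interpret projective_line_action G \<sigma> p .
  show ?thesis by (rule iso_PSL2_7)
qed

end
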